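(* Let $M$ be a closed, connected, oriented 3-manifold and let $(\alpha_-,\alpha_+)$ be a Liouville pair on $M$. Let $V=\mathbb{R}_s\times M$ with the Liouville form $\lambda=e^{-s}\alpha_-+e^s\alpha_+$. Then the skeleton of $(V,\lambda)$ is of the form $$\mathfrak{skel}(V,\lambda)=\mathrm{graph}(\sigma):=\{(\sigma(x),x)\ :\ x\in M\}$$ for some continuous function $\sigma:M\to\mathbb{R}$.
   Context: A Liouville pair on $M$ is a pair $(\alpha_-,\alpha_+)$ of smooth 1-forms with $\alpha_-\wedge d\alpha_-<0$, $\alpha_+\wedge d\alpha_+>0$, such that $\lambda=e^{-s}\alpha_-+e^s\alpha_+$ on $\mathbb{R}_s\times M$ is a positive Liouville form, i.e. $d\lambda$ is nondegenerate and $d\lambda\wedge d\lambda>0$. The Liouville vector field $Z$ of $\lambda$ is defined by $\iota_Z d\lambda=\lambda$, with flow $(\phi_Z^t)$. The skeleton is $$\mathfrak{skel}(V,\lambda):=\bigcup_{K\subset V\text{ compact}}\ \bigcap_{t>0}\phi_Z^{-t}(K).$$ *)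

theory Defs
  imports "HOL-Analysis.Analysis"
begin

section \<open>Smooth maps between open subsets of normed spaces\<close>

text \<open>Both predicates are meant for open \<open>S\<close>, where \<open>frechet_derivative f (at x)\<close> is unique
  and depends only on the values of \<open>f\<close> on \<open>S\<close>.\<close>

primrec Ck_on :: "nat \<Rightarrow> 'a set \<Rightarrow> ('a::real_normed_vector \<Rightarrow> 'b::real_normed_vector) \<Rightarrow> bool" where
  "Ck_on 0 S f \<longleftrightarrow> continuous_on S f"
| "Ck_on (Suc k) S f \<longleftrightarrow>
     (\<forall>x\<in>S. f differentiable (at x)) \<and>
     (\<forall>v. Ck_on k S (\<lambda>x. frechet_derivative f (at x) v))"

definition smooth_on :: "'a set \<Rightarrow> ('a::real_normed_vector \<Rightarrow> 'b::real_normed_vector) \<Rightarrow> bool" where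
  "smooth_on S f \<longleftrightarrow> (\<forall>k. Ck_on k S f)"


section \<open>Smooth manifolds\<close>

text \<open>The underlying set of the manifold is the whole type \<open>'m\<close>, and its topology is the one given
  by the type class.  An atlas is an indexed family of charts \<open>coord A i : dom A i \<rightarrow> 'b\<close>,
  for \<open>i \<in> idx A\<close>, with values in a Euclidean model space \<open>'b\<close>.\<close>

record ('i, 'm, 'b) atlas =
  idx :: "'i set"
  dom :: "'i \<Rightarrow> 'm set"
  coord :: "'i \<Rightarrow> 'm \<Rightarrow> 'b"

definition param :: "('i, 'm, 'b) atlas \<Rightarrow> 'i \<Rightarrow> 'b \<Rightarrow> 'm" where
  "param A i = inv_into (dom A i) (coord A i)"

definition transition :: "('i, 'm, 'b) atlas \<Rightarrow> 'i \<Rightarrow> 'i \<Rightarrow> 'b \<Rightarrow> 'b" where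
  "transition A i j = coord A j \<circ> param A i"

text \<open>Chart images are open in the model space, so there is no boundary.\<close>

definition smooth_atlas ::
  "('i, 'm::{t2_space,second_countable_topology}, 'b::euclidean_space) atlas \<Rightarrow> bool" where
  "smooth_atlas A \<longleftrightarrow>
     (\<Union>i\<in>idx A. dom A i) = UNIV \<and>
     (\<forall>i\<in>idx A. open (dom A i) \<and> open (coord A i ` dom A i) \<and>
        homeomorphism (dom A i) (coord A i ` dom A i) (coord A i) (param A i)) \<and>
     (\<forall>i\<in>idx A. \<forall>j\<in>idx A. smooth_on (coord A i ` (dom A i \<inter> dom A j)) (transition A i j))"

text \<open>An orientation of a smooth manifold is given by an atlas whose transition maps all have
  positive Jacobian determinant; its charts are the positively oriented ones.\<close>

definition oriented_smooth_atlas ::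
  "('i, 'm::{t2_space,second_countable_topology}, real^'n) atlas \<Rightarrow> bool" where
  "oriented_smooth_atlas A \<longleftrightarrow> smooth_atlas A \<and>
     (\<forall>i\<in>idx A. \<forall>j\<in>idx A. \<forall>x\<in>coord A i ` (dom A i \<inter> dom A j).
        det (matrix (frechet_derivative (transition A i j) (at x))) > 0)"

definition closed_connected_oriented_3_manifold ::
  "('i, 'm::{t2_space,second_countable_topology}, real^3) atlas \<Rightarrow> bool" where
  "closed_connected_oriented_3_manifold A \<longleftrightarrow>
     oriented_smooth_atlas A \<and> compact (UNIV :: 'm set) \<and> connected (UNIV :: 'm set)"

text \<open>The product manifold \<open>\<real> \<times> M\<close>, with the \<open>\<real>\<close> factor first.  Its charts have the same index
  set as those of \<open>M\<close>.\<close>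

definition line_times :: "('i, 'm, 'b) atlas \<Rightarrow> ('i, real \<times> 'm, real \<times> 'b) atlas" where
  "line_times A = \<lparr> idx = idx A,
                    dom = (\<lambda>i. UNIV \<times> dom A i),
                    coord = (\<lambda>i (s, x). (s, coord A i x)) \<rparr>"


section \<open>Differential forms\<close>

text \<open>On the model space, \<open>\<omega> x v\<close> is the value of a 1-form at the point \<open>x\<close> on the vector \<open>v\<close>;
  similarly for forms of higher degree, with more vector arguments.\<close>

type_synonym 'b form1 = "'b \<Rightarrow> 'b \<Rightarrow> real"
type_synonym 'b form2 = "'b \<Rightarrow> 'b \<Rightarrow> 'b \<Rightarrow> real"
type_synonym 'b form3 = "'b \<Rightarrow> 'b \<Rightarrow> 'b \<Rightarrow> 'b \<Rightarrow> real"
type_synonym 'b form4 = "'b \<Rightarrow> 'b \<Rightarrow> 'b \<Rightarrow> 'b \<Rightarrow> 'b \<Rightarrow> real"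

text \<open>Exterior derivative and wedge products are normalised by
  \<open>d\<omega>(X,Y) = X(\<omega>(Y)) - Y(\<omega>(X)) - \<omega>([X,Y])\<close>, here with constant fields \<open>X, Y\<close>, and by summing
  over shuffles with signs.\<close>

definition ext_d :: "('b::real_normed_vector) form1 \<Rightarrow> 'b form2" where
  "ext_d \<omega> x u v = frechet_derivative (\<lambda>y. \<omega> y v) (at x) u
                 - frechet_derivative (\<lambda>y. \<omega> y u) (at x) v"

definition wedge12 :: "'b form1 \<Rightarrow> 'b form2 \<Rightarrow> 'b form3" where
  "wedge12 \<omega> \<eta> x u v w = \<omega> x u * \<eta> x v w - \<omega> x v * \<eta> x u w + \<omega> x w * \<eta> x u v"

definition wedge22 :: "'b form2 \<Rightarrow> 'b form2 \<Rightarrow> 'b form4" where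
  "wedge22 \<omega> \<eta> x t u v w =
       \<omega> x t u * \<eta> x v w - \<omega> x t v * \<eta> x u w + \<omega> x t w * \<eta> x u v
     + \<omega> x u v * \<eta> x t w - \<omega> x u w * \<eta> x t v + \<omega> x v w * \<eta> x t u"

text \<open>A smooth 1-form on a manifold is a family of smooth 1-forms \<open>\<omega> i\<close> on the chart images
  that are related by pullback along the transition maps.\<close>

definition smooth_1form :: "('i, 'm, 'b::euclidean_space) atlas \<Rightarrow> ('i \<Rightarrow> 'b form1) \<Rightarrow> bool" where
  "smooth_1form A \<omega> \<longleftrightarrow>
     (\<forall>i\<in>idx A. (\<forall>x\<in>coord A i ` dom A i. linear (\<omega> i x)) \<and>
        (\<forall>v. smooth_on (coord A i ` dom A i) (\<lambda>x. \<omega> i x v))) \<and>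
     (\<forall>i\<in>idx A. \<forall>j\<in>idx A. \<forall>x\<in>coord A i ` (dom A i \<inter> dom A j). \<forall>v.
        \<omega> i x v = \<omega> j (transition A i j x) (frechet_derivative (transition A i j) (at x) v))"

text \<open>Signs of top-degree forms on an oriented 3-manifold, and on \<open>\<real> \<times> M\<close> with the product
  orientation: a form is compared with the standard positive frame in every oriented chart.\<close>

definition positive_3form :: "('i, 'm, real^3) atlas \<Rightarrow> ('i \<Rightarrow> (real^3) form3) \<Rightarrow> bool" where
  "positive_3form A \<omega> \<longleftrightarrow>
     (\<forall>i\<in>idx A. \<forall>x\<in>coord A i ` dom A i. \<omega> i x (axis 1 1) (axis 2 1) (axis 3 1) > 0)"

definition negative_3form :: "('i, 'm, real^3) atlas \<Rightarrow> ('i \<Rightarrow> (real^3) form3) \<Rightarrow> bool" where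
  "negative_3form A \<omega> \<longleftrightarrow>
     (\<forall>i\<in>idx A. \<forall>x\<in>coord A i ` dom A i. \<omega> i x (axis 1 1) (axis 2 1) (axis 3 1) < 0)"

definition positive_4form ::
  "('i, 'v, real \<times> (real^3)) atlas \<Rightarrow> ('i \<Rightarrow> (real \<times> (real^3)) form4) \<Rightarrow> bool" where
  "positive_4form A \<omega> \<longleftrightarrow>
     (\<forall>i\<in>idx A. \<forall>x\<in>coord A i ` dom A i.
        \<omega> i x (1, 0) (0, axis 1 1) (0, axis 2 1) (0, axis 3 1) > 0)"

definition nondegenerate_2form ::
  "('i, 'm, 'b::euclidean_space) atlas \<Rightarrow> ('i \<Rightarrow> 'b form2) \<Rightarrow> bool" where
  "nondegenerate_2form A \<omega> \<longleftrightarrow>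
     (\<forall>i\<in>idx A. \<forall>x\<in>coord A i ` dom A i. \<forall>u. (\<forall>v. \<omega> i x u v = 0) \<longrightarrow> u = 0)"


section \<open>Liouville pairs\<close>

definition positive_liouville_form ::
  "('i, 'v, real \<times> (real^3)) atlas \<Rightarrow> ('i \<Rightarrow> (real \<times> (real^3)) form1) \<Rightarrow> bool" where
  "positive_liouville_form A \<omega> \<longleftrightarrow>
     nondegenerate_2form A (\<lambda>i. ext_d (\<omega> i)) \<and>
     positive_4form A (\<lambda>i. wedge22 (ext_d (\<omega> i)) (ext_d (\<omega> i)))"

text \<open>The 1-form \<open>e\<^sup>-\<^sup>s \<alpha>\<^sub>- + e\<^sup>s \<alpha>\<^sub>+\<close> on \<open>\<real> \<times> M\<close>, where \<open>\<alpha>\<^sub>-\<close> and \<open>\<alpha>\<^sub>+\<close> are pulled back along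
  the projection to \<open>M\<close>; it therefore ignores the \<open>\<real>\<close>-component of a tangent vector.\<close>

definition pair_form ::
  "('i \<Rightarrow> 'b form1) \<Rightarrow> ('i \<Rightarrow> 'b form1) \<Rightarrow> 'i \<Rightarrow> (real \<times> 'b) form1" where
  "pair_form \<alpha>m \<alpha>p i = (\<lambda>(s, x) (a, v). exp (- s) * \<alpha>m i x v + exp s * \<alpha>p i x v)"

definition liouville_pair ::
  "('i, 'm, real^3) atlas \<Rightarrow> ('i \<Rightarrow> (real^3) form1) \<Rightarrow> ('i \<Rightarrow> (real^3) form1) \<Rightarrow> bool" where
  "liouville_pair A \<alpha>m \<alpha>p \<longleftrightarrow>
     smooth_1form A \<alpha>m \<and> smooth_1form A \<alpha>p \<and>
     negative_3form A (\<lambda>i. wedge12 (\<alpha>m i) (ext_d (\<alpha>m i))) \<and>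
     positive_3form A (\<lambda>i. wedge12 (\<alpha>p i) (ext_d (\<alpha>p i))) \<and>
     positive_liouville_form (line_times A) (pair_form \<alpha>m \<alpha>p)"


section \<open>Liouville vector field, flow, skeleton\<close>

text \<open>A vector field is given by its chart representatives.  The following one is the solution of
  \<open>\<iota>\<^sub>Z d\<omega> = \<omega>\<close>, which exists and is unique when \<open>d\<omega>\<close> is nondegenerate.\<close>

definition liouville_vector_field ::
  "('i \<Rightarrow> ('b::euclidean_space) form1) \<Rightarrow> 'i \<Rightarrow> 'b \<Rightarrow> 'b" where
  "liouville_vector_field \<omega> i x = (THE z. \<forall>w. ext_d (\<omega> i) x z w = \<omega> i x w)"

definition integral_curve ::
  "('i, 'v::topological_space, 'b::euclidean_space) atlas \<Rightarrow> ('i \<Rightarrow> 'b \<Rightarrow> 'b)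
     \<Rightarrow> real set \<Rightarrow> (real \<Rightarrow> 'v) \<Rightarrow> bool" where
  "integral_curve A X J \<gamma> \<longleftrightarrow> continuous_on J \<gamma> \<and>
     (\<forall>t\<in>J. \<forall>i\<in>idx A. \<gamma> t \<in> dom A i \<longrightarrow>
        ((\<lambda>u. coord A i (\<gamma> u)) has_vector_derivative X i (coord A i (\<gamma> t))) (at t within J))"

text \<open>The image of \<open>S\<close> under the time \<open>t\<close> flow map of \<open>X\<close>, for \<open>t\<close> of either sign; points whose
  trajectory does not exist up to time \<open>t\<close> contribute nothing.\<close>

definition flow_image ::
  "('i, 'v::topological_space, 'b::euclidean_space) atlas \<Rightarrow> ('i \<Rightarrow> 'b \<Rightarrow> 'b)
     \<Rightarrow> real \<Rightarrow> 'v set \<Rightarrow> 'v set" where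
  "flow_image A X t S = {\<gamma> t | \<gamma>. integral_curve A X (closed_segment 0 t) \<gamma> \<and> \<gamma> 0 \<in> S}"

definition skeleton ::
  "('i, 'v::topological_space, 'b::euclidean_space) atlas \<Rightarrow> ('i \<Rightarrow> 'b form1) \<Rightarrow> 'v set" where
  "skeleton A \<omega> = (\<Union>K\<in>{K. compact K}. \<Inter>t\<in>{0<..}.
      flow_image A (liouville_vector_field \<omega>) (- t) K)"

definition graph_over :: "('m \<Rightarrow> real) \<Rightarrow> (real \<times> 'm) set" where
  "graph_over \<sigma> = {(\<sigma> x, x) | x. x \<in> UNIV}"

end

theory Submission
  imports Defs
begin

text \<open>
  Why the skeleton is a graph.  Write \<open>p\<close>, \<open>q\<close> for \<open>\<alpha>\<^sub>-\<close>, \<open>\<alpha>\<^sub>+\<close> and put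
  \<open>\<mu> = e\<^sup>s q - e\<^sup>-\<^sup>s p\<close>, the contraction of \<open>d\<lambda>\<close> with \<open>\<partial>/\<partial>s\<close>.  The Liouville field has the form
  \<open>Z = (g \<partial>/\<partial>s + X) / f\<close>, where, as multiples of the volume form \<open>q \<and> dq\<close> of \<open>M\<close>,
  \<open>f = e\<^sup>2\<^sup>s + a e\<^sup>-\<^sup>2\<^sup>s + c\<close> represents \<open>\<mu> \<and> (e\<^sup>s dq + e\<^sup>-\<^sup>s dp)\<close> and is positive because
  \<open>d\<lambda> \<and> d\<lambda> > 0\<close>, \<open>g = e\<^sup>2\<^sup>s - a e\<^sup>-\<^sup>2\<^sup>s + d\<close> represents \<open>\<lambda> \<and> (e\<^sup>s dq + e\<^sup>-\<^sup>s dp)\<close>, and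
  \<open>X\<close> takes values in the common kernel of \<open>p\<close> and \<open>q\<close> and represents \<open>\<lambda> \<and> \<mu> = 2 p \<and> q\<close>.  The functions \<open>a\<close>, \<open>c\<close>,
  \<open>d\<close> live on \<open>M\<close>, and \<open>a > 0\<close> because \<open>p \<and> dp < 0\<close>.

  Two things are decisive: \<open>X\<close> does not depend on \<open>s\<close>, and \<open>g\<close> is strictly increasing in \<open>s\<close>, at a
  rate bounded below.  Up to the positive factor \<open>1 / f\<close>, which only changes the speed, trajectories of
  \<open>Z\<close> therefore lie over trajectories of \<open>X\<close> on the compact manifold \<open>M\<close>, and two trajectories over
  the same one separate exponentially fast.  Hence over each point of \<open>M\<close> at most one trajectory
  stays bounded in the future (\<open>bounded_future_graph\<close>).  That there is one, and that its height depends
  continuously on the point, is the existence of an invariant graph for a fibrewise expanding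
  equation: the height \<open>\<sigma>\<close> is the fixed point of a contraction on continuous functions
  (\<open>expanding_invariant_graph\<close>).  As the skeleton is the set of points with bounded future, it is
  the graph of \<open>\<sigma>\<close>.

  The analytic input is the semiflow of \<open>X\<close>, obtained from Picard iteration in charts
  (\<open>picard_short_time\<close>) and glued along \<open>M\<close> by uniqueness and compactness.  The geometric input is that
  \<open>X\<close>, \<open>a\<close>, \<open>c\<close>, \<open>d\<close>, computed in charts, agree on overlaps; this rests on the naturality of the exterior
  derivative (\<open>ext_d_pullback\<close>).
\<close>

section \<open>Ordinary differential equations with a Lipschitz right-hand side\<close>

text \<open>On a time interval so short that the mean value inequality gives
  \<open>sup |y - z| \<le> |y t0 - z t0| + (sup |y - z|) / 2\<close>, the supremum can be absorbed.  With \<open>z t0 = y t0\<close>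
  this is uniqueness, otherwise continuous dependence on the initial value.  The factor \<open>\<theta>\<close> is a
  time-dependent speed, so that the estimate also covers reparametrised solutions.\<close>

lemma solutions_gap_le:
  fixes X :: "'b::real_normed_vector \<Rightarrow> 'b"
  assumes lip: "L-lipschitz_on U X"
    and y: "\<And>s. s \<in> {a..b} \<Longrightarrow> y s \<in> U \<and> (y has_vector_derivative \<theta> s *\<^sub>R X (y s)) (at s within {a..b})"
    and z: "\<And>s. s \<in> {a..b} \<Longrightarrow> z s \<in> U \<and> (z has_vector_derivative \<theta> s *\<^sub>R X (z s)) (at s within {a..b})"
    and \<theta>: "\<And>s. s \<in> {a..b} \<Longrightarrow> \<bar>\<theta> s\<bar> \<le> \<Theta>"
    and short: "(b - a) * (\<Theta> * L) \<le> 1/2"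
    and t0: "t0 \<in> {a..b}" and t: "t \<in> {a..b}"
  shows "norm (y t - z t) \<le> 2 * norm (y t0 - z t0)"
proof -
  define w where "w s = y s - z s" for s
  have deriv: "(w has_vector_derivative \<theta> s *\<^sub>R (X (y s) - X (z s))) (at s within {a..b})"
    if "s \<in> {a..b}" for s
    unfolding w_def using has_vector_derivative_diff[OF y[OF that, THEN conjunct2] z[OF that, THEN conjunct2]]
    by (simp add: scaleR_right_diff_distrib)
  have "continuous_on {a..b} w"
    using deriv has_vector_derivative_continuous continuous_on_eq_continuous_within by blast
  then have "continuous_on {a..b} (\<lambda>s. norm (w s))" by (rule continuous_on_norm)
  then obtain t1 where t1: "t1 \<in> {a..b}" and max: "\<And>s. s \<in> {a..b} \<Longrightarrow> norm (w s) \<le> norm (w t1)"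
    using continuous_attains_sup[of "{a..b}" "\<lambda>s. norm (w s)"] t by auto
  have L0: "L \<ge> 0" using lip lipschitz_on_nonneg by blast
  have \<Theta>0: "\<Theta> \<ge> 0" using \<theta>[OF t] by linarith
  have "norm (w t1 - w t0) \<le> (\<Theta> * L * norm (w t1)) * norm (t1 - t0)"
  proof (rule differentiable_bound[of "{a..b}" w "\<lambda>s h. h *\<^sub>R (\<theta> s *\<^sub>R (X (y s) - X (z s)))"])
    fix s assume s: "s \<in> {a..b}"
    show "(w has_derivative (\<lambda>h. h *\<^sub>R (\<theta> s *\<^sub>R (X (y s) - X (z s))))) (at s within {a..b})"
      using deriv[OF s] by (simp add: has_vector_derivative_def)
    have "norm (X (y s) - X (z s)) \<le> L * norm (w s)"
      using lipschitz_on_normD[OF lip] y[OF s] z[OF s] by (simp add: w_def)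
    also have "\<dots> \<le> L * norm (w t1)" using max[OF s] L0 by (simp add: mult_left_mono)
    finally have "norm (\<theta> s *\<^sub>R (X (y s) - X (z s))) \<le> \<Theta> * (L * norm (w t1))"
      using \<theta>[OF s] \<Theta>0 by (simp add: mult_mono)
    then show "onorm (\<lambda>h. h *\<^sub>R (\<theta> s *\<^sub>R (X (y s) - X (z s)))) \<le> \<Theta> * L * norm (w t1)"
      by (intro onorm_le)
         (metis mult.assoc mult.commute mult_left_mono norm_ge_zero norm_scaleR real_norm_def)
  qed (use t0 t1 in auto)
  also have "\<dots> \<le> (\<Theta> * L * norm (w t1)) * (b - a)"
    using t0 t1 L0 \<Theta>0 by (intro mult_left_mono) auto
  also have "\<dots> = ((b - a) * (\<Theta> * L)) * norm (w t1)" by simp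
  also have "\<dots> \<le> 1/2 * norm (w t1)" using short by (intro mult_right_mono) auto
  finally have "norm (w t1 - w t0) \<le> norm (w t1) / 2" by simp
  then have "norm (w t1) \<le> 2 * norm (w t0)"
    using norm_triangle_sub[of "w t1" "w t0"] by linarith
  then show ?thesis using max[OF t] by (simp add: w_def)
qed

text \<open>Picard iteration.  Precomposing the field with the nearest-point retraction onto the ball makes
  it globally Lipschitz, and freezing the curve outside \<open>{0..T}\<close> turns the integral operator into a
  contraction of the complete space of bounded continuous functions on the line; for small \<open>T\<close> the
  fixed point does not leave the ball, so that the retraction does not act on it.\<close>

lemma picard_short_time:
  fixes X :: "'b::euclidean_space \<Rightarrow> 'b"
  assumes lip: "L-lipschitz_on (cball \<xi> r) X" and r: "r > 0"
  obtains T c where "T > 0" "T * L \<le> 1/2"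
    "\<And>\<eta>. \<eta> \<in> cball \<xi> (r/2) \<Longrightarrow> c \<eta> 0 = \<eta>"
    "\<And>\<eta> t. \<eta> \<in> cball \<xi> (r/2) \<Longrightarrow> t \<in> {0..T} \<Longrightarrow> c \<eta> t \<in> cball \<xi> r \<and>
        (c \<eta> has_vector_derivative X (c \<eta> t)) (at t within {0..T})"
proof -
  define P where "P = closest_point (cball \<xi> r)"
  define X' where "X' = X \<circ> P"
  have P_in: "P y \<in> cball \<xi> r" for y
    unfolding P_def using r by (intro closest_point_in_set) auto
  have P_id: "P y = y" if "y \<in> cball \<xi> r" for y
    unfolding P_def using that by (rule closest_point_self)
  have P_lip: "dist (P x) (P y) \<le> dist x y" for x y
    unfolding P_def using r by (intro closest_point_lipschitz) auto
  have L0: "L \<ge> 0" using lip lipschitz_on_nonneg by blast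
  have X'_lip: "L-lipschitz_on UNIV X'"
  proof (rule lipschitz_onI)
    fix x y
    have "dist (X' x) (X' y) \<le> L * dist (P x) (P y)"
      unfolding X'_def using lipschitz_onD[OF lip P_in P_in] by simp
    also have "\<dots> \<le> L * dist x y" using P_lip L0 by (simp add: mult_left_mono)
    finally show "dist (X' x) (X' y) \<le> L * dist x y" .
  qed (rule L0)
  have X'_cont: "continuous_on S X'" for S
    using lipschitz_on_continuous_on[OF X'_lip] continuous_on_subset by blast
  have "compact (X ` cball \<xi> r)"
    using lipschitz_on_continuous_on[OF lip] by (intro compact_continuous_image) auto
  then obtain B where B0: "B > 0" and B': "\<And>y. y \<in> X ` cball \<xi> r \<Longrightarrow> norm y \<le> B"
    using compact_imp_bounded bounded_pos by metis
  have B: "norm (X' y) \<le> B" for y using B'[of "X' y"] P_in by (simp add: X'_def)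
  \<comment> \<open>Up to time \<open>T\<close> a curve of speed at most \<open>B\<close> moves by at most \<open>r / 2\<close>, and the integral operator
    contracts by the factor \<open>T * L\<close>.\<close>
  define T where "T = min (r / (2 * B)) (1 / (2 * (L + 1)))"
  have T0: "T > 0" using r B0 L0 by (simp add: T_def)
  have TB: "T * B \<le> r / 2"
  proof -
    have "T * B \<le> r / (2 * B) * B" using B0 by (intro mult_right_mono) (auto simp: T_def)
    then show ?thesis using B0 by simp
  qed
  have TL: "T * L \<le> 1/2"
  proof -
    have "T * L \<le> 1 / (2 * (L + 1)) * L" using L0 by (intro mult_right_mono) (auto simp: T_def)
    also have "\<dots> \<le> 1/2" using L0 by (simp add: field_simps)
    finally show ?thesis .
  qed
  define k where "k t = max 0 (min T t)" for t
  have k_in: "k t \<in> {0..T}" for t using T0 by (auto simp: k_def)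
  have k_id: "k t = t" if "t \<in> {0..T}" for t using that by (auto simp: k_def)
  have k_cont: "continuous_on UNIV k" unfolding k_def by (intro continuous_intros)
  define step where "step \<eta> y t = \<eta> + integral {0..k t} (\<lambda>s. X' (y s))" for \<eta> and y :: "real \<Rightarrow> 'b" and t
  have X'y_cont: "continuous_on S (\<lambda>s. X' (y s))" if "continuous_on UNIV y" for y :: "real \<Rightarrow> 'b" and S
    by (rule continuous_on_compose2[OF X'_cont[of UNIV] continuous_on_subset[OF that]]) auto
  have int: "(\<lambda>s. X' (y s)) integrable_on {0..k t}" if "continuous_on UNIV y" for y :: "real \<Rightarrow> 'b" and t
    by (intro integrable_continuous_real X'y_cont that)
  have drift: "norm (step \<eta> y t - \<eta>) \<le> T * B" if "continuous_on UNIV y" for \<eta> y t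
  proof -
    have "norm (integral {0..k t} (\<lambda>s. X' (y s))) \<le> B * (k t - 0)"
      by (rule integral_bound)
         (use k_in[of t] B X'y_cont[OF that] in auto)
    also have "\<dots> \<le> B * T" using k_in[of t] B0 by (intro mult_left_mono) auto
    finally show ?thesis by (simp add: step_def mult.commute)
  qed
  have step_bcont: "step \<eta> y \<in> bcontfun" if y: "continuous_on UNIV y" for \<eta> y
  proof (rule bcontfun_normI)
    have "(\<lambda>s. X' (y s)) integrable_on {0..T}"
      using int[OF y, of T] by (simp add: k_def T0 less_imp_le)
    then have "continuous_on {0..T} (\<lambda>u. integral {0..u} (\<lambda>s. X' (y s)))"
      by (rule indefinite_integral_continuous_1)
    then have "continuous_on UNIV (\<lambda>t. integral {0..k t} (\<lambda>s. X' (y s)))"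
      by (rule continuous_on_compose2) (use k_cont k_in in auto)
    then show "continuous_on UNIV (step \<eta> y)"
      unfolding step_def[abs_def] by (intro continuous_intros)
    show "norm (step \<eta> y t) \<le> norm \<eta> + T * B" for t
      using drift[OF y, of \<eta> t] norm_triangle_sub[of "step \<eta> y t" \<eta>] by linarith
  qed
  have "\<exists>y. continuous_on UNIV y \<and> (\<forall>t. y t = step \<eta> y t)" for \<eta>
  proof -
    define \<Phi> where "\<Phi> y = Bcontfun (step \<eta> (apply_bcontfun y))" for y
    have app: "apply_bcontfun (\<Phi> y) = step \<eta> (apply_bcontfun y)" for y
      unfolding \<Phi>_def by (rule Bcontfun_inverse) (intro step_bcont continuous_on_apply_bcontfun)
    have "dist (\<Phi> y) (\<Phi> z) \<le> 1/2 * dist y z" for y z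
    proof (rule dist_bound)
      fix t
      have "step \<eta> y t - step \<eta> z t = integral {0..k t} (\<lambda>s. X' (y s) - X' (z s))"
        by (simp add: step_def integral_diff int)
      also have "norm \<dots> \<le> (L * dist y z) * (k t - 0)"
      proof (rule integral_bound)
        show "continuous_on {0..k t} (\<lambda>s. X' (apply_bcontfun y s) - X' (apply_bcontfun z s))"
          by (intro continuous_intros continuous_on_compose2[OF X'_cont[of UNIV]]) auto
        show "norm (X' (apply_bcontfun y s) - X' (apply_bcontfun z s)) \<le> L * dist y z" for s
        proof -
          have "norm (X' (apply_bcontfun y s) - X' (apply_bcontfun z s)) \<le> L * dist (apply_bcontfun y s) (apply_bcontfun z s)"
            using lipschitz_onD[OF X'_lip] by (simp add: dist_norm)
          also have "\<dots> \<le> L * dist y z" using dist_bounded L0 by (intro mult_left_mono) auto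
          finally show ?thesis .
        qed
      qed (use k_in[of t] in auto)
      also have "\<dots> \<le> (L * dist y z) * T" using k_in[of t] L0 by (intro mult_left_mono) auto
      also have "\<dots> = (T * L) * dist y z" by simp
      also have "\<dots> \<le> 1/2 * dist y z" using TL by (intro mult_right_mono) auto
      finally show "dist (apply_bcontfun (\<Phi> y) t) (apply_bcontfun (\<Phi> z) t) \<le> 1/2 * dist y z"
        by (simp add: app dist_norm)
    qed
    then have "\<exists>!y. \<Phi> y = y" by (intro banach_fix_type[of "1/2"]) auto
    then obtain y where "\<Phi> y = y" by auto
    then show ?thesis using app[of y] by (intro exI[of _ "apply_bcontfun y"]) auto
  qed
  then obtain c where c_cont: "\<And>\<eta>. continuous_on UNIV (c \<eta>)" and c_fix: "\<And>\<eta> t. c \<eta> t = step \<eta> (c \<eta>) t"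
    by metis
  show ?thesis
  proof (rule that[OF T0 TL])
    fix \<eta> assume \<eta>: "\<eta> \<in> cball \<xi> (r/2)"
    show "c \<eta> 0 = \<eta>" by (subst c_fix) (simp add: step_def k_def T0 less_imp_le)
    fix t assume t: "t \<in> {0..T}"
    have in_ball: "c \<eta> s \<in> cball \<xi> r" for s
    proof -
      have "norm (c \<eta> s - \<eta>) \<le> r / 2"
        using drift[OF c_cont, of \<eta> \<eta> s] TB c_fix[of \<eta> s] by simp
      then show ?thesis using \<eta> dist_triangle[of \<xi> "c \<eta> s" \<eta>]
        by (simp add: dist_norm norm_minus_commute)
    qed
    have "((\<lambda>u. integral {0..u} (\<lambda>s. X' (c \<eta> s))) has_vector_derivative X' (c \<eta> t)) (at t within {0..T})"
      by (rule integral_has_vector_derivative)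
         (use t X'y_cont[OF c_cont] in auto)
    then have "((\<lambda>u. \<eta> + integral {0..u} (\<lambda>s. X' (c \<eta> s))) has_vector_derivative X' (c \<eta> t)) (at t within {0..T})"
      by (auto intro!: derivative_eq_intros)
    then have "(c \<eta> has_vector_derivative X' (c \<eta> t)) (at t within {0..T})"
      by (rule has_vector_derivative_transform[OF t, rotated]) (subst c_fix, simp add: step_def k_id)
    moreover have "X' (c \<eta> t) = X (c \<eta> t)" using P_id[OF in_ball] by (simp add: X'_def)
    ultimately show "c \<eta> t \<in> cball \<xi> r \<and> (c \<eta> has_vector_derivative X (c \<eta> t)) (at t within {0..T})"
      using in_ball by simp
  qed
qed

section \<open>The semiflow of a vector field on a compact manifold\<close>

text \<open>Integral curves of \<open>X\<close> run at the speed \<open>\<theta> t\<close>.  The base component of a trajectory of the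
  Liouville field is such a curve, with a speed that depends on the fibre component.\<close>

definition speed_curve ::
  "('i, 'v::topological_space, 'b::euclidean_space) atlas \<Rightarrow> ('i \<Rightarrow> 'b \<Rightarrow> 'b)
     \<Rightarrow> (real \<Rightarrow> real) \<Rightarrow> real set \<Rightarrow> (real \<Rightarrow> 'v) \<Rightarrow> bool" where
  "speed_curve A X \<theta> J \<gamma> \<longleftrightarrow> continuous_on J \<gamma> \<and>
     (\<forall>t\<in>J. \<forall>i\<in>idx A. \<gamma> t \<in> dom A i \<longrightarrow>
        ((\<lambda>u. coord A i (\<gamma> u)) has_vector_derivative \<theta> t *\<^sub>R X i (coord A i (\<gamma> t))) (at t within J))"

lemma integral_curve_iff_unit_speed: "integral_curve A X J \<gamma> \<longleftrightarrow> speed_curve A X (\<lambda>_. 1) J \<gamma>"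
  by (simp add: integral_curve_def speed_curve_def)

lemma speed_curve_continuous: "speed_curve A X \<theta> J \<gamma> \<Longrightarrow> continuous_on J \<gamma>"
  by (simp add: speed_curve_def)

lemma speed_curve_deriv:
  assumes "speed_curve A X \<theta> J \<gamma>" "t \<in> J" "i \<in> idx A" "\<gamma> t \<in> dom A i"
  shows "((\<lambda>u. coord A i (\<gamma> u)) has_vector_derivative \<theta> t *\<^sub>R X i (coord A i (\<gamma> t))) (at t within J)"
  using assms by (simp add: speed_curve_def)

lemma speed_curve_subset: "speed_curve A X \<theta> J \<gamma> \<Longrightarrow> K \<subseteq> J \<Longrightarrow> speed_curve A X \<theta> K \<gamma>"
  unfolding speed_curve_def
  by (meson continuous_on_subset has_vector_derivative_within_subset subsetD)

lemma speed_curve_cong: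
  assumes "\<And>t. t \<in> J \<Longrightarrow> \<gamma> t = \<delta> t" "\<And>t. t \<in> J \<Longrightarrow> \<theta> t = \<theta>' t"
  shows "speed_curve A X \<theta> J \<gamma> \<longleftrightarrow> speed_curve A X \<theta>' J \<delta>"
proof -
  have "((\<lambda>u. coord A i (\<gamma> u)) has_vector_derivative v) (at t within J) \<longleftrightarrow>
        ((\<lambda>u. coord A i (\<delta> u)) has_vector_derivative v) (at t within J)" if "t \<in> J" for i v t
    using assms that by (auto elim!: has_vector_derivative_transform[rotated 2])
  moreover have "continuous_on J \<gamma> \<longleftrightarrow> continuous_on J \<delta>" using assms by (intro continuous_on_cong) auto
  ultimately show ?thesis using assms by (simp add: speed_curve_def)
qed

lemma speed_curve_reparam:
  assumes \<gamma>: "speed_curve A X \<theta> J \<gamma>"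
    and h: "\<And>t. t \<in> K \<Longrightarrow> (h has_vector_derivative h' t) (at t within K)" and sub: "h ` K \<subseteq> J"
  shows "speed_curve A X (\<lambda>t. h' t * \<theta> (h t)) K (\<lambda>t. \<gamma> (h t))"
  unfolding speed_curve_def
proof (intro conjI ballI impI)
  have "continuous_on K h"
    using h has_vector_derivative_continuous continuous_on_eq_continuous_within by blast
  then show "continuous_on K (\<lambda>t. \<gamma> (h t))"
    using continuous_on_compose2[OF speed_curve_continuous[OF \<gamma>]] sub by blast
  fix t i assume t: "t \<in> K" "i \<in> idx A" "\<gamma> (h t) \<in> dom A i"
  have "((\<lambda>u. coord A i (\<gamma> u)) \<circ> h has_vector_derivative h' t *\<^sub>R (\<theta> (h t) *\<^sub>R X i (coord A i (\<gamma> (h t)))))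
      (at t within K)"
    by (rule vector_diff_chain_within[OF h[OF t(1)]
          has_vector_derivative_within_subset[OF speed_curve_deriv[OF \<gamma>]]]) (use t sub in auto)
  then show "((\<lambda>u. coord A i (\<gamma> (h u))) has_vector_derivative
      (h' t * \<theta> (h t)) *\<^sub>R X i (coord A i (\<gamma> (h t)))) (at t within K)"
    by (simp add: o_def)
qed

lemma speed_curve_shift:
  assumes "speed_curve A X (\<lambda>_. 1) J \<gamma>" "(\<lambda>t. t + a) ` K \<subseteq> J"
  shows "speed_curve A X (\<lambda>_. 1) K (\<lambda>t. \<gamma> (t + a))"
proof -
  have "((\<lambda>t. t + a) has_vector_derivative 1) (at t within K)" for t
    by (auto intro!: derivative_eq_intros)
  from speed_curve_reparam[OF assms(1) this assms(2)] show ?thesis by simp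
qed

lemma speed_curve_concat:
  assumes \<gamma>: "speed_curve A X (\<lambda>_. 1) {0..T} \<gamma>" and \<delta>: "speed_curve A X (\<lambda>_. 1) {0..e} \<delta>"
    and glue: "\<gamma> T = \<delta> 0" and T: "T \<ge> 0" "e \<ge> 0"
  shows "speed_curve A X (\<lambda>_. 1) {0..T+e} (\<lambda>t. if t \<in> {0..T} then \<gamma> t else \<delta> (t - T))"
proof -
  have \<delta>': "speed_curve A X (\<lambda>_. 1) {T..T+e} (\<lambda>t. \<delta> (t - T))"
    using speed_curve_shift[OF \<delta>, of "-T" "{T..T+e}"] by auto
  have un: "{0..T+e} = {0..T} \<union> {T..T+e}" using T by auto
  show ?thesis unfolding speed_curve_def
  proof (intro conjI ballI impI)
    show "continuous_on {0..T+e} (\<lambda>t. if t \<in> {0..T} then \<gamma> t else \<delta> (t - T))"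
      unfolding un by (rule continuous_on_cases)
        (use speed_curve_continuous[OF \<gamma>] speed_curve_continuous[OF \<delta>'] glue in auto)
    fix t i assume t: "t \<in> {0..T+e}" and i: "i \<in> idx A"
      and d: "(if t \<in> {0..T} then \<gamma> t else \<delta> (t - T)) \<in> dom A i"
    have "((\<lambda>u. if u \<in> {0..T} then coord A i (\<gamma> u) else coord A i (\<delta> (u - T))) has_vector_derivative
        (if t \<in> {0..T} then X i (coord A i (\<gamma> t)) else X i (coord A i (\<delta> (t - T))))) (at t within {0..T+e})"
    proof (rule has_vector_derivative_If_within_closures[where T = "{T..T+e}", OF _ un])
      show "t \<in> {0..T} \<union> {T..T+e}" using t un by auto
      have cl: "{0..T} \<union> (closure {0..T} \<inter> closure {T..T+e}) = {0..T}"
        "{T..T+e} \<union> (closure {0..T} \<inter> closure {T..T+e}) = {T..T+e}" using T by auto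
      show "((\<lambda>u. coord A i (\<gamma> u)) has_vector_derivative X i (coord A i (\<gamma> t)))
          (at t within {0..T} \<union> (closure {0..T} \<inter> closure {T..T+e}))"
        if "t \<in> {0..T} \<union> (closure {0..T} \<inter> closure {T..T+e})"
        using speed_curve_deriv[OF \<gamma> _ i, of t] that d unfolding cl by simp
      show "((\<lambda>u. coord A i (\<delta> (u - T))) has_vector_derivative X i (coord A i (\<delta> (t - T))))
          (at t within {T..T+e} \<union> (closure {0..T} \<inter> closure {T..T+e}))"
        if "t \<in> {T..T+e} \<union> (closure {0..T} \<inter> closure {T..T+e})"
      proof -
        have "t \<in> {T..T+e}" using that unfolding cl by simp
        moreover have "\<delta> (t - T) \<in> dom A i" using d \<open>t \<in> {T..T+e}\<close> glue T
          by (cases "t = T") (auto split: if_splits)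
        ultimately show ?thesis using speed_curve_deriv[OF \<delta>' _ i, of t] unfolding cl by simp
      qed
    qed (use glue T in auto)
    then show "((\<lambda>u. coord A i (if u \<in> {0..T} then \<gamma> u else \<delta> (u - T))) has_vector_derivative
      1 *\<^sub>R X i (coord A i (if t \<in> {0..T} then \<gamma> t else \<delta> (t - T)))) (at t within {0..T+e})"
      by (simp add: if_distrib[of "coord A i"] if_distrib[of "X i"] cong: if_cong)
  qed
qed

lemma smooth_atlasD:
  assumes "smooth_atlas A"
  shows smooth_atlas_cover: "\<exists>i\<in>idx A. p \<in> dom A i"
    and smooth_atlas_dom: "i \<in> idx A \<Longrightarrow> open (dom A i)"
    and smooth_atlas_image: "i \<in> idx A \<Longrightarrow> open (coord A i ` dom A i)"
    and smooth_atlas_homeo: "i \<in> idx A \<Longrightarrow> homeomorphism (dom A i) (coord A i ` dom A i) (coord A i) (param A i)"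
    and smooth_atlas_transition: "i \<in> idx A \<Longrightarrow> j \<in> idx A \<Longrightarrow>
      smooth_on (coord A i ` (dom A i \<inter> dom A j)) (transition A i j)"
  using assms unfolding smooth_atlas_def by blast+

lemma
  assumes "smooth_atlas A" "i \<in> idx A" "p \<in> dom A i"
  shows param_coord: "param A i (coord A i p) = p"
    and transition_coord: "transition A i j (coord A i p) = coord A j p"
  using homeomorphism_apply1[OF smooth_atlas_homeo[OF assms(1,2)] assms(3)]
  by (simp_all add: transition_def)

lemma
  assumes "smooth_atlas A" "i \<in> idx A" "\<xi> \<in> coord A i ` dom A i"
  shows param_in: "param A i \<xi> \<in> dom A i" and coord_param: "coord A i (param A i \<xi>) = \<xi>"
  using assms param_coord[OF assms(1,2)] by auto

lemma smooth_atlas_overlap_open: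
  assumes A: "smooth_atlas A" and ij: "i \<in> idx A" "j \<in> idx A"
  shows "open (coord A i ` (dom A i \<inter> dom A j))"
proof -
  have "openin (top_of_set (coord A i ` dom A i)) (coord A i ` (dom A i \<inter> dom A j))"
    by (rule homeomorphism_imp_open_map[OF smooth_atlas_homeo[OF A ij(1)]])
       (simp add: openin_open_Int smooth_atlas_dom[OF A ij(2)])
  then show ?thesis using openin_open_trans smooth_atlas_image[OF A ij(1)] by blast
qed

text \<open>A vector field given by chart representatives that are related by the transition maps and are
  locally Lipschitz, which is what existence and uniqueness of integral curves need.\<close>

locale compact_lipschitz_field =
  fixes A :: "('i, 'm::{t2_space,second_countable_topology}, 'b::euclidean_space) atlas"
    and X :: "'i \<Rightarrow> 'b \<Rightarrow> 'b"
  assumes atlas: "smooth_atlas A"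
    and compact_manifold: "compact (UNIV :: 'm set)"
    and covariant: "\<And>i j p. i \<in> idx A \<Longrightarrow> j \<in> idx A \<Longrightarrow> p \<in> dom A i \<Longrightarrow> p \<in> dom A j \<Longrightarrow>
      frechet_derivative (transition A i j) (at (coord A i p)) (X i (coord A i p)) = X j (coord A j p)"
    and locally_lipschitz: "\<And>i \<xi>. i \<in> idx A \<Longrightarrow> \<xi> \<in> coord A i ` dom A i \<Longrightarrow>
      \<exists>r>0. \<exists>L. cball \<xi> r \<subseteq> coord A i ` dom A i \<and> L-lipschitz_on (cball \<xi> r) (X i)"
begin

lemma open_chart_ball:
  assumes "i \<in> idx A"
  shows "open (dom A i \<inter> coord A i -` ball \<xi> r)"
  using continuous_open_preimage[OF homeomorphism_cont1[OF smooth_atlas_homeo[OF atlas assms]]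
      smooth_atlas_dom[OF atlas assms] open_ball] .

text \<open>Where two curves meet, both run for a short time in one chart ball on which the field is
  Lipschitz, so they agree near that time; the times of agreement are hence open and closed.\<close>

lemma speed_curve_unique:
  assumes \<gamma>: "speed_curve A X \<theta> {a..b} \<gamma>" and \<delta>: "speed_curve A X \<theta> {a..b} \<delta>"
    and \<theta>: "\<And>s. s \<in> {a..b} \<Longrightarrow> \<bar>\<theta> s\<bar> \<le> \<Theta>"
    and t0: "t0 \<in> {a..b}" "\<gamma> t0 = \<delta> t0" and t: "t \<in> {a..b}"
  shows "\<gamma> t = \<delta> t"
proof -
  let ?E = "{s \<in> {a..b}. \<gamma> s = \<delta> s}"
  note cont = speed_curve_continuous[OF \<gamma>] speed_curve_continuous[OF \<delta>]
  have "closedin (top_of_set {a..b}) ({a..b} \<inter> (\<lambda>s. (\<gamma> s, \<delta> s)) -` {y. \<exists>x. y = (x,x)})"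
    by (intro continuous_closedin_preimage continuous_on_Pair cont closed_diagonal)
  moreover have "{a..b} \<inter> (\<lambda>s. (\<gamma> s, \<delta> s)) -` {y. \<exists>x. y = (x,x)} = ?E" by auto
  ultimately have closed: "closedin (top_of_set {a..b}) ?E" by simp
  have "openin (top_of_set {a..b}) ?E"
    unfolding openin_euclidean_subtopology_iff
  proof (intro conjI ballI)
    fix s assume s: "s \<in> ?E"
    obtain i where i: "i \<in> idx A" "\<gamma> s \<in> dom A i" using smooth_atlas_cover[OF atlas] by blast
    obtain r L where r: "r > 0" and lip: "L-lipschitz_on (cball (coord A i (\<gamma> s)) r) (X i)"
      using locally_lipschitz[OF i(1)] i(2) by blast
    define N where "N = dom A i \<inter> coord A i -` ball (coord A i (\<gamma> s)) r"
    have N: "open N" "\<gamma> s \<in> N" "\<delta> s \<in> N" using open_chart_ball[OF i(1)] i r s by (auto simp: N_def)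
    have "\<exists>d>0. \<forall>u\<in>{a..b}. dist u s < d \<longrightarrow> \<zeta> u \<in> N" if "continuous_on {a..b} \<zeta>" "\<zeta> s \<in> N" for \<zeta>
    proof -
      have "openin (top_of_set {a..b}) ({a..b} \<inter> \<zeta> -` N)"
        by (rule continuous_openin_preimage_gen[OF that(1) N(1)])
      then show ?thesis unfolding openin_euclidean_subtopology_iff using that(2) s by blast
    qed
    from this[OF cont(1) N(2)] this[OF cont(2) N(3)] obtain d1 d2 where
      d1: "d1 > 0" "\<And>u. u \<in> {a..b} \<Longrightarrow> dist u s < d1 \<Longrightarrow> \<gamma> u \<in> N" and
      d2: "d2 > 0" "\<And>u. u \<in> {a..b} \<Longrightarrow> dist u s < d2 \<Longrightarrow> \<delta> u \<in> N" by metis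
    have L0: "L \<ge> 0" using lip lipschitz_on_nonneg by blast
    have \<Theta>0: "\<Theta> \<ge> 0" using \<theta>[OF t] by linarith
    define e where "e = min (min d1 d2 / 2) (1 / (4 * (\<Theta> * L + 1)))"
    have e: "e > 0" using d1(1) d2(1) L0 \<Theta>0 by (simp add: e_def add_nonneg_pos)
    have eL: "2 * e * (\<Theta> * L) \<le> 1/2"
    proof -
      have "2 * e * (\<Theta> * L) \<le> 2 * (1 / (4 * (\<Theta> * L + 1))) * (\<Theta> * L)"
        using L0 \<Theta>0 by (intro mult_right_mono mult_left_mono) (auto simp: e_def)
      also have "\<dots> \<le> 1/2" using L0 \<Theta>0 by (simp add: divide_le_eq add_nonneg_pos)
      finally show ?thesis .
    qed
    have "u \<in> ?E" if u: "u \<in> {a..b}" "dist u s < e" for u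
    proof -
      define a' b' where "a' = max a (s - e)" and "b' = min b (s + e)"
      have sub: "{a'..b'} \<subseteq> {a..b}" by (auto simp: a'_def b'_def)
      have near: "\<gamma> v \<in> N \<and> \<delta> v \<in> N" if "v \<in> {a'..b'}" for v
      proof -
        have "\<bar>v - s\<bar> \<le> e" using that unfolding a'_def b'_def by auto
        moreover have "e < d1" "e < d2" using d1(1) d2(1) by (auto simp: e_def)
        ultimately show ?thesis using d1(2)[of v] d2(2)[of v] that sub by (auto simp: dist_real_def)
      qed
      have deriv: "coord A i (\<zeta> v) \<in> cball (coord A i (\<gamma> s)) r \<and>
          ((\<lambda>u. coord A i (\<zeta> u)) has_vector_derivative \<theta> v *\<^sub>R X i (coord A i (\<zeta> v))) (at v within {a'..b'})"
        if "v \<in> {a'..b'}" "speed_curve A X \<theta> {a..b} \<zeta>" "\<zeta> v \<in> N" for v \<zeta>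
        using speed_curve_deriv[OF speed_curve_subset[OF that(2) sub] that(1) i(1)] that(3)
        by (auto simp: N_def)
      have "norm (coord A i (\<gamma> u) - coord A i (\<delta> u)) \<le> 2 * norm (coord A i (\<gamma> s) - coord A i (\<delta> s))"
      proof (rule solutions_gap_le[OF lip, where a = a' and b = b' and \<Theta> = \<Theta>])
        have "(b' - a') * (\<Theta> * L) \<le> 2 * e * (\<Theta> * L)"
          using L0 \<Theta>0 by (intro mult_right_mono) (auto simp: a'_def b'_def)
        then show "(b' - a') * (\<Theta> * L) \<le> 1/2" using eL by linarith
        show "s \<in> {a'..b'}" "u \<in> {a'..b'}" using s u e by (auto simp: a'_def b'_def dist_real_def)
      qed (use deriv \<gamma> \<delta> near \<theta> sub in auto)
      then have eq: "coord A i (\<gamma> u) = coord A i (\<delta> u)" using s by simp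
      have "\<gamma> u \<in> dom A i" "\<delta> u \<in> dom A i"
        using near[of u] u e s by (force simp: a'_def b'_def dist_real_def N_def)+
      then have "\<gamma> u = \<delta> u" using eq param_coord[OF atlas i(1)] by metis
      then show ?thesis using u by simp
    qed
    then show "\<exists>e>0. \<forall>u\<in>{a..b}. dist u s < e \<longrightarrow> u \<in> ?E" using e by blast
  qed auto
  with closed have "?E = {} \<or> ?E = {a..b}"
    using connected_clopen[of "{a..b}"] connected_Icc by blast
  then show ?thesis using t0 t by blast
qed

lemma integral_curve_unique:
  assumes "speed_curve A X (\<lambda>_. 1) {0..T} \<gamma>" "speed_curve A X (\<lambda>_. 1) {0..T} \<delta>"
    and "\<gamma> 0 = \<delta> 0" "t \<in> {0..T}"
  shows "\<gamma> t = \<delta> t"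
  using speed_curve_unique[where \<Theta> = 1 and ?t0.0 = 0, OF assms(1,2) _ _ assms(3,4)] assms(4) by simp

lemma integral_curve_of_chart:
  assumes i: "i \<in> idx A"
    and c: "\<And>t. t \<in> J \<Longrightarrow> c t \<in> coord A i ` dom A i \<and> (c has_vector_derivative X i (c t)) (at t within J)"
  shows "speed_curve A X (\<lambda>_. 1) J (\<lambda>t. param A i (c t))"
  unfolding speed_curve_def
proof (intro conjI ballI impI)
  have "continuous_on J c"
    using c has_vector_derivative_continuous continuous_on_eq_continuous_within by blast
  then show "continuous_on J (\<lambda>t. param A i (c t))"
    using c by (intro continuous_on_compose2[OF homeomorphism_cont2[OF smooth_atlas_homeo[OF atlas i]]]) auto
  fix t j assume t: "t \<in> J" and j: "j \<in> idx A" "param A i (c t) \<in> dom A j"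
  define p where "p = param A i (c t)"
  have p: "p \<in> dom A i" "p \<in> dom A j" "coord A i p = c t"
    using j c[OF t] param_in[OF atlas i] coord_param[OF atlas i] by (auto simp: p_def)
  have "Ck_on (Suc 0) (coord A i ` (dom A i \<inter> dom A j)) (transition A i j)"
    using smooth_atlas_transition[OF atlas i j(1)] by (simp add: smooth_on_def del: Ck_on.simps)
  moreover have "c t \<in> coord A i ` (dom A i \<inter> dom A j)" using p by (metis IntI imageI)
  ultimately have "transition A i j differentiable (at (c t))" unfolding Ck_on.simps(2) by (rule bspec[OF conjunct1])
  then have "(transition A i j has_derivative frechet_derivative (transition A i j) (at (c t))) (at (c t) within c ` J)"
    using has_derivative_at_withinI[OF frechet_derivative_works[THEN iffD1]] by blast
  then have "(transition A i j \<circ> c has_vector_derivative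
      frechet_derivative (transition A i j) (at (c t)) (X i (c t))) (at t within J)"
    by (rule vector_derivative_diff_chain_within[OF c[OF t, THEN conjunct2]])
  moreover have "frechet_derivative (transition A i j) (at (c t)) (X i (c t)) = X j (coord A j p)"
    using covariant[OF i j(1) p(1,2)] p(3) by simp
  ultimately show "((\<lambda>u. coord A j (param A i (c u))) has_vector_derivative
      1 *\<^sub>R X j (coord A j (param A i (c t)))) (at t within J)"
    by (simp add: transition_def o_def p_def)
qed

definition flows_until :: "'m set \<Rightarrow> real \<Rightarrow> ('m \<Rightarrow> real \<Rightarrow> 'm) \<Rightarrow> bool" where
  "flows_until N T \<psi> \<longleftrightarrow>
     (\<forall>x\<in>N. \<psi> x 0 = x \<and> speed_curve A X (\<lambda>_. 1) {0..T} (\<psi> x)) \<and>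
     (\<forall>t\<in>{0..T}. continuous_on N (\<lambda>x. \<psi> x t))"

lemma flows_until_mono: "flows_until N T \<psi> \<Longrightarrow> S \<le> T \<Longrightarrow> flows_until N S \<psi>"
  unfolding flows_until_def by (auto intro: speed_curve_subset)

text \<open>The time \<open>T\<close> of Picard's theorem is the same for all starting points near \<open>p\<close>; by compactness one
  positive time then works on the whole manifold, and iteration reaches every time.\<close>

lemma local_flow: "\<exists>N T \<psi>. open N \<and> p \<in> N \<and> T > 0 \<and> flows_until N T \<psi>"
proof -
  obtain i where i: "i \<in> idx A" "p \<in> dom A i" using smooth_atlas_cover[OF atlas] by blast
  let ?\<xi> = "coord A i p"
  obtain r L where r: "r > 0" and sub: "cball ?\<xi> r \<subseteq> coord A i ` dom A i"
    and lip: "L-lipschitz_on (cball ?\<xi> r) (X i)"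
    using locally_lipschitz[OF i(1)] i(2) by blast
  obtain T c where T: "T > 0" "T * L \<le> 1/2"
    and c0: "\<And>\<eta>. \<eta> \<in> cball ?\<xi> (r/2) \<Longrightarrow> c \<eta> 0 = \<eta>"
    and c: "\<And>\<eta> t. \<eta> \<in> cball ?\<xi> (r/2) \<Longrightarrow> t \<in> {0..T} \<Longrightarrow> c \<eta> t \<in> cball ?\<xi> r \<and>
        (c \<eta> has_vector_derivative X i (c \<eta> t)) (at t within {0..T})"
    using picard_short_time[OF lip r] by metis
  define N where "N = dom A i \<inter> coord A i -` ball ?\<xi> (r/2)"
  define \<psi> where "\<psi> x t = param A i (c (coord A i x) t)" for x t
  have N: "coord A i x \<in> cball ?\<xi> (r/2)" "x \<in> dom A i" if "x \<in> N" for x using that by (auto simp: N_def)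
  have "continuous_on N (\<lambda>x. \<psi> x t)" if t: "t \<in> {0..T}" for t
  proof -
    have "2-lipschitz_on (cball ?\<xi> (r/2)) (\<lambda>\<eta>. c \<eta> t)"
    proof (rule lipschitz_onI)
      fix \<eta> \<eta>' assume \<eta>: "\<eta> \<in> cball ?\<xi> (r/2)" "\<eta>' \<in> cball ?\<xi> (r/2)"
      have "norm (c \<eta> t - c \<eta>' t) \<le> 2 * norm (c \<eta> 0 - c \<eta>' 0)"
        by (rule solutions_gap_le[OF lip, where a = 0 and b = T and \<theta> = "\<lambda>_. 1" and \<Theta> = 1])
           (use c \<eta> T t in auto)
      then show "dist (c \<eta> t) (c \<eta>' t) \<le> 2 * dist \<eta> \<eta>'" using c0 \<eta> by (simp add: dist_norm)
    qed simp
    then have 1: "continuous_on (cball ?\<xi> (r/2)) (\<lambda>\<eta>. c \<eta> t)" by (rule lipschitz_on_continuous_on)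
    have "continuous_on N (coord A i)"
      using homeomorphism_cont1[OF smooth_atlas_homeo[OF atlas i(1)]] N continuous_on_subset by (metis subsetI)
    then have "continuous_on N (\<lambda>x. c (coord A i x) t)"
      by (rule continuous_on_compose2[OF 1]) (use N in blast)
    then show ?thesis unfolding \<psi>_def
      by (rule continuous_on_compose2[OF homeomorphism_cont2[OF smooth_atlas_homeo[OF atlas i(1)]]])
         (use N c t sub in blast)
  qed
  moreover have "speed_curve A X (\<lambda>_. 1) {0..T} (\<psi> x)" if "x \<in> N" for x
    unfolding \<psi>_def by (rule integral_curve_of_chart[OF i(1)]) (use c[OF N(1)[OF that]] sub in blast)
  moreover have "\<psi> x 0 = x" if "x \<in> N" for x
    using c0 N[OF that] param_coord[OF atlas i(1)] by (simp add: \<psi>_def)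
  ultimately have "flows_until N T \<psi>" unfolding flows_until_def by blast
  moreover have "open N" "p \<in> N" using open_chart_ball[OF i(1)] i r by (auto simp: N_def)
  ultimately show ?thesis using T by blast
qed

lemma short_flow: "\<exists>e>0. \<exists>\<psi>. flows_until UNIV e \<psi>"
proof -
  from choice[OF allI[OF local_flow]] obtain N
    where "\<forall>p. \<exists>T \<psi>. open (N p) \<and> p \<in> N p \<and> T > 0 \<and> flows_until (N p) T \<psi>" by (rule exE)
  from choice[OF this] obtain T
    where "\<forall>p. \<exists>\<psi>. open (N p) \<and> p \<in> N p \<and> T p > 0 \<and> flows_until (N p) (T p) \<psi>" by (rule exE)
  from choice[OF this] obtain \<psi>
    where *: "\<forall>p. open (N p) \<and> p \<in> N p \<and> T p > 0 \<and> flows_until (N p) (T p) (\<psi> p)" by (rule exE)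
  have N: "open (N p)" "p \<in> N p" and T: "T p > 0" and \<psi>: "flows_until (N p) (T p) (\<psi> p)" for p
    using *[rule_format, of p] by simp_all
  have "UNIV \<subseteq> (\<Union>p\<in>UNIV. N p)" using N(2) by auto
  then obtain D where D: "finite D" "UNIV \<subseteq> (\<Union>p\<in>D. N p)"
    using compactE_image[OF compact_manifold, of UNIV N] N(1) by metis
  then have D0: "D \<noteq> {}" by auto
  define e where "e = Min (T ` D)"
  have e: "e > 0" using D(1) D0 T by (simp add: e_def)
  have \<psi>e: "flows_until (N p) e (\<psi> p)" if "p \<in> D" for p
  proof (rule flows_until_mono[OF \<psi>])
    show "e \<le> T p" unfolding e_def using that D(1) by (intro Min_le) auto
  qed
  have "\<forall>x. \<exists>p. p \<in> D \<and> x \<in> N p" using D(2) by blast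
  then obtain q where q: "\<And>x. q x \<in> D" "\<And>x. x \<in> N (q x)" by metis
  define \<Psi> where "\<Psi> x = \<psi> (q x) x" for x
  have agree: "\<Psi> x t = \<psi> p x t" if "p \<in> D" "x \<in> N p" "t \<in> {0..e}" for x p t
  proof -
    have 1: "\<psi> p x 0 = x" "speed_curve A X (\<lambda>_. 1) {0..e} (\<psi> p x)"
      using \<psi>e[OF that(1)] that(2) by (auto simp: flows_until_def)
    have 2: "\<Psi> x 0 = x" "speed_curve A X (\<lambda>_. 1) {0..e} (\<Psi> x)"
      using \<psi>e[OF q(1)[of x]] q(2)[of x] by (auto simp: flows_until_def \<Psi>_def)
    show ?thesis by (rule integral_curve_unique[OF 2(2) 1(2) _ that(3)]) (simp add: 1 2)
  qed
  have "continuous_on UNIV (\<lambda>x. \<Psi> x t)" if t: "t \<in> {0..e}" for t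
  proof -
    have "continuous_on (N p) (\<lambda>x. \<Psi> x t)" if "p \<in> D" for p
      using \<psi>e[OF that] t agree[OF that] by (auto simp: flows_until_def cong: continuous_on_cong)
    then have "continuous_on (\<Union>p\<in>D. N p) (\<lambda>x. \<Psi> x t)" by (intro continuous_on_open_UN N)
    then show ?thesis using D(2) continuous_on_subset by blast
  qed
  moreover have "\<Psi> x 0 = x \<and> speed_curve A X (\<lambda>_. 1) {0..e} (\<Psi> x)" for x
    using \<psi>e[OF q(1)[of x]] q(2)[of x] by (simp add: flows_until_def \<Psi>_def)
  ultimately have "flows_until UNIV e \<Psi>" by (simp add: flows_until_def)
  then show ?thesis using e by blast
qed

lemma flow_extend:
  assumes \<psi>: "flows_until UNIV T \<psi>" and \<rho>: "flows_until UNIV e \<rho>" and "T \<ge> 0" "e \<ge> 0"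
  shows "flows_until UNIV (T + e) (\<lambda>x t. if t \<in> {0..T} then \<psi> x t else \<rho> (\<psi> x T) (t - T))"
  unfolding flows_until_def
proof (intro conjI ballI)
  fix x show "(if 0 \<in> {0..T} then \<psi> x 0 else \<rho> (\<psi> x T) (0 - T)) = x"
    using \<psi> assms(3) by (simp add: flows_until_def)
  show "speed_curve A X (\<lambda>_. 1) {0..T+e} (\<lambda>t. if t \<in> {0..T} then \<psi> x t else \<rho> (\<psi> x T) (t - T))"
    by (rule speed_curve_concat) (use assms in \<open>auto simp: flows_until_def\<close>)
next
  fix t assume t: "t \<in> {0..T+e}"
  show "continuous_on UNIV (\<lambda>x. if t \<in> {0..T} then \<psi> x t else \<rho> (\<psi> x T) (t - T))"
  proof (cases "t \<in> {0..T}")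
    case True then show ?thesis using \<psi> by (simp add: flows_until_def)
  next
    case False
    then have "continuous_on UNIV (\<lambda>x. \<rho> x (t - T))" "continuous_on UNIV (\<lambda>x. \<psi> x T)"
      using t assms by (auto simp: flows_until_def)
    then have "continuous_on UNIV (\<lambda>x. \<rho> (\<psi> x T) (t - T))"
      by (rule continuous_on_compose2) auto
    then show ?thesis unfolding if_not_P[OF False] .
  qed
qed

lemma long_flow: "\<exists>\<psi>. flows_until UNIV T \<psi>"
proof -
  obtain e \<rho> where e: "e > 0" and \<rho>: "flows_until UNIV e \<rho>" using short_flow by blast
  have "\<exists>\<psi>. flows_until UNIV (real n * e) \<psi>" for n
  proof (induction n)
    case 0
    then show ?case using flows_until_mono[OF \<rho>, of 0] e by auto
  next
    case (Suc n)
    then obtain \<psi> where "flows_until UNIV (real n * e) \<psi>" by blast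
    from flow_extend[OF this \<rho>] e show ?case by (auto simp: algebra_simps)
  qed
  moreover obtain n where "T \<le> real n * e" using e reals_Archimedean3 less_imp_le by metis
  ultimately show ?thesis using flows_until_mono by blast
qed

text \<open>Meant for \<open>t \<ge> 0\<close>: the skeleton is about the future of a point.  By uniqueness of integral
  curves the choice of \<open>\<psi>\<close> is immaterial.\<close>

definition flow :: "real \<Rightarrow> 'm \<Rightarrow> 'm" where
  "flow t x = (SOME \<psi>. flows_until UNIV t \<psi>) x t"

lemma flow_eq:
  assumes "flows_until UNIV T \<psi>" "t \<in> {0..T}"
  shows "flow t x = \<psi> x t"
proof -
  define \<rho> where "\<rho> = (SOME \<psi>. flows_until UNIV t \<psi>)"
  have \<rho>: "flows_until UNIV t \<rho>" unfolding \<rho>_def using long_flow by (rule someI_ex)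
  have \<psi>: "flows_until UNIV t \<psi>" using flows_until_mono[OF assms(1)] assms(2) by simp
  have "\<rho> x t = \<psi> x t"
    by (rule integral_curve_unique[of t "\<rho> x" "\<psi> x"]) (use \<rho> \<psi> assms(2) in \<open>auto simp: flows_until_def\<close>)
  then show ?thesis by (simp add: flow_def \<rho>_def)
qed

lemma flows_until_flow: "flows_until UNIV T (\<lambda>x t. flow t x)"
proof -
  obtain \<psi> where \<psi>: "flows_until UNIV T \<psi>" using long_flow by blast
  have eq: "flow t x = \<psi> x t" if "t \<in> {0..T}" for t x by (rule flow_eq[OF \<psi> that])
  have "speed_curve A X (\<lambda>_. 1) {0..T} (\<lambda>t. flow t x)" for x
  proof -
    have "speed_curve A X (\<lambda>_. 1) {0..T} (\<psi> x)" using \<psi> by (simp add: flows_until_def)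
    then show ?thesis
      using speed_curve_cong[of "{0..T}" "\<lambda>t. flow t x" "\<psi> x" "\<lambda>_. 1" "\<lambda>_. 1" A X] eq by simp
  qed
  moreover have "flow 0 x = x" for x
  proof -
    obtain \<rho> where "flows_until UNIV 0 \<rho>" using long_flow by blast
    from flow_eq[OF this, of 0 x] this show ?thesis by (simp add: flows_until_def)
  qed
  moreover have "continuous_on UNIV (flow t)" if "t \<in> {0..T}" for t
  proof -
    have "flow t = (\<lambda>x. \<psi> x t)" using eq[OF that] by (rule ext)
    then show ?thesis using \<psi> that by (simp add: flows_until_def)
  qed
  ultimately show ?thesis by (simp add: flows_until_def)
qed

lemma flow_0 [simp]: "flow 0 x = x"
  using flows_until_flow[of 0] by (simp add: flows_until_def)

lemma continuous_on_flow: "t \<ge> 0 \<Longrightarrow> continuous_on UNIV (flow t)"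
  using flows_until_flow[of t] by (simp add: flows_until_def)

lemma speed_curve_flow: "speed_curve A X (\<lambda>_. 1) {0..T} (\<lambda>t. flow t x)"
  using flows_until_flow[of T] by (simp add: flows_until_def)

lemma continuous_on_flow_time: "continuous_on {0..} (\<lambda>t. flow t x)"
proof -
  have "isCont (\<lambda>t. flow (max 0 t) x) t" for t
  proof -
    have "continuous_on {..\<bar>t\<bar>+1} (\<lambda>t. flow (max 0 t) x)"
      by (rule continuous_on_compose2[OF speed_curve_continuous[OF speed_curve_flow[of "\<bar>t\<bar>+1"]]])
         (auto intro!: continuous_intros)
    then have "continuous_on {..<\<bar>t\<bar>+1} (\<lambda>t. flow (max 0 t) x)"
      by (rule continuous_on_subset) auto
    then show ?thesis by (simp add: continuous_on_eq_continuous_at)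
  qed
  then have "continuous_on UNIV (\<lambda>t. flow (max 0 t) x)" by (simp add: continuous_on_eq_continuous_at)
  then have "continuous_on {0..} (\<lambda>t. flow (max 0 t) x)" using continuous_on_subset by blast
  then show ?thesis by (rule continuous_on_eq) auto
qed

lemma flow_add:
  assumes "s \<ge> 0" "t \<ge> 0"
  shows "flow t (flow s x) = flow (t + s) x"
proof -
  have "speed_curve A X (\<lambda>_. 1) {0..t} (\<lambda>t. flow (t + s) x)"
    by (rule speed_curve_shift[OF speed_curve_flow[of "t + s"]]) (use assms in auto)
  then show ?thesis
    using integral_curve_unique[OF speed_curve_flow, of t "\<lambda>t. flow (t + s) x" "flow s x" t] assms by simp
qed

text \<open>The base component of a trajectory is determined by its starting point and the elapsed time
  \<open>\<integral> \<theta>\<close> of \<open>X\<close>: running the semiflow by that time gives another curve of speed \<open>\<theta>\<close>.\<close>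

lemma speed_curve_eq_flow:
  assumes \<gamma>: "speed_curve A X \<theta> {0..T} \<gamma>" and \<theta>: "continuous_on {0..T} \<theta>"
    and pos: "\<And>t. t \<in> {0..T} \<Longrightarrow> \<theta> t \<ge> 0" and t: "t \<in> {0..T}"
  shows "\<gamma> t = flow (integral {0..t} \<theta>) (\<gamma> 0)"
proof -
  define h where "h t = integral {0..t} \<theta>" for t
  have int: "\<theta> integrable_on {0..s}" if "s \<in> {0..T}" for s
    using \<theta> that by (intro integrable_continuous_real continuous_on_subset[OF \<theta>]) auto
  have h: "(h has_vector_derivative \<theta> s) (at s within {0..T})" if "s \<in> {0..T}" for s
    unfolding h_def by (rule integral_has_vector_derivative[OF \<theta> that])
  have h_in: "h s \<in> {0..h T}" if "s \<in> {0..T}" for s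
    unfolding h_def using that pos int
    by (auto intro!: integral_nonneg integral_subset_le)
  have "speed_curve A X (\<lambda>s. \<theta> s * 1) {0..T} (\<lambda>s. flow (h s) (\<gamma> 0))"
    by (rule speed_curve_reparam[OF speed_curve_flow[of "h T"] h]) (use h_in in auto)
  then have *: "speed_curve A X \<theta> {0..T} (\<lambda>s. flow (h s) (\<gamma> 0))" by simp
  obtain \<Theta> where "\<forall>s\<in>{0..T}. \<bar>\<theta> s\<bar> \<le> \<Theta>"
    using compact_imp_bounded[OF compact_continuous_image[OF \<theta> compact_Icc]] by (auto simp: bounded_iff)
  then have "\<bar>\<theta> s\<bar> \<le> \<Theta>" if "s \<in> {0..T}" for s using that by blast
  from speed_curve_unique[OF \<gamma> * this, of 0 t] t have "\<gamma> t = flow (h t) (\<gamma> 0)"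
    by (simp add: h_def)
  then show ?thesis by (simp add: h_def)
qed

end

section \<open>Invariant graphs of fibrewise expanding equations\<close>

context
  fixes L B :: real and h :: "real \<Rightarrow> real"
  assumes L: "L > 0" and h: "continuous_on {0..} h" and B: "\<And>r. r \<ge> 0 \<Longrightarrow> \<bar>h r\<bar> \<le> B"
begin

lemma discounted_bound: "r \<ge> 0 \<Longrightarrow> \<bar>exp (- L * r) * h r\<bar> \<le> B * exp (- L * r)"
  using B[of r] by (simp add: abs_mult mult.commute)

lemma discounted_integrable: "(\<lambda>r. exp (- L * r) * h r) integrable_on {0..}"
proof (rule measurable_bounded_by_integrable_imp_integrable_real)
  show "(\<lambda>r. exp (- L * r) * h r) \<in> borel_measurable (lebesgue_on {0..})"
    by (intro continuous_imp_measurable_on_sets_lebesgue continuous_intros h) auto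
  show "(\<lambda>r. B * exp (- L * r)) integrable_on {0..}"
    using integrable_cmul[OF integrable_on_exp_minus_to_infinity[OF L, of 0], of B] by simp
qed (use discounted_bound in auto)

lemma discounted_integral_le: "\<bar>integral {0..} (\<lambda>r. exp (- L * r) * h r)\<bar> \<le> B / L"
proof -
  have E: "((\<lambda>r. B * exp (- L * r)) has_integral B * (exp (- L * 0) / L)) {0..}"
    by (intro has_integral_mult_right has_integral_exp_minus_to_infinity L)
  have "norm (integral {0..} (\<lambda>r. exp (- L * r) * h r)) \<le> integral {0..} (\<lambda>r. B * exp (- L * r))"
    by (rule integral_norm_bound_integral) (use discounted_integrable discounted_bound E in auto)
  then show ?thesis using integral_unique[OF E] by simp
qed

lemma discounted_integral_lim:
  assumes u: "filterlim u at_top sequentially"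
  shows "(\<lambda>n. integral {0..u n} (\<lambda>r. exp (- L * r) * h r)) \<longlonglongrightarrow> integral {0..} (\<lambda>r. exp (- L * r) * h r)"
proof -
  define F where "F r = exp (- L * r) * h r" for r
  have F: "continuous_on {0..} F" unfolding F_def by (intro continuous_intros h)
  have "(\<lambda>n. integral {0..} (\<lambda>r. if r \<in> {0..u n} then F r else 0)) \<longlonglongrightarrow> integral {0..} F"
  proof (rule dominated_convergence)
    show "(\<lambda>r. B * exp (- L * r)) integrable_on {0..}"
      using integrable_cmul[OF integrable_on_exp_minus_to_infinity[OF L, of 0], of B] by simp
    have "F integrable_on {0..u n}" for n
      by (intro integrable_continuous_real continuous_on_subset[OF F]) auto
    then show "(\<lambda>r. if r \<in> {0..u n} then F r else 0) integrable_on {0..}" for n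
      using integrable_restrict_Int[of "{0..u n}" F "{0..}"]
      by (simp add: Int_absorb2 Icc_subset_Ici_iff)
    show "norm (if r \<in> {0..u n} then F r else 0) \<le> B * exp (- L * r)" if "r \<in> {0..}" for n r
      using discounted_bound[of r] B[of 0] that by (auto simp: F_def)
    show "(\<lambda>n. if r \<in> {0..u n} then F r else 0) \<longlonglongrightarrow> F r" if "r \<in> {0..}" for r
    proof (rule tendsto_eventually)
      show "eventually (\<lambda>n. (if r \<in> {0..u n} then F r else 0) = F r) sequentially"
        using u[unfolded filterlim_at_top, rule_format, of r] by (rule eventually_mono) (use that in auto)
    qed
  qed
  moreover have "integral {0..} (\<lambda>r. if r \<in> {0..u n} then F r else 0) = integral {0..u n} F" for n
    using integral_restrict_Int[of "{0..}" "{0..u n}" F] by (simp add: Int_absorb2 Icc_subset_Ici_iff)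
  ultimately have "(\<lambda>n. integral {0..u n} F) \<longlonglongrightarrow> integral {0..} F" by simp
  then show ?thesis unfolding F_def .
qed

end

text \<open>Splitting the integral at time \<open>t\<close> relates the fixed-point equation of an invariant graph at \<open>x\<close>
  to that at the point reached at time \<open>t\<close>.\<close>

lemma discounted_integral_split:
  fixes h :: "real \<Rightarrow> real"
  assumes L: "L > 0" and h: "continuous_on {0..} h" and B: "\<And>r. r \<ge> 0 \<Longrightarrow> \<bar>h r\<bar> \<le> B" and t: "t \<ge> 0"
  shows "integral {0..} (\<lambda>r. exp (- L * r) * h r) =
    integral {0..t} (\<lambda>r. exp (- L * r) * h r) + exp (- L * t) * integral {0..} (\<lambda>r. exp (- L * r) * h (r + t))"
proof -
  define F where "F r = exp (- L * r) * h r" for r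
  have F: "F integrable_on {a..b}" if "a \<ge> 0" for a b
    unfolding F_def using that
    by (intro integrable_continuous_real continuous_intros continuous_on_subset[OF h]) auto
  have "continuous_on {0..} (\<lambda>r. h (r + t))"
    by (rule continuous_on_compose2[OF h]) (use t in \<open>auto intro!: continuous_intros\<close>)
  then have "(\<lambda>n. integral {0..real n} (\<lambda>r. exp (- L * r) * h (r + t))) \<longlonglongrightarrow>
      integral {0..} (\<lambda>r. exp (- L * r) * h (r + t))"
    by (rule discounted_integral_lim[OF L, where B = B]) (use B t filterlim_real_sequentially in auto)
  from tendsto_mult_left[OF this, of "exp (- L * t)"]
  have "(\<lambda>n. exp (- L * t) * integral {0..real n} (\<lambda>r. exp (- L * r) * h (r + t))) \<longlonglongrightarrow>
      exp (- L * t) * integral {0..} (\<lambda>r. exp (- L * r) * h (r + t))" .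
  moreover have "exp (- L * t) * integral {0..real n} (\<lambda>r. exp (- L * r) * h (r + t)) =
      integral {0..real n + t} F - integral {0..t} F" for n
  proof -
    have "exp (- L * t) * integral {0..real n} (\<lambda>r. exp (- L * r) * h (r + t)) =
        integral {0..real n} (\<lambda>r. exp (- L * t) * (exp (- L * r) * h (r + t)))"
      by simp
    also have "(\<lambda>r. exp (- L * t) * (exp (- L * r) * h (r + t))) = (\<lambda>r. F (r + t))"
    proof
      fix r
      have "exp (- L * (r + t)) = exp (- L * t) * exp (- L * r)"
        by (simp add: exp_add[symmetric] algebra_simps)
      then show "exp (- L * t) * (exp (- L * r) * h (r + t)) = F (r + t)" by (simp add: F_def)
    qed
    also have "integral {0..real n} (\<lambda>r. F (r + t)) = integral {t..real n + t} F"
      using integral_shift_real_ivl[of t t "real n + t" F] by simp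
    also have "\<dots> = integral {0..real n + t} F - integral {0..t} F"
      using Henstock_Kurzweil_Integration.integral_combine[of 0 t "real n + t" F] F[of 0] t by simp
    finally show ?thesis .
  qed
  moreover have "(\<lambda>n. integral {0..real n + t} F - integral {0..t} F) \<longlonglongrightarrow>
      integral {0..} F - integral {0..t} F"
  proof (intro tendsto_diff tendsto_const)
    have "filterlim (\<lambda>n. t + real n) at_top sequentially"
      by (rule filterlim_tendsto_add_at_top[OF tendsto_const filterlim_real_sequentially])
    then show "(\<lambda>n. integral {0..real n + t} F) \<longlonglongrightarrow> integral {0..} F"
      unfolding F_def by (intro discounted_integral_lim[OF L h B]) (simp_all add: add.commute)
  qed
  ultimately have "exp (- L * t) * integral {0..} (\<lambda>r. exp (- L * r) * h (r + t)) =
      integral {0..} F - integral {0..t} F"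
    by (simp only: LIMSEQ_unique)
  then show ?thesis unfolding F_def by linarith
qed

text \<open>Uniform limits of continuous functions are continuous on any topological space; the base
  manifold comes without a metric.\<close>

lemma complete_bcontfun: "complete (UNIV :: ('a::topological_space \<Rightarrow>\<^sub>C 'b::complete_space) set)"
  unfolding complete_def
proof (intro allI impI, elim conjE)
  fix f :: "nat \<Rightarrow> 'a \<Rightarrow>\<^sub>C 'b" assume "Cauchy f"
  have "uniformly_Cauchy_on UNIV (\<lambda>n. apply_bcontfun (f n))"
    unfolding uniformly_Cauchy_on_def
  proof (intro allI impI)
    fix e :: real assume "e > 0"
    then obtain N where "\<And>m n. m \<ge> N \<Longrightarrow> n \<ge> N \<Longrightarrow> dist (f m) (f n) < e"
      using \<open>Cauchy f\<close> unfolding Cauchy_def by blast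
    then have "dist (f m x) (f n x) < e" if "m \<ge> N" "n \<ge> N" for m n x
      using le_less_trans[OF dist_bounded] that by blast
    then show "\<exists>M. \<forall>x\<in>UNIV. \<forall>m\<ge>M. \<forall>n\<ge>M. dist (f m x) (f n x) < e" by blast
  qed
  then obtain g where "uniform_limit UNIV (\<lambda>n. apply_bcontfun (f n)) g sequentially"
    using Cauchy_uniformly_convergent[THEN uniformly_convergent_on_def[THEN iffD1]] by metis
  then obtain l where "f \<longlonglongrightarrow> l"
    by (rule uniform_limit_bcontfunE[OF _ sequentially_bot])
  then show "\<exists>l\<in>UNIV. f \<longlonglongrightarrow> l" by (rule bexI[OF _ UNIV_I])
qed

text \<open>A solution of \<open>s' = g s\<close> that stays bounded in the future is determined by the future:
  writing the equation as \<open>s' = L s - H s\<close> shows that \<open>s 0\<close> is the integral of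
  \<open>exp (- L * r) * H (s r)\<close> over \<open>r \<ge> 0\<close>.  If \<open>L\<close> is a Lipschitz constant of \<open>g\<close> in \<open>s\<close> and \<open>m\<close> its
  expansion rate, then \<open>H\<close> has Lipschitz constant \<open>L - m\<close>, and the right-hand side is a contraction
  with factor \<open>(L - m) / L\<close> on the continuous functions \<open>\<sigma>\<close> with values in \<open>[-S, S]\<close>.  Solving
  for \<open>\<sigma>\<close> over all base points at once makes continuity of the invariant graph automatic.\<close>

theorem expanding_invariant_graph:
  fixes \<psi> :: "real \<Rightarrow> 'm::first_countable_topology \<Rightarrow> 'm" and g :: "real \<Rightarrow> 'm \<Rightarrow> real"
  assumes compact: "compact (UNIV :: 'm set)"
    and flow_0: "\<And>x. \<psi> 0 x = x"
    and flow_add: "\<And>s t x. s \<ge> 0 \<Longrightarrow> t \<ge> 0 \<Longrightarrow> \<psi> t (\<psi> s x) = \<psi> (t + s) x"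
    and cont_time: "\<And>x. continuous_on {0..} (\<lambda>t. \<psi> t x)"
    and cont_space: "\<And>t. t \<ge> 0 \<Longrightarrow> continuous_on UNIV (\<psi> t)"
    and g_cont: "continuous_on UNIV (\<lambda>(s, x). g s x)"
    and m: "m > 0" and expand: "\<And>s s' x. s \<le> s' \<Longrightarrow> m * (s' - s) \<le> g s' x - g s x"
    and g_lip: "\<And>S. \<exists>L. \<forall>x. \<forall>s s'. - S \<le> s \<longrightarrow> s \<le> s' \<longrightarrow> s' \<le> S \<longrightarrow> g s' x - g s x \<le> L * (s' - s)"
  obtains \<sigma> S where "continuous_on UNIV \<sigma>" "\<And>x. \<bar>\<sigma> x\<bar> \<le> S"
    "\<And>x t. t \<ge> 0 \<Longrightarrow> ((\<lambda>t. \<sigma> (\<psi> t x)) has_vector_derivative g (\<sigma> (\<psi> t x)) (\<psi> t x)) (at t within {0..})"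
proof -
  have g_comp: "continuous_on J (\<lambda>t. g (a t) (b t))"
    if "continuous_on J a" "continuous_on J b" for J and a and b :: "'x::topological_space \<Rightarrow> 'm"
    using continuous_on_compose2[OF g_cont continuous_on_Pair[OF that]] by simp
  have "compact ((\<lambda>x. g 0 x) ` UNIV)"
    by (intro compact_continuous_image g_comp continuous_intros compact)
  then obtain D where "\<And>y. y \<in> range (g 0) \<Longrightarrow> norm y \<le> D"
    using compact_imp_bounded bounded_pos by metis
  then have D: "\<bar>g 0 x\<bar> \<le> D" for x by auto
  have D0: "D \<ge> 0" using D[of undefined] by linarith
  \<comment> \<open>By expansion, \<open>g\<close> is nonnegative at height \<open>S\<close> and nonpositive at height \<open>- S\<close>, so that the
    fixed-point operator preserves the bound \<open>S\<close>.\<close>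
  define S where "S = D / m"
  have S0: "S \<ge> 0" using D0 m by (simp add: S_def)
  have S_up: "g S x \<ge> 0" and S_down: "g (- S) x \<le> 0" for x
    using expand[of 0 S x] expand[of "- S" 0 x] D[of x] S0 m by (auto simp: S_def)
  obtain L0 where L0: "\<And>x s s'. - S \<le> s \<Longrightarrow> s \<le> s' \<Longrightarrow> s' \<le> S \<Longrightarrow> g s' x - g s x \<le> L0 * (s' - s)"
    using g_lip[of S] by blast
  define L where "L = max L0 m"
  have L: "L > 0" "m \<le> L" using m by (auto simp: L_def)
  have lip: "g s' x - g s x \<le> L * (s' - s)" if "- S \<le> s" "s \<le> s'" "s' \<le> S" for s s' x
  proof -
    have "L0 * (s' - s) \<le> L * (s' - s)" using that by (intro mult_right_mono) (auto simp: L_def)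
    then show ?thesis using L0[OF that, of x] by linarith
  qed
  define H where "H s x = L * s - g s x" for s x
  have H_mono: "0 \<le> H s' x - H s x \<and> H s' x - H s x \<le> (L - m) * (s' - s)"
    if "- S \<le> s" "s \<le> s'" "s' \<le> S" for s s' x
    using lip[OF that, of x] expand[OF that(2), of x] by (simp add: H_def algebra_simps)
  have H_lip: "\<bar>H s' x - H s x\<bar> \<le> (L - m) * \<bar>s' - s\<bar>" if "\<bar>s\<bar> \<le> S" "\<bar>s'\<bar> \<le> S" for s s' x
    proof -
    have "- S \<le> s" "s \<le> S" "- S \<le> s'" "s' \<le> S" using that by auto
    then show ?thesis
      using H_mono[of s s' x] H_mono[of s' s x] by (cases "s \<le> s'") (auto simp: abs_if)
  qed
  have H_bound: "\<bar>H s x\<bar> \<le> L * S" if "\<bar>s\<bar> \<le> S" for s x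
  proof -
    have "H s x \<le> H S x" "H (- S) x \<le> H s x" using H_mono[of s S x] H_mono[of "-S" s x] that by auto
    then show ?thesis using S_up[of x] S_down[of x] by (simp add: H_def abs_le_iff)
  qed
  have H_comp: "continuous_on J (\<lambda>t. H (a t) (b t))"
    if "continuous_on J a" "continuous_on J b" for J and a and b :: "'x::topological_space \<Rightarrow> 'm"
    unfolding H_def by (intro continuous_intros g_comp that)
  define op where "op \<sigma> x = integral {0..} (\<lambda>r. exp (- L * r) * H (\<sigma> (\<psi> r x)) (\<psi> r x))" for \<sigma> x
  define \<C> :: "('m \<Rightarrow>\<^sub>C real) set" where "\<C> = cball (const_bcontfun 0) S"
  have \<C>: "\<sigma> \<in> \<C> \<longleftrightarrow> (\<forall>x. \<bar>apply_bcontfun \<sigma> x\<bar> \<le> S)" for \<sigma>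
  proof
    assume "\<sigma> \<in> \<C>"
    then have "dist (const_bcontfun 0 :: 'm \<Rightarrow>\<^sub>C real) \<sigma> \<le> S" by (simp add: \<C>_def)
    then have "dist (apply_bcontfun (const_bcontfun 0) x) (apply_bcontfun \<sigma> x) \<le> S" for x
      using order_trans[OF dist_bounded] by blast
    then show "\<forall>x. \<bar>apply_bcontfun \<sigma> x\<bar> \<le> S" by (simp add: dist_real_def)
  next
    assume "\<forall>x. \<bar>apply_bcontfun \<sigma> x\<bar> \<le> S"
    then have "dist (const_bcontfun 0) \<sigma> \<le> S" by (intro dist_bound) (simp add: dist_real_def)
    then show "\<sigma> \<in> \<C>" by (simp add: \<C>_def)
  qed
  have path_cont: "continuous_on {0..} (\<lambda>r. H (\<sigma> (\<psi> r x)) (\<psi> r x))"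
    if "continuous_on UNIV \<sigma>" for \<sigma> x
    by (intro H_comp cont_time continuous_on_compose2[OF that]) auto
  have op_bound: "\<bar>op \<sigma> x\<bar> \<le> S" if "continuous_on UNIV \<sigma>" "\<And>x. \<bar>\<sigma> x\<bar> \<le> S" for \<sigma> x
    unfolding op_def
    using discounted_integral_le[OF L(1) path_cont[OF that(1)], where B = "L * S"] H_bound that(2) L(1) by simp
  have op_cont: "continuous_on UNIV (op \<sigma>)" if \<sigma>: "continuous_on UNIV \<sigma>" "\<And>x. \<bar>\<sigma> x\<bar> \<le> S" for \<sigma>
  proof -
    have "(op \<sigma> \<longlongrightarrow> op \<sigma> x) (at x)" for x
      unfolding tendsto_at_iff_sequentially
    proof (intro allI impI)
      fix y assume y: "y \<longlonglongrightarrow> x"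
      show "(op \<sigma> \<circ> y) \<longlonglongrightarrow> op \<sigma> x"
        unfolding o_def op_def
      proof (rule dominated_convergence)
        show "(\<lambda>r. exp (- L * r) * H (\<sigma> (\<psi> r (y k))) (\<psi> r (y k))) integrable_on {0..}" for k
          by (rule discounted_integrable[OF L(1) path_cont[OF \<sigma>(1)]]) (use H_bound \<sigma>(2) in blast)
        show "(\<lambda>r. L * S * exp (- L * r)) integrable_on {0..}"
          using integrable_cmul[OF integrable_on_exp_minus_to_infinity[OF L(1), of 0], of "L * S"] by simp
        show "norm (exp (- L * r) * H (\<sigma> (\<psi> r (y k))) (\<psi> r (y k))) \<le> L * S * exp (- L * r)" for k r
          using H_bound[OF \<sigma>(2)] by (simp add: abs_mult)
        fix r :: real assume "r \<in> {0..}"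
        then have "continuous_on UNIV (\<lambda>x. H (\<sigma> (\<psi> r x)) (\<psi> r x))"
          using cont_space by (intro H_comp continuous_on_compose2[OF \<sigma>(1)]) auto
        then have "(\<lambda>k. H (\<sigma> (\<psi> r (y k))) (\<psi> r (y k))) \<longlonglongrightarrow> H (\<sigma> (\<psi> r x)) (\<psi> r x)"
          using y by (rule continuous_on_tendsto_compose) auto
        then show "(\<lambda>k. exp (- L * r) * H (\<sigma> (\<psi> r (y k))) (\<psi> r (y k))) \<longlonglongrightarrow> exp (- L * r) * H (\<sigma> (\<psi> r x)) (\<psi> r x)"
          by (rule tendsto_mult_left)
      qed
    qed
    then show ?thesis by (simp add: continuous_on_def)
  qed
  define \<Phi> where "\<Phi> \<sigma> = Bcontfun (op (apply_bcontfun \<sigma>))" for \<sigma>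
  have \<Phi>: "apply_bcontfun (\<Phi> \<sigma>) = op (apply_bcontfun \<sigma>)" if "\<sigma> \<in> \<C>" for \<sigma>
  proof -
    have "op (apply_bcontfun \<sigma>) \<in> bcontfun"
      using that op_cont[of "apply_bcontfun \<sigma>"] op_bound[of "apply_bcontfun \<sigma>"]
      by (intro bcontfun_normI[where b = S]) (auto simp: \<C>)
    then show ?thesis unfolding \<Phi>_def by (rule Bcontfun_inverse)
  qed
  have "\<exists>!\<sigma>\<in>\<C>. \<Phi> \<sigma> = \<sigma>"
  proof (rule Banach_fix[where c = "(L - m) / L"])
    show "complete \<C>" unfolding \<C>_def       by (rule complete_closed_subset[OF closed_cball subset_UNIV complete_bcontfun])
    have "const_bcontfun 0 \<in> \<C>" using S0 by (simp add: \<C>)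
    then show "\<C> \<noteq> {}" by blast
    show "0 \<le> (L - m) / L" "(L - m) / L < 1" using L m by auto
    show "\<Phi> ` \<C> \<subseteq> \<C>" using op_bound by (auto simp: \<C> \<Phi>)
    fix \<sigma> \<tau> assume \<sigma>: "\<sigma> \<in> \<C>" and \<tau>: "\<tau> \<in> \<C>"
    show "dist (\<Phi> \<sigma>) (\<Phi> \<tau>) \<le> (L - m) / L * dist \<sigma> \<tau>"
    proof (rule dist_bound)
      fix x
      let ?h = "\<lambda>\<sigma> r. H (apply_bcontfun \<sigma> (\<psi> r x)) (\<psi> r x)"
      have c: "continuous_on {0..} (?h \<sigma>)" for \<sigma> by (rule path_cont) auto
      have int: "(\<lambda>r. exp (- L * r) * ?h \<sigma> r) integrable_on {0..}" if "\<sigma> \<in> \<C>" for \<sigma>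
        by (rule discounted_integrable[OF L(1) c, where B = "L * S"]) (use H_bound that in \<open>auto simp: \<C>\<close>)
      have "op (apply_bcontfun \<sigma>) x - op (apply_bcontfun \<tau>) x =
          integral {0..} (\<lambda>r. exp (- L * r) * (?h \<sigma> r - ?h \<tau> r))"
        unfolding op_def using integral_diff[OF int[OF \<sigma>] int[OF \<tau>]] by (simp add: algebra_simps)
      also have "\<bar>\<dots>\<bar> \<le> (L - m) * dist \<sigma> \<tau> / L"
      proof (rule discounted_integral_le[OF L(1)])
        show "continuous_on {0..} (\<lambda>r. ?h \<sigma> r - ?h \<tau> r)" by (intro continuous_intros c)
        fix r
        have "\<bar>?h \<sigma> r - ?h \<tau> r\<bar> \<le> (L - m) * \<bar>apply_bcontfun \<sigma> (\<psi> r x) - apply_bcontfun \<tau> (\<psi> r x)\<bar>"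
          using \<sigma> \<tau> by (intro H_lip) (auto simp: \<C>)
        also have "\<dots> \<le> (L - m) * dist \<sigma> \<tau>"
          using dist_bounded[of \<sigma> "\<psi> r x" \<tau>] L by (intro mult_left_mono) (auto simp: dist_real_def)
        finally show "\<bar>?h \<sigma> r - ?h \<tau> r\<bar> \<le> (L - m) * dist \<sigma> \<tau>" .
      qed
      finally show "dist (apply_bcontfun (\<Phi> \<sigma>) x) (apply_bcontfun (\<Phi> \<tau>) x) \<le> (L - m) / L * dist \<sigma> \<tau>"
        by (simp add: \<Phi> \<sigma> \<tau> dist_real_def)
    qed
  qed
  then obtain \<sigma>' where \<sigma>': "\<sigma>' \<in> \<C>" "\<Phi> \<sigma>' = \<sigma>'" by blast
  define \<sigma> where "\<sigma> = apply_bcontfun \<sigma>'"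
  have \<sigma>: "continuous_on UNIV \<sigma>" "\<And>x. \<bar>\<sigma> x\<bar> \<le> S" "op \<sigma> = \<sigma>"
    using \<sigma>' \<Phi>[OF \<sigma>'(1)] by (auto simp: \<sigma>_def \<C>)
  show ?thesis
  proof (rule that[OF \<sigma>(1,2)])
    fix x t assume t: "(t::real) \<ge> 0"
    define h where "h r = H (\<sigma> (\<psi> r x)) (\<psi> r x)" for r
    define F where "F r = exp (- L * r) * h r" for r
    have h: "continuous_on {0..} h" unfolding h_def by (rule path_cont[OF \<sigma>(1)])
    have hB: "\<bar>h r\<bar> \<le> L * S" for r unfolding h_def using H_bound \<sigma>(2) by blast
    have eq: "\<sigma> (\<psi> t x) = exp (L * t) * (\<sigma> x - integral {0..t} F)" if "t \<ge> 0" for t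
    proof -
      have "\<sigma> x = integral {0..} (\<lambda>r. exp (- L * r) * h r)"
        using fun_cong[OF \<sigma>(3), of x] by (simp add: op_def h_def)
      also have "\<dots> = integral {0..t} F + exp (- L * t) * integral {0..} (\<lambda>r. exp (- L * r) * h (r + t))"
        unfolding F_def by (rule discounted_integral_split[OF L(1) h hB that])
      also have "integral {0..} (\<lambda>r. exp (- L * r) * h (r + t)) = op \<sigma> (\<psi> t x)"
        unfolding op_def by (rule integral_cong) (simp add: h_def flow_add that)
      finally have "\<sigma> x - integral {0..t} F = exp (- L * t) * \<sigma> (\<psi> t x)" using \<sigma>(3) by simp
      then show ?thesis by (simp add: exp_minus)
    qed
    have F: "continuous_on {0..} F" unfolding F_def by (intro continuous_intros h)
    have "((\<lambda>t. integral {0..t} F) has_vector_derivative F t) (at t within {0..t+1})"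
      using t by (intro integral_has_vector_derivative continuous_on_subset[OF F]) auto
    then have "((\<lambda>t. exp (L * t) * (\<sigma> x - integral {0..t} F)) has_vector_derivative
        exp (L * t) * (0 - F t) + (exp (L * t) * L) * (\<sigma> x - integral {0..t} F)) (at t within {0..t+1})"
      by (intro has_vector_derivative_mult has_vector_derivative_diff has_vector_derivative_const)
         (auto intro!: derivative_eq_intros simp: has_real_derivative_iff_has_vector_derivative[symmetric])
    moreover have "exp (L * t) * (0 - F t) + (exp (L * t) * L) * (\<sigma> x - integral {0..t} F) =
        g (\<sigma> (\<psi> t x)) (\<psi> t x)"
    proof -
      have "exp (L * t) * F t = h t" by (simp add: F_def exp_minus)
      then have "exp (L * t) * (0 - F t) + (exp (L * t) * L) * (\<sigma> x - integral {0..t} F) =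
          L * (exp (L * t) * (\<sigma> x - integral {0..t} F)) - h t"
        by (simp add: algebra_simps)
      also have "\<dots> = L * \<sigma> (\<psi> t x) - h t" using eq[OF t] by simp
      finally have "exp (L * t) * (0 - F t) + (exp (L * t) * L) * (\<sigma> x - integral {0..t} F) =
          L * \<sigma> (\<psi> t x) - h t" .
      then show ?thesis by (simp add: h_def H_def)
    qed
    ultimately have "((\<lambda>t. exp (L * t) * (\<sigma> x - integral {0..t} F)) has_vector_derivative
        g (\<sigma> (\<psi> t x)) (\<psi> t x)) (at t within {0..t+1})" by simp
    then have "((\<lambda>t. \<sigma> (\<psi> t x)) has_vector_derivative g (\<sigma> (\<psi> t x)) (\<psi> t x)) (at t within {0..t+1})"
      by (rule has_vector_derivative_transform[rotated 2]) (use t eq in auto)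
    moreover have "at t within {0..t+1} = at t within {0..}"
      by (rule at_within_nhd[of _ "{..<t+1}"]) auto
    ultimately show "((\<lambda>t. \<sigma> (\<psi> t x)) has_vector_derivative g (\<sigma> (\<psi> t x)) (\<psi> t x)) (at t within {0..})"
      by simp
  qed
qed

section \<open>Points with bounded future in a skew product over a compact base\<close>

lemma has_vector_derivative_inverse_within:
  fixes T h :: "real \<Rightarrow> real"
  assumes T: "(T has_vector_derivative D) (at (h r) within S)" and D: "D \<noteq> 0"
    and h: "\<And>u. u \<in> R \<Longrightarrow> h u \<in> S \<and> T (h u) = u" and cont: "continuous_on R h" and r: "r \<in> R"
  shows "(h has_vector_derivative 1 / D) (at r within R)"
proof -
  have "((\<lambda>z. (T z - T (h r)) / (z - h r)) \<longlongrightarrow> D) (at (h r) within S)"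
    using T by (simp add: has_real_derivative_iff_has_vector_derivative[symmetric] has_field_derivative_iff)
  moreover have "filterlim h (at (h r) within S) (at r within R)"
    unfolding filterlim_at
  proof
    show "(h \<longlongrightarrow> h r) (at r within R)" using cont r by (simp add: continuous_on_def)
    have "h u \<noteq> h r" if "u \<in> R" "u \<noteq> r" for u using h[OF that(1)] h[OF r] that by metis
    then show "\<forall>\<^sub>F u in at r within R. h u \<in> S \<and> h u \<noteq> h r"
      using h by (auto simp: eventually_at_filter)
  qed
  ultimately have "((\<lambda>u. (T (h u) - T (h r)) / (h u - h r)) \<longlongrightarrow> D) (at r within R)"
    by (rule filterlim_compose)
  then have "((\<lambda>u. inverse ((T (h u) - T (h r)) / (h u - h r))) \<longlongrightarrow> inverse D) (at r within R)"
    using D by (rule tendsto_inverse)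
  moreover have "\<forall>\<^sub>F u in at r within R. inverse ((T (h u) - T (h r)) / (h u - h r)) = (h u - h r) / (u - r)"
    using h r by (auto simp: eventually_at_filter)
  ultimately have "((\<lambda>u. (h u - h r) / (u - r)) \<longlongrightarrow> inverse D) (at r within R)"
    by (rule Lim_transform_eventually)
  then show ?thesis
    by (simp add: has_real_derivative_iff_has_vector_derivative[symmetric] has_field_derivative_iff inverse_eq_divide)
qed

text \<open>A solution of \<open>h' = 1 / F h\<close>, obtained as the inverse of the integral of \<open>F\<close>, since \<open>F\<close> is merely
  continuous.  The lower bound on \<open>F\<close> guarantees that \<open>h\<close> reaches time \<open>t\<close>.\<close>

lemma exists_time_change:
  fixes F :: "real \<Rightarrow> real"
  assumes F: "continuous_on {0..} F" and c: "c > 0" "\<And>\<tau>. \<tau> \<ge> 0 \<Longrightarrow> c \<le> F \<tau>" and t: "t \<ge> 0"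
  obtains h where "h 0 = 0" "\<And>r. r \<in> {0..t} \<Longrightarrow> h r \<ge> 0"
    "\<And>r. r \<in> {0..t} \<Longrightarrow> (h has_vector_derivative 1 / F (h r)) (at r within {0..t})"
proof -
  define T where "T \<tau> = integral {0..\<tau>} F" for \<tau>
  define b where "b = t / c"
  have b: "b \<ge> 0" using t c by (simp add: b_def)
  have int: "F integrable_on {\<tau>..\<tau>'}" if "\<tau> \<ge> 0" for \<tau> \<tau>'
    using that by (intro integrable_continuous_real continuous_on_subset[OF F]) auto
  have deriv: "(T has_vector_derivative F \<tau>) (at \<tau> within {0..b})" if "\<tau> \<in> {0..b}" for \<tau>
    unfolding T_def using that by (intro integral_has_vector_derivative continuous_on_subset[OF F]) auto
  then have contT: "continuous_on {0..b} T"
    using has_vector_derivative_continuous continuous_on_eq_continuous_within by blast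
  have growth: "c * (\<tau>' - \<tau>) \<le> T \<tau>' - T \<tau>" if "0 \<le> \<tau>" "\<tau> \<le> \<tau>'" for \<tau> \<tau>'
  proof -
    have "T \<tau>' - T \<tau> = integral {\<tau>..\<tau>'} F"
      using Henstock_Kurzweil_Integration.integral_combine[of 0 \<tau> \<tau>' F] int[of 0] that by (simp add: T_def)
    moreover have "integral {\<tau>..\<tau>'} (\<lambda>_. c) \<le> integral {\<tau>..\<tau>'} F"
      using that c by (intro integral_le int) auto
    ultimately show ?thesis using that by (simp add: mult.commute)
  qed
  have T0: "T 0 = 0" by (simp add: T_def)
  have Tb: "t \<le> T b" using growth[of 0 b] b c by (simp add: T0 b_def)
  have inj: "\<tau> = \<tau>'" if "\<tau> \<in> {0..b}" "\<tau>' \<in> {0..b}" "T \<tau> = T \<tau>'" for \<tau> \<tau>'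
  proof -
    have "c * (\<tau>' - \<tau>) \<le> 0 \<or> \<tau>' < \<tau>" "c * (\<tau> - \<tau>') \<le> 0 \<or> \<tau> < \<tau>'"
      using growth[of \<tau> \<tau>'] growth[of \<tau>' \<tau>] that by (auto simp: not_less)
    then have "\<tau>' \<le> \<tau>" "\<tau> \<le> \<tau>'" using c(1) by (auto simp: mult_le_0_iff)
    then show ?thesis by simp
  qed
  define h where "h = inv_into {0..b} T"
  have hT: "h (T \<tau>) = \<tau>" if "\<tau> \<in> {0..b}" for \<tau>
  proof -
    have "inj_on T {0..b}" by (rule inj_onI) (rule inj)
    then show ?thesis unfolding h_def using that by (rule inv_into_f_f)
  qed
  have sub: "{0..t} \<subseteq> T ` {0..b}"
  proof
    fix r assume "r \<in> {0..t}"
    then have "\<exists>\<tau>\<ge>0. \<tau> \<le> b \<and> T \<tau> = r" using Tb T0 b contT by (intro IVT') auto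
    then show "r \<in> T ` {0..b}" by auto
  qed
  have h: "h r \<in> {0..b} \<and> T (h r) = r" if r: "r \<in> {0..t}" for r
  proof -
    obtain \<tau> where "\<tau> \<in> {0..b}" "r = T \<tau>" using sub r by blast
    then show ?thesis using hT by simp
  qed
  have "continuous_on (T ` {0..b}) h"
    by (rule continuous_on_inv[OF contT]) (use hT in auto)
  then have hc: "continuous_on {0..t} h" using sub continuous_on_subset by blast
  show ?thesis
  proof (rule that)
    show "h 0 = 0" using hT[of 0] b by (simp add: T0)
    fix r assume r: "r \<in> {0..t}"
    then show "h r \<ge> 0" using h by auto
    have "F (h r) \<noteq> 0" using c(1) c(2)[of "h r"] h[OF r] by auto
    then show "(h has_vector_derivative 1 / F (h r)) (at r within {0..t})"
      using has_vector_derivative_inverse_within[OF deriv _ h hc r] h[OF r] by blast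
  qed
qed

lemma linear_growth:
  fixes \<phi> :: "real \<Rightarrow> real"
  assumes deriv: "\<And>r. r \<in> {0..t} \<Longrightarrow> (\<phi> has_vector_derivative \<phi>' r) (at r within {0..t})"
    and le: "\<And>r. r \<in> {0..t} \<Longrightarrow> c \<le> \<phi>' r" and r: "0 \<le> r" "r \<le> r'" "r' \<le> t"
  shows "\<phi> r + c * (r' - r) \<le> \<phi> r'"
proof (cases "r = r'")
  case False
  have "\<exists>x\<in>{r<..<r'}. \<phi> r' - \<phi> r = (\<lambda>h. h *\<^sub>R \<phi>' x) (r' - r)"
  proof (rule mvt_simple)
    fix x assume x: "r \<le> x" "x \<le> r'"
    then have "(\<phi> has_vector_derivative \<phi>' x) (at x within {r..r'})"
      using r by (intro has_vector_derivative_within_subset[OF deriv]) auto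
    then show "(\<phi> has_derivative (\<lambda>h. h *\<^sub>R \<phi>' x)) (at x within {r..r'})"
      by (simp add: has_vector_derivative_def)
  qed (use False r in auto)
  then obtain x where x: "r < x" "x < r'" "\<phi> r' - \<phi> r = (r' - r) * \<phi>' x" by auto
  have "(r' - r) * c \<le> (r' - r) * \<phi>' x" using le[of x] x(1,2) r by (intro mult_left_mono) auto
  then show ?thesis using x(3) by (simp add: mult.commute)
qed simp

lemma line_times_simps [simp]:
  "idx (line_times A) = idx A" "dom (line_times A) i = UNIV \<times> dom A i"
  "coord (line_times A) i (s, x) = (s, coord A i x)"
  by (simp_all add: line_times_def)

text \<open>The field \<open>Z\<close> on \<open>\<real> \<times> M\<close> is, up to the positive factor \<open>1 / f\<close>, the field with
  fibre component \<open>g\<close> and base component \<open>X\<close>.  The factor destroys the skew-product form of \<open>Z\<close> but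
  not of its unparametrised trajectories.\<close>

locale expanding_skew_field = compact_lipschitz_field A X
  for A :: "('i, 'm::{t2_space,second_countable_topology}, 'b::euclidean_space) atlas" and X +
  fixes f g :: "real \<Rightarrow> 'm \<Rightarrow> real" and m :: real and Z :: "'i \<Rightarrow> real \<times> 'b \<Rightarrow> real \<times> 'b"
  assumes f_cont: "continuous_on UNIV (\<lambda>(s, x). f s x)"
    and g_cont: "continuous_on UNIV (\<lambda>(s, x). g s x)"
    and f_pos: "\<And>s x. f s x > 0"
    and m: "m > 0" and expand: "\<And>s s' x. s \<le> s' \<Longrightarrow> m * (s' - s) \<le> g s' x - g s x"
    and g_lip: "\<And>S. \<exists>L. \<forall>x. \<forall>s s'. - S \<le> s \<longrightarrow> s \<le> s' \<longrightarrow> s' \<le> S \<longrightarrow> g s' x - g s x \<le> L * (s' - s)"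
    and Z: "\<And>i s x. i \<in> idx A \<Longrightarrow> x \<in> dom A i \<Longrightarrow>
      Z i (s, coord A i x) = (1 / f s x) *\<^sub>R (g s x, X i (coord A i x))"
begin

lemma f_comp: "continuous_on J a \<Longrightarrow> continuous_on J b \<Longrightarrow> continuous_on J (\<lambda>t. f (a t) (b t))"
  using continuous_on_compose2[OF f_cont continuous_on_Pair] by simp

lemma f_bounds:
  obtains c C where "c > 0" "\<And>s x. \<bar>s\<bar> \<le> S \<Longrightarrow> c \<le> f s x \<and> f s x \<le> C"
proof (cases "S \<ge> 0")
  case True
  let ?K = "{-S..S} \<times> (UNIV :: 'm set)" and ?f = "\<lambda>(s, x). f s x"
  have K: "compact ?K" "?K \<noteq> {}" using True by (auto intro!: compact_Times compact_manifold)
  have cont: "continuous_on ?K ?f" using f_cont continuous_on_subset by blast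
  obtain p where p: "\<And>q. q \<in> ?K \<Longrightarrow> ?f p \<le> ?f q" using continuous_attains_inf[OF K cont] by blast
  obtain p' where p': "\<And>q. q \<in> ?K \<Longrightarrow> ?f q \<le> ?f p'" using continuous_attains_sup[OF K cont] by blast
  show ?thesis
  proof (rule that)
    show "?f p > 0" using f_pos by (cases p) auto
    show "?f p \<le> f s x \<and> f s x \<le> ?f p'" if "\<bar>s\<bar> \<le> S" for s x
      using p[of "(s, x)"] p'[of "(s, x)"] that by (auto simp: abs_le_iff)
  qed
qed (use that[of 1 0] in auto)

lemma integral_curve_line_iff:
  "speed_curve (line_times A) Z (\<lambda>_. 1) J (\<lambda>t. (s t, y t)) \<longleftrightarrow>
     (\<forall>t\<in>J. (s has_vector_derivative g (s t) (y t) / f (s t) (y t)) (at t within J)) \<and>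
     speed_curve A X (\<lambda>t. 1 / f (s t) (y t)) J y" (is "?L \<longleftrightarrow> ?R")
proof
  assume L: ?L
  have both: "(s has_vector_derivative g (s t) (y t) / f (s t) (y t)) (at t within J) \<and>
      ((\<lambda>u. coord A i (y u)) has_vector_derivative (1 / f (s t) (y t)) *\<^sub>R X i (coord A i (y t))) (at t within J)"
    if "t \<in> J" "i \<in> idx A" "y t \<in> dom A i" for t i
  proof -
    have "((\<lambda>u. (s u, coord A i (y u))) has_vector_derivative
        (1 / f (s t) (y t)) *\<^sub>R (g (s t) (y t), X i (coord A i (y t)))) (at t within J)"
      using speed_curve_deriv[OF L that(1), of i] that Z[OF that(2,3)] by simp
    note bounded_linear.has_vector_derivative[OF bounded_linear_fst this]
      bounded_linear.has_vector_derivative[OF bounded_linear_snd this]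
    then show ?thesis by simp
  qed
  have "continuous_on J (\<lambda>t. snd (s t, y t))"
    by (intro continuous_on_snd speed_curve_continuous[OF L])
  then have "speed_curve A X (\<lambda>t. 1 / f (s t) (y t)) J y"
    using both by (auto simp: speed_curve_def)
  then show ?R using both smooth_atlas_cover[OF atlas] by blast
next
  assume R: ?R
  then have s: "(s has_vector_derivative g (s t) (y t) / f (s t) (y t)) (at t within J)" if "t \<in> J" for t
    using that by blast
  have "continuous_on J s"
    using s has_vector_derivative_continuous continuous_on_eq_continuous_within by blast
  moreover have "((\<lambda>u. (s u, coord A i (y u))) has_vector_derivative
      1 *\<^sub>R Z i (s t, coord A i (y t))) (at t within J)"
    if "t \<in> J" "i \<in> idx A" "y t \<in> dom A i" for t i
    using has_vector_derivative_Pair[OF s[OF that(1)] speed_curve_deriv[OF R[THEN conjunct2] that]]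
    by (simp add: Z[OF that(2,3)])
  ultimately show ?L
    using R by (auto simp: speed_curve_def intro!: continuous_on_Pair)
qed

lemma mem_backward_flow_image:
  assumes t: "t > 0"
  shows "p \<in> flow_image (line_times A) Z (- t) K \<longleftrightarrow>
    (\<exists>s y. speed_curve (line_times A) Z (\<lambda>_. 1) {0..t} (\<lambda>r. (s r, y r)) \<and> (s 0, y 0) = p \<and> (s t, y t) \<in> K)"
    (is "_ \<longleftrightarrow> ?R")
proof -
  have seg: "closed_segment 0 (- t) = {- t..0}" using t by (auto simp: closed_segment_eq_real_ivl)
  show ?thesis
  proof
    assume "p \<in> flow_image (line_times A) Z (- t) K"
    then obtain \<gamma> where \<gamma>: "speed_curve (line_times A) Z (\<lambda>_. 1) {- t..0} \<gamma>" "p = \<gamma> (- t)" "\<gamma> 0 \<in> K"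
      by (auto simp: flow_image_def integral_curve_iff_unit_speed seg)
    have "speed_curve (line_times A) Z (\<lambda>_. 1) {0..t} (\<lambda>r. (fst (\<gamma> (r + - t)), snd (\<gamma> (r + - t))))"
      using speed_curve_shift[OF \<gamma>(1), of "- t" "{0..t}"] by auto
    then show ?R using \<gamma>(2,3)
      by (intro exI[of _ "\<lambda>r. fst (\<gamma> (r + - t))"] exI[of _ "\<lambda>r. snd (\<gamma> (r + - t))"]) auto
  next
    assume ?R
    then obtain s y where \<gamma>: "speed_curve (line_times A) Z (\<lambda>_. 1) {0..t} (\<lambda>r. (s r, y r))"
      "(s 0, y 0) = p" "(s t, y t) \<in> K" by blast
    have "speed_curve (line_times A) Z (\<lambda>_. 1) {- t..0} (\<lambda>r. (s (r + t), y (r + t)))"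
      using speed_curve_shift[OF \<gamma>(1), of t "{- t..0}"] by auto
    then show "p \<in> flow_image (line_times A) Z (- t) K"
      unfolding flow_image_def integral_curve_iff_unit_speed seg using \<gamma>(2,3)
      by (intro CollectI exI[of _ "\<lambda>r. (s (r + t), y (r + t))"]) auto
  qed
qed

text \<open>The trajectories of \<open>Z\<close> lie over trajectories of \<open>X\<close>, and over a given one the fibre
  coordinate solves a scalar equation with expanding right-hand side.  The graph consists of its
  bounded solutions; the distance of any other solution to the graph never decreases, so as long as
  it is bounded the factor \<open>1 / f\<close> is bounded below and the distance grows at a definite rate.\<close>

theorem bounded_future_graph:
  "\<exists>\<sigma>. continuous_on UNIV \<sigma> \<and>
    (\<Union>K\<in>{K. compact K}. \<Inter>t\<in>{0<..}. flow_image (line_times A) Z (- t) K) = graph_over \<sigma>"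
proof -
  obtain \<sigma> S where \<sigma>: "continuous_on UNIV \<sigma>" and S: "\<And>x. \<bar>\<sigma> x\<bar> \<le> S"
    and inv: "\<And>x t. t \<ge> 0 \<Longrightarrow>
      ((\<lambda>t. \<sigma> (flow t x)) has_vector_derivative g (\<sigma> (flow t x)) (flow t x)) (at t within {0..})"
    using expanding_invariant_graph[OF compact_manifold flow_0 flow_add continuous_on_flow_time
        continuous_on_flow g_cont m expand g_lip] by blast
  have "(\<sigma> x, x) \<in> flow_image (line_times A) Z (- t) ({-S..S} \<times> UNIV)" if t: "t > 0" for x t
  proof -
    obtain c C where c: "c > 0" "\<And>s x. \<bar>s\<bar> \<le> S \<Longrightarrow> c \<le> f s x \<and> f s x \<le> C"
      using f_bounds[of S] by metis
    have F: "continuous_on {0..} (\<lambda>\<tau>. f (\<sigma> (flow \<tau> x)) (flow \<tau> x))"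
      by (intro f_comp continuous_on_flow_time continuous_on_compose2[OF \<sigma>]) auto
    obtain h where h0: "h 0 = 0" and h_ge: "\<And>r. r \<in> {0..t} \<Longrightarrow> h r \<ge> 0"
      and h: "\<And>r. r \<in> {0..t} \<Longrightarrow> (h has_vector_derivative 1 / f (\<sigma> (flow (h r) x)) (flow (h r) x)) (at r within {0..t})"
      using exists_time_change[OF F c(1), of t] c(2)[OF S] t by (metis less_imp_le)
    define y where "y r = flow (h r) x" for r
    define s where "s r = \<sigma> (y r)" for r
    have "compact (h ` {0..t})"
      using h has_vector_derivative_continuous continuous_on_eq_continuous_within
      by (intro compact_continuous_image) (blast | simp)+
    then obtain b where "\<forall>r\<in>h ` {0..t}. norm r \<le> b" using compact_imp_bounded bounded_iff by metis
    then have "\<bar>h r\<bar> \<le> b" if "r \<in> {0..t}" for r using that by auto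
    then have h_le: "h r \<le> b" if "r \<in> {0..t}" for r using that abs_le_D1 by blast
    have "speed_curve A X (\<lambda>r. 1 / f (s r) (y r) * 1) {0..t} y"
      unfolding y_def s_def by (rule speed_curve_reparam[OF speed_curve_flow[of b] h]) (use h_ge h_le in auto)
    moreover have "(s has_vector_derivative g (s r) (y r) / f (s r) (y r)) (at r within {0..t})"
      if r: "r \<in> {0..t}" for r
    proof -
      have "((\<lambda>\<tau>. \<sigma> (flow \<tau> x)) \<circ> h has_vector_derivative
          (1 / f (s r) (y r)) *\<^sub>R g (s r) (y r)) (at r within {0..t})"
        unfolding s_def y_def
        by (rule vector_diff_chain_within[OF h[OF r] has_vector_derivative_within_subset[OF inv]])
           (use h_ge r in auto)
      then show ?thesis by (simp add: o_def s_def[abs_def] y_def)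
    qed
    ultimately have "speed_curve (line_times A) Z (\<lambda>_. 1) {0..t} (\<lambda>r. (s r, y r))"
      by (simp add: integral_curve_line_iff)
    moreover have "(s 0, y 0) = (\<sigma> x, x)" by (simp add: s_def y_def h0)
    moreover have "(s t, y t) \<in> {-S..S} \<times> UNIV" using S[of "y t"] by (auto simp: s_def abs_le_iff)
    ultimately show ?thesis using mem_backward_flow_image[OF t] by blast
  qed
  moreover have "s0 = \<sigma> x"
    if K: "compact K" and p: "\<And>t. t > 0 \<Longrightarrow> (s0, x) \<in> flow_image (line_times A) Z (- t) K" for K s0 x
  proof (rule ccontr)
    assume ne: "s0 \<noteq> \<sigma> x"
    have "compact (fst ` K)" by (intro compact_continuous_image continuous_intros K)
    then obtain R0 where R0: "\<forall>r\<in>fst ` K. norm r \<le> R0" using compact_imp_bounded bounded_iff by metis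
    \<comment> \<open>At time \<open>t\<close> the trajectory is back in \<open>K\<close>, so its distance to the graph is at most \<open>R\<close> there, and
      by monotonicity at all times before; this confines it to heights at most \<open>R + S\<close>, where \<open>f \<le> C\<close>.\<close>
    define R where "R = R0 + S"
    obtain c C where c: "c > 0" "\<And>s x. \<bar>s\<bar> \<le> R + S \<Longrightarrow> c \<le> f s x \<and> f s x \<le> C"
      using f_bounds[of "R + S"] by metis
    define d0 where "d0 = (s0 - \<sigma> x)\<^sup>2"
    have d0: "d0 > 0" using ne by (simp add: d0_def)
    have growth: "0 < C \<and> d0 + 2 * m * d0 / C * t \<le> R\<^sup>2" if t: "t > 0" for t
    proof -
      obtain s y where curve: "speed_curve (line_times A) Z (\<lambda>_. 1) {0..t} (\<lambda>r. (s r, y r))"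
        and start: "s 0 = s0" "y 0 = x" and "(s t, y t) \<in> K"
        using p[OF t] unfolding mem_backward_flow_image[OF t] by auto
      then have end_bound: "\<bar>s t\<bar> \<le> R0" using R0 by force
      have s: "(s has_vector_derivative g (s r) (y r) / f (s r) (y r)) (at r within {0..t})"
        if "r \<in> {0..t}" for r using curve that by (simp add: integral_curve_line_iff)
      have y: "speed_curve A X (\<lambda>r. 1 / f (s r) (y r)) {0..t} y"
        using curve by (simp add: integral_curve_line_iff)
      have cs: "continuous_on {0..t} s"
        using s has_vector_derivative_continuous continuous_on_eq_continuous_within by blast
      define \<theta> where "\<theta> r = 1 / f (s r) (y r)" for r
      have f_ne: "f s x \<noteq> 0" for s x using f_pos[of s x] by simp
      have \<theta>_cont: "continuous_on {0..t} \<theta>" unfolding \<theta>_def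
        by (intro continuous_intros f_comp cs speed_curve_continuous[OF y]) (use f_ne in auto)
      have \<theta>_pos: "\<theta> r > 0" for r using f_pos by (simp add: \<theta>_def)
      define \<Theta> where "\<Theta> r = integral {0..r} \<theta>" for r
      have \<Theta>: "(\<Theta> has_vector_derivative \<theta> r) (at r within {0..t})" if "r \<in> {0..t}" for r
        unfolding \<Theta>_def by (rule integral_has_vector_derivative[OF \<theta>_cont that])
      have \<Theta>_ge: "\<Theta> r \<ge> 0" for r
        unfolding \<Theta>_def using integral_nonneg[of \<theta> "{0..r}"] less_imp_le[OF \<theta>_pos]
        by (cases "\<theta> integrable_on {0..r}") (auto simp: not_integrable_integral)
      have y_eq: "y r = flow (\<Theta> r) x" if "r \<in> {0..t}" for r
        using speed_curve_eq_flow[OF y[folded \<theta>_def] \<theta>_cont _ that] \<theta>_pos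
        by (simp add: start \<Theta>_def less_imp_le)
      define d where "d r = s r - \<sigma> (y r)" for r
      have k: "((\<lambda>r. \<sigma> (y r)) has_vector_derivative \<theta> r * g (\<sigma> (y r)) (y r)) (at r within {0..t})"
        if r: "r \<in> {0..t}" for r
      proof -
        have "((\<lambda>\<tau>. \<sigma> (flow \<tau> x)) \<circ> \<Theta> has_vector_derivative
            \<theta> r *\<^sub>R g (\<sigma> (flow (\<Theta> r) x)) (flow (\<Theta> r) x)) (at r within {0..t})"
          by (rule vector_diff_chain_within[OF \<Theta>[OF r] has_vector_derivative_within_subset[OF inv]])
             (use \<Theta>_ge in auto)
        then have "((\<lambda>\<tau>. \<sigma> (flow \<tau> x)) \<circ> \<Theta> has_vector_derivative \<theta> r * g (\<sigma> (y r)) (y r)) (at r within {0..t})"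
          by (simp add: y_eq[OF r])
        then show ?thesis
          by (rule has_vector_derivative_transform[OF r, rotated]) (simp add: y_eq)
      qed
      define \<phi>' where "\<phi>' r = 2 * d r * (\<theta> r * (g (s r) (y r) - g (\<sigma> (y r)) (y r)))" for r
      have \<phi>: "((\<lambda>r. (d r)\<^sup>2) has_vector_derivative \<phi>' r) (at r within {0..t})" if r: "r \<in> {0..t}" for r
      proof -
        have "(d has_vector_derivative \<theta> r * (g (s r) (y r) - g (\<sigma> (y r)) (y r))) (at r within {0..t})"
          using has_vector_derivative_diff[OF s[OF r] k[OF r]]
          by (simp add: d_def[abs_def] \<theta>_def right_diff_distrib)
        then show ?thesis unfolding \<phi>'_def has_real_derivative_iff_has_vector_derivative[symmetric]
          by (auto intro!: derivative_eq_intros)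
      qed
      have \<phi>'_ge: "2 * m * \<theta> r * (d r)\<^sup>2 \<le> \<phi>' r" for r
      proof -
        have "m * (d r)\<^sup>2 \<le> d r * (g (s r) (y r) - g (\<sigma> (y r)) (y r))"
        proof (cases "\<sigma> (y r) \<le> s r")
          case True
          then have "d r * (m * d r) \<le> d r * (g (s r) (y r) - g (\<sigma> (y r)) (y r))"
            using expand[OF True, of "y r"] by (intro mult_left_mono) (auto simp: d_def)
          then show ?thesis by (simp add: power2_eq_square mult.left_commute)
        next
          case False
          then have "- d r * (m * - d r) \<le> - d r * (g (\<sigma> (y r)) (y r) - g (s r) (y r))"
            using expand[of "s r" "\<sigma> (y r)" "y r"] by (intro mult_left_mono) (auto simp: d_def)
          then show ?thesis by (simp add: power2_eq_square algebra_simps)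
        qed
        then have "2 * \<theta> r * (m * (d r)\<^sup>2) \<le> 2 * \<theta> r * (d r * (g (s r) (y r) - g (\<sigma> (y r)) (y r)))"
          using \<theta>_pos[of r] by (intro mult_left_mono) auto
        then show ?thesis by (simp add: \<phi>'_def mult.assoc mult.left_commute)
      qed
      have \<phi>'_nonneg: "0 \<le> \<phi>' r" for r
      proof -
        have "0 \<le> 2 * m * \<theta> r * (d r)\<^sup>2" using m \<theta>_pos[of r] by (simp add: less_imp_le)
        then show ?thesis using \<phi>'_ge[of r] by linarith
      qed
      have mono: "(d r)\<^sup>2 \<le> (d r')\<^sup>2" if "0 \<le> r" "r \<le> r'" "r' \<le> t" for r r'
        using linear_growth[OF \<phi> \<phi>'_nonneg that] by simp
      have dt: "\<bar>d t\<bar> \<le> R" using end_bound S[of "y t"] by (simp add: d_def R_def)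
      then have R2: "(d t)\<^sup>2 \<le> R\<^sup>2" by (rule power2_le_iff_abs_le[THEN iffD2, rotated]) (use dt in simp)
      have \<theta>_ge: "1 / C \<le> \<theta> r \<and> 0 < C" if "r \<in> {0..t}" for r
      proof -
        have "\<bar>d r\<bar> \<le> R" using mono[of r t] that R2 dt by (simp add: abs_le_square_iff[symmetric])
        then have "\<bar>s r\<bar> \<le> R + S" using S[of "y r"] by (simp add: d_def)
        then have "f (s r) (y r) \<le> C" using c(2) by blast
        then show ?thesis using f_pos[of "s r" "y r"] by (auto simp: \<theta>_def frac_le)
      qed
      have C: "C > 0" using \<theta>_ge[of 0] t by simp
      have start_d: "(d 0)\<^sup>2 = d0" by (simp add: d_def d0_def start)
      have "2 * m * d0 / C \<le> \<phi>' r" if "r \<in> {0..t}" for r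
      proof -
        have "2 * m * d0 / C = 2 * m * (1 / C) * d0" by simp
        also have "\<dots> \<le> 2 * m * \<theta> r * (d r)\<^sup>2"
          using \<theta>_ge[OF that] mono[of 0 r] that m d0 C start_d \<theta>_pos[of r]
          by (intro mult_mono mult_left_mono) (auto simp: less_imp_le)
        also have "\<dots> \<le> \<phi>' r" by (rule \<phi>'_ge)
        finally show ?thesis .
      qed
      then have "d0 + 2 * m * d0 / C * (t - 0) \<le> (d t)\<^sup>2"
        using linear_growth[OF \<phi>, where c = "2 * m * d0 / C" and r = 0 and r' = t] t start_d by simp
      then show ?thesis using R2 C by simp
    qed
    have C: "C > 0" using growth[of 1] by simp
    \<comment> \<open>So late that the linear growth of the squared distance has exceeded its bound.\<close>
    define t where "t = (R\<^sup>2 + 1) * C / (2 * m * d0)"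
    have t: "t > 0" using C m d0 by (simp add: t_def add_nonneg_pos)
    have "2 * m * d0 / C * t = R\<^sup>2 + 1" using C m d0 by (simp add: t_def)
    then show False using growth[OF t] d0 by simp
  qed
  ultimately have "(\<Union>K\<in>{K. compact K}. \<Inter>t\<in>{0<..}. flow_image (line_times A) Z (- t) K) = graph_over \<sigma>"
  proof -
    assume 1: "\<And>t x. t > 0 \<Longrightarrow> (\<sigma> x, x) \<in> flow_image (line_times A) Z (- t) ({-S..S} \<times> UNIV)"
      and 2: "\<And>K s0 x. compact K \<Longrightarrow> (\<And>t. t > 0 \<Longrightarrow> (s0, x) \<in> flow_image (line_times A) Z (- t) K) \<Longrightarrow> s0 = \<sigma> x"
    have "compact ({-S..S} \<times> (UNIV :: 'm set))" by (intro compact_Times compact_manifold) auto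
    then have "(\<sigma> x, x) \<in> (\<Union>K\<in>{K. compact K}. \<Inter>t\<in>{0<..}. flow_image (line_times A) Z (- t) K)" for x
      using 1 by blast
    then show ?thesis using 2 by (force simp: graph_over_def)
  qed
  then show ?thesis using \<sigma> by blast
qed

end

section \<open>Calculus in charts\<close>

lemma smooth_on_imp_Ck: "smooth_on S f \<Longrightarrow> Ck_on k S f"
  by (simp add: smooth_on_def)

lemma smooth_on_differentiable:
  assumes "smooth_on S f" "x \<in> S"
  shows "f differentiable (at x)"
  using smooth_on_imp_Ck[OF assms(1), of "Suc 0", unfolded Ck_on.simps(2)] assms(2) by (rule bspec[OF conjunct1])

lemma smooth_on_derivative:
  assumes "smooth_on S f"
  shows "smooth_on S (\<lambda>x. frechet_derivative f (at x) v)"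
  unfolding smooth_on_def
proof
  fix k show "Ck_on k S (\<lambda>x. frechet_derivative f (at x) v)"
    using smooth_on_imp_Ck[OF assms, of "Suc k", unfolded Ck_on.simps(2)] by (rule conjunct2[THEN spec])
qed

lemma smooth_on_continuous: "smooth_on S f \<Longrightarrow> continuous_on S f"
  using smooth_on_imp_Ck[of S f 0] by simp

lemma smooth_on_has_derivative:
  assumes "smooth_on S f" "x \<in> S"
  shows "(f has_derivative frechet_derivative f (at x)) (at x)"
  using smooth_on_differentiable[OF assms] by (rule frechet_derivative_works[THEN iffD1])

text \<open>Two applications of the mean value theorem to the second difference of \<open>f\<close> along \<open>h u\<close> and
  \<open>h v\<close>.  Exchanging \<open>u\<close> and \<open>v\<close> changes the mixed derivative but not the second difference.\<close>

lemma second_difference_mean_value: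
  fixes f :: "'a::real_normed_vector \<Rightarrow> real"
  assumes f: "\<And>y. y \<in> ball x \<delta> \<Longrightarrow> (f has_derivative f' y) (at y)"
    and fu: "\<And>y. y \<in> ball x \<delta> \<Longrightarrow> ((\<lambda>y. f' y u) has_derivative fu y) (at y)"
    and h: "h > 0" "h * (norm u + norm v) < \<delta>"
  obtains y where "y \<in> ball x \<delta>"
    "f (x + h *\<^sub>R u + h *\<^sub>R v) - f (x + h *\<^sub>R u) - f (x + h *\<^sub>R v) + f x = h * h * fu y v"
proof -
  have in_ball: "x + a *\<^sub>R u + b *\<^sub>R v \<in> ball x \<delta>" if "0 \<le> a" "a \<le> h" "0 \<le> b" "b \<le> h" for a b
  proof -
    have "norm (a *\<^sub>R u + b *\<^sub>R v) \<le> norm (a *\<^sub>R u) + norm (b *\<^sub>R v)" by (rule norm_triangle_ineq)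
    also have "\<dots> \<le> h * norm u + h * norm v" using that by (auto intro!: add_mono mult_right_mono)
    finally have "norm (a *\<^sub>R u + b *\<^sub>R v) < \<delta>" using h by (simp add: distrib_left)
    moreover have "dist x (x + a *\<^sub>R u + b *\<^sub>R v) = norm (a *\<^sub>R u + b *\<^sub>R v)"
      unfolding dist_norm by (subst norm_minus_commute) (simp add: add.assoc)
    ultimately show ?thesis by simp
  qed
  define k where "k a = f (x + a *\<^sub>R u + h *\<^sub>R v) - f (x + a *\<^sub>R u + 0 *\<^sub>R v)" for a
  have "\<exists>a\<in>{0<..<h}. k h - k 0 =
      (\<lambda>t. f' (x + a *\<^sub>R u + h *\<^sub>R v) (t *\<^sub>R u) - f' (x + a *\<^sub>R u + 0 *\<^sub>R v) (t *\<^sub>R u)) (h - 0)"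
  proof (rule mvt_simple[OF h(1)])
    fix a assume a: "0 \<le> a" "a \<le> h"
    have line: "((\<lambda>a. x + a *\<^sub>R u + c *\<^sub>R v) has_derivative (\<lambda>t. t *\<^sub>R u)) (at a within {0..h})" for c
      by (auto intro!: derivative_eq_intros)
    have "((\<lambda>a. f (x + a *\<^sub>R u + c *\<^sub>R v)) has_derivative (\<lambda>t. f' (x + a *\<^sub>R u + c *\<^sub>R v) (t *\<^sub>R u)))
        (at a within {0..h})" if "0 \<le> c" "c \<le> h" for c
      by (rule has_derivative_compose[OF line f]) (use in_ball a that in auto)
    from has_derivative_diff[OF this[of h] this[of 0]] h(1)
    show "(k has_derivative (\<lambda>t. f' (x + a *\<^sub>R u + h *\<^sub>R v) (t *\<^sub>R u) - f' (x + a *\<^sub>R u + 0 *\<^sub>R v) (t *\<^sub>R u)))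
        (at a within {0..h})" by (simp add: k_def[abs_def])
  qed
  then obtain a where a: "0 < a" "a < h"
    and k: "k h - k 0 = f' (x + a *\<^sub>R u + h *\<^sub>R v) (h *\<^sub>R u) - f' (x + a *\<^sub>R u + 0 *\<^sub>R v) (h *\<^sub>R u)" by auto
  have lin: "f' y (h *\<^sub>R u) = h * f' y u" if "y \<in> ball x \<delta>" for y
    using linear_scale[OF has_derivative_linear[OF f[OF that]]] by simp
  have "\<exists>b\<in>{0<..<h}. f' (x + a *\<^sub>R u + h *\<^sub>R v) u - f' (x + a *\<^sub>R u + 0 *\<^sub>R v) u =
      (\<lambda>t. fu (x + a *\<^sub>R u + b *\<^sub>R v) (t *\<^sub>R v)) (h - 0)"
  proof (rule mvt_simple[OF h(1)])
    fix b assume b: "0 \<le> b" "b \<le> h"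
    have line: "((\<lambda>b. x + a *\<^sub>R u + b *\<^sub>R v) has_derivative (\<lambda>t. t *\<^sub>R v)) (at b within {0..h})"
      by (auto intro!: derivative_eq_intros)
    show "((\<lambda>b. f' (x + a *\<^sub>R u + b *\<^sub>R v) u) has_derivative (\<lambda>t. fu (x + a *\<^sub>R u + b *\<^sub>R v) (t *\<^sub>R v)))
        (at b within {0..h})"
      by (rule has_derivative_compose[OF line fu]) (use in_ball a b in auto)
  qed
  then obtain b where b: "0 < b" "b < h" and
    "f' (x + a *\<^sub>R u + h *\<^sub>R v) u - f' (x + a *\<^sub>R u + 0 *\<^sub>R v) u = fu (x + a *\<^sub>R u + b *\<^sub>R v) (h *\<^sub>R v)" by auto
  moreover have "fu (x + a *\<^sub>R u + b *\<^sub>R v) (h *\<^sub>R v) = h * fu (x + a *\<^sub>R u + b *\<^sub>R v) v"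
    using linear_scale[OF has_derivative_linear[OF fu[OF in_ball]], of a b h v] a b by simp
  moreover have "k h - k 0 = h * (f' (x + a *\<^sub>R u + h *\<^sub>R v) u - f' (x + a *\<^sub>R u + 0 *\<^sub>R v) u)"
    unfolding k using lin[OF in_ball[of a h]] lin[OF in_ball[of a 0]] a h(1) by (simp add: right_diff_distrib)
  ultimately have "k h - k 0 = h * h * fu (x + a *\<^sub>R u + b *\<^sub>R v) v" by simp
  moreover have "k h - k 0 = f (x + h *\<^sub>R u + h *\<^sub>R v) - f (x + h *\<^sub>R u) - f (x + h *\<^sub>R v) + f x"
    by (simp add: k_def)
  ultimately show ?thesis using that[OF in_ball[of a b]] a b by simp
qed

lemma second_derivative_symmetric:
  fixes f :: "'a::real_normed_vector \<Rightarrow> real"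
  assumes S: "open S" "x \<in> S"
    and f: "\<And>y. y \<in> S \<Longrightarrow> (f has_derivative f' y) (at y)"
    and fu: "\<And>y. y \<in> S \<Longrightarrow> ((\<lambda>y. f' y u) has_derivative fu y) (at y)"
    and fv: "\<And>y. y \<in> S \<Longrightarrow> ((\<lambda>y. f' y v) has_derivative fv y) (at y)"
    and cont: "continuous_on S (\<lambda>y. fu y v)" "continuous_on S (\<lambda>y. fv y u)"
  shows "fu x v = fv x u"
proof (rule ccontr)
  assume ne: "fu x v \<noteq> fv x u"
  define e where "e = \<bar>fu x v - fv x u\<bar> / 2"
  have e: "e > 0" using ne by (simp add: e_def)
  have near: "\<exists>d>0. \<forall>y\<in>ball x d. y \<in> S \<and> \<bar>k y - k x\<bar> < e" if "continuous_on S k" for k :: "'a \<Rightarrow> real"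
  proof -
    have "isCont k x" using that S by (simp add: continuous_on_eq_continuous_at)
    then obtain d1 where d1: "d1 > 0" "\<And>y. dist y x < d1 \<Longrightarrow> dist (k y) (k x) < e"
      using e unfolding continuous_at_eps_delta by blast
    obtain d2 where d2: "d2 > 0" "ball x d2 \<subseteq> S" using S open_contains_ball by blast
    show ?thesis
      using d1 d2 by (intro exI[of _ "min d1 d2"]) (auto simp: dist_commute dist_real_def)
  qed
  obtain d1 d2 where d1: "d1 > 0" "\<forall>y\<in>ball x d1. y \<in> S \<and> \<bar>fu y v - fu x v\<bar> < e"
    and d2: "d2 > 0" "\<forall>y\<in>ball x d2. y \<in> S \<and> \<bar>fv y u - fv x u\<bar> < e"
    using near[OF cont(1)] near[OF cont(2)] by blast
  define \<delta> where "\<delta> = min d1 d2"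
  define h where "h = \<delta> / (2 * (norm u + norm v + 1))"
  have \<delta>: "\<delta> > 0" "\<And>y. y \<in> ball x \<delta> \<Longrightarrow> y \<in> S" using d1 d2 by (auto simp: \<delta>_def)
  have pos: "norm u + norm v + 1 > 0" by (simp add: add_nonneg_pos)
  have h: "h > 0" using \<delta>(1) pos by (simp add: h_def)
  have "h * (norm u + norm v) \<le> h * (norm u + norm v + 1)" using h by simp
  also have "\<dots> = \<delta> / 2"
  proof -
    define n where "n = norm u + norm v + 1"
    have "n \<noteq> 0" using pos by (simp add: n_def)
    then show ?thesis unfolding h_def n_def[symmetric] by simp
  qed
  finally have small: "h * (norm u + norm v) < \<delta>" "h * (norm v + norm u) < \<delta>"
    using \<delta>(1) by (simp_all add: add.commute)
  obtain y where y: "y \<in> ball x \<delta>"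
    "f (x + h *\<^sub>R u + h *\<^sub>R v) - f (x + h *\<^sub>R u) - f (x + h *\<^sub>R v) + f x = h * h * fu y v"
    using second_difference_mean_value[OF f[OF \<delta>(2)] fu[OF \<delta>(2)] h small(1)] by metis
  obtain z where z: "z \<in> ball x \<delta>"
    "f (x + h *\<^sub>R v + h *\<^sub>R u) - f (x + h *\<^sub>R v) - f (x + h *\<^sub>R u) + f x = h * h * fv z u"
    using second_difference_mean_value[OF f[OF \<delta>(2)] fv[OF \<delta>(2)] h small(2)] by metis
  have "x + h *\<^sub>R v + h *\<^sub>R u = x + h *\<^sub>R u + h *\<^sub>R v" by (simp add: add_ac)
  then have "h * h * fu y v = h * h * fv z u" using y(2) z(2) by (simp only:)
  then have "fu y v = fv z u" using h by simp
  moreover have "\<bar>fu y v - fu x v\<bar> < e" "\<bar>fv z u - fv x u\<bar> < e"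
    using d1 d2 y(1) z(1) by (auto simp: \<delta>_def)
  ultimately show False by (simp add: e_def abs_if split: if_splits)
qed

text \<open>The field whose flow is needed is a rational expression in coefficients of smooth forms and
  their first derivatives; its local Lipschitz property comes from the following closure properties.\<close>

definition lipschitz_near :: "'a::metric_space \<Rightarrow> ('a \<Rightarrow> 'b::metric_space) \<Rightarrow> bool" where
  "lipschitz_near x f \<longleftrightarrow> (\<exists>r>0. \<exists>L. L-lipschitz_on (cball x r) f)"

lemma lipschitz_near_shrink:
  assumes "lipschitz_near x f" "lipschitz_near x g" "e > 0"
  obtains r L M where "r > 0" "r \<le> e" "L-lipschitz_on (cball x r) f" "M-lipschitz_on (cball x r) g"
proof -
  obtain r1 L r2 M where "r1 > 0" "L-lipschitz_on (cball x r1) f" "r2 > 0" "M-lipschitz_on (cball x r2) g"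
    using assms by (auto simp: lipschitz_near_def)
  then show ?thesis
    by (intro that[of "min e (min r1 r2)" L M]) (use assms(3) in \<open>auto elim!: lipschitz_on_subset\<close>)
qed

lemma lipschitz_near_diff:
  fixes f g :: "'a::metric_space \<Rightarrow> 'b::real_normed_vector"
  assumes "lipschitz_near x f" "lipschitz_near x g"
  shows "lipschitz_near x (\<lambda>y. f y - g y)"
  using lipschitz_near_shrink[OF assms zero_less_one] lipschitz_on_diff unfolding lipschitz_near_def by metis

lemma lipschitz_near_add:
  fixes f g :: "'a::metric_space \<Rightarrow> 'b::real_normed_vector"
  assumes "lipschitz_near x f" "lipschitz_near x g"
  shows "lipschitz_near x (\<lambda>y. f y + g y)"
  using lipschitz_near_shrink[OF assms zero_less_one] lipschitz_on_add unfolding lipschitz_near_def by metis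

lemma lipschitz_near_bounded:
  fixes f :: "'a::metric_space \<Rightarrow> 'b::real_normed_vector"
  assumes "L-lipschitz_on (cball x r) f" "y \<in> cball x r"
  shows "norm (f y) \<le> norm (f x) + L * r"
proof -
  have "r \<ge> 0" using assms(2) zero_le_dist[of x y] by (simp del: zero_le_dist)
  then have "norm (f y - f x) \<le> L * dist y x" using lipschitz_onD[OF assms(1,2), of x] by (simp add: dist_norm[of "f y"])
  also have "\<dots> \<le> L * r" using assms by (intro mult_left_mono lipschitz_on_nonneg) (auto simp: dist_commute)
  finally show ?thesis using norm_triangle_sub[of "f y" "f x"] by linarith
qed

lemma lipschitz_near_mult:
  fixes f g :: "'a::metric_space \<Rightarrow> real"
  assumes "lipschitz_near x f" "lipschitz_near x g"
  shows "lipschitz_near x (\<lambda>y. f y * g y)"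
proof -
  from lipschitz_near_shrink[OF assms zero_less_one] obtain r L M
    where r: "r > 0" and f: "L-lipschitz_on (cball x r) f" and g: "M-lipschitz_on (cball x r) g" by metis
  have L: "L \<ge> 0" "M \<ge> 0" using f g lipschitz_on_nonneg by auto
  define F G where "F = norm (f x) + L * r" and "G = norm (g x) + M * r"
  have FG: "F \<ge> 0" "G \<ge> 0" using L r by (auto simp: F_def G_def)
  have "(F * M + G * L)-lipschitz_on (cball x r) (\<lambda>y. f y * g y)"
  proof (rule lipschitz_onI)
    fix y z assume y: "y \<in> cball x r" and z: "z \<in> cball x r"
    have "f y * g y - f z * g z = f y * (g y - g z) + g z * (f y - f z)" by (simp add: algebra_simps)
    then have "dist (f y * g y) (f z * g z) \<le> \<bar>f y * (g y - g z)\<bar> + \<bar>g z * (f y - f z)\<bar>"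
      by (simp add: dist_real_def abs_triangle_ineq)
    also have "\<dots> \<le> F * (M * dist y z) + G * (L * dist y z)"
      unfolding abs_mult F_def G_def
      using lipschitz_near_bounded[OF f y] lipschitz_near_bounded[OF g z]
        lipschitz_onD[OF f y z] lipschitz_onD[OF g y z] L r
      by (intro add_mono mult_mono) (auto simp: dist_real_def)
    finally show "dist (f y * g y) (f z * g z) \<le> (F * M + G * L) * dist y z" by (simp add: algebra_simps)
  qed (use L FG in auto)
  then show ?thesis using r unfolding lipschitz_near_def by blast
qed

lemma lipschitz_near_inverse:
  fixes f :: "'a::metric_space \<Rightarrow> real"
  assumes "lipschitz_near x f" "f x > 0"
  shows "lipschitz_near x (\<lambda>y. inverse (f y))"
proof -
  obtain r0 L where r0: "r0 > 0" "L-lipschitz_on (cball x r0) f" using assms by (auto simp: lipschitz_near_def)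
  then have L: "L \<ge> 0" using lipschitz_on_nonneg by blast
  define c where "c = f x / 2"
  define r where "r = min r0 (c / (L + 1))"
  have c: "c > 0" using assms(2) by (simp add: c_def)
  have r: "r > 0" using r0(1) c L by (simp add: r_def)
  have f: "L-lipschitz_on (cball x r) f" by (rule lipschitz_on_subset[OF r0(2)]) (simp add: r_def subset_cball)
  have "L * r \<le> L * (c / (L + 1))" using L by (intro mult_left_mono) (auto simp: r_def)
  also have "\<dots> \<le> c" using L c by (simp add: field_simps)
  finally have Lr: "L * r \<le> c" .
  have low: "c \<le> f y" if "y \<in> cball x r" for y
  proof -
    have "\<bar>f y - f x\<bar> \<le> L * dist y x" using lipschitz_onD[OF f that, of x] r by (simp add: dist_real_def)
    also have "\<dots> \<le> L * r" using L that by (intro mult_left_mono) (auto simp: dist_commute)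
    finally show ?thesis using Lr by (simp add: c_def)
  qed
  have "(L / (c * c))-lipschitz_on (cball x r) (\<lambda>y. inverse (f y))"
  proof (rule lipschitz_onI)
    fix y z assume y: "y \<in> cball x r" and z: "z \<in> cball x r"
    have pos: "f y > 0" "f z > 0" using low[OF y] low[OF z] c by auto
    then have "inverse (f y) - inverse (f z) = (f z - f y) / (f y * f z)" by (simp add: field_simps)
    then have "dist (inverse (f y)) (inverse (f z)) = dist (f y) (f z) / (f y * f z)"
      using pos by (simp add: dist_real_def abs_divide abs_minus_commute)
    also have "\<dots> \<le> L * dist y z / (c * c)"
      using lipschitz_onD[OF f y z] low[OF y] low[OF z] c L by (intro frac_le mult_mono) auto
    finally show "dist (inverse (f y)) (inverse (f z)) \<le> L / (c * c) * dist y z" by simp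
  qed (use L c in auto)
  then show ?thesis using r unfolding lipschitz_near_def by blast
qed

lemma lipschitz_near_vec3:
  fixes f :: "'a::metric_space \<Rightarrow> real^3"
  assumes "\<And>k. lipschitz_near x (\<lambda>y. f y $ k)"
  shows "lipschitz_near x f"
proof -
  from lipschitz_near_shrink[OF assms[of 1] assms[of 2] zero_less_one] obtain r L1 L2 where 1:
    "r > 0" "L1-lipschitz_on (cball x r) (\<lambda>y. f y $ 1)" "L2-lipschitz_on (cball x r) (\<lambda>y. f y $ 2)" by metis
  from lipschitz_near_shrink[OF assms[of 3] assms[of 3] 1(1)] obtain r' L3 where 2:
    "r' > 0" "r' \<le> r" "L3-lipschitz_on (cball x r') (\<lambda>y. f y $ 3)" by metis
  have L: "L1-lipschitz_on (cball x r') (\<lambda>y. f y $ 1)" "L2-lipschitz_on (cball x r') (\<lambda>y. f y $ 2)"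
    using 1 2 by (auto elim!: lipschitz_on_subset)
  have "(L1 + L2 + L3)-lipschitz_on (cball x r') f"
  proof (rule lipschitz_onI)
    fix y z assume "y \<in> cball x r'" "z \<in> cball x r'"
    note lip = lipschitz_onD[OF L(1) this] lipschitz_onD[OF L(2) this] lipschitz_onD[OF 2(3) this]
    have "dist (f y) (f z) \<le> (\<Sum>k\<in>UNIV. \<bar>(f y - f z) $ k\<bar>)" unfolding dist_norm by (rule norm_le_l1_cart)
    also have "\<dots> \<le> L1 * dist y z + L2 * dist y z + L3 * dist y z"
      using lip by (simp add: sum_3 dist_real_def)
    finally show "dist (f y) (f z) \<le> (L1 + L2 + L3) * dist y z" by (simp add: algebra_simps)
  next
    have "0 \<le> L1" "0 \<le> L2" "0 \<le> L3" using L 2(3) lipschitz_on_nonneg by blast+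
    then show "0 \<le> L1 + L2 + L3" by simp
  qed
  then show ?thesis using 2 unfolding lipschitz_near_def by blast
qed

lemma smooth_on_lipschitz_near:
  fixes f :: "'a::euclidean_space \<Rightarrow> real"
  assumes f: "smooth_on S f" and S: "open S" "x \<in> S"
  shows "lipschitz_near x f"
proof -
  obtain r where r: "r > 0" "cball x r \<subseteq> S" using S open_contains_cball by blast
  let ?D = "\<lambda>y. frechet_derivative f (at y)"
  have deriv: "(f has_derivative ?D y) (at y)" if "y \<in> cball x r" for y
    using smooth_on_has_derivative[OF f] that r by blast
  have "\<exists>C. \<forall>y\<in>cball x r. \<bar>?D y b\<bar> \<le> C" for b
  proof -
    have "continuous_on (cball x r) (\<lambda>y. ?D y b)"
      using smooth_on_continuous[OF smooth_on_derivative[OF f]] r(2) continuous_on_subset by blast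
    then have "bounded ((\<lambda>y. ?D y b) ` cball x r)"
      by (intro compact_imp_bounded compact_continuous_image compact_cball)
    then show ?thesis by (auto simp: bounded_iff)
  qed
  then obtain C where C: "\<And>b y. y \<in> cball x r \<Longrightarrow> \<bar>?D y b\<bar> \<le> C b" by metis
  have C0: "C b \<ge> 0" for b using C[of x b] r by simp
  have "(\<Sum>b\<in>Basis. C b)-lipschitz_on (cball x r) f"
  proof (rule bounded_derivative_imp_lipschitz[of _ f ?D])
    fix y assume y: "y \<in> cball x r"
    show "(f has_derivative ?D y) (at y within cball x r)"
      using deriv[OF y] by (rule has_derivative_at_withinI)
    show "onorm (?D y) \<le> (\<Sum>b\<in>Basis. C b)"
    proof (rule onorm_le)
      fix h
      have lin: "linear (?D y)" using deriv[OF y] by (rule has_derivative_linear)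
      have "?D y h = ?D y (\<Sum>b\<in>Basis. (h \<bullet> b) *\<^sub>R b)" by (simp add: euclidean_representation)
      also have "\<dots> = (\<Sum>b\<in>Basis. (h \<bullet> b) * ?D y b)"
        by (simp add: linear_sum[OF lin] linear_scale[OF lin])
      also have "\<bar>\<dots>\<bar> \<le> (\<Sum>b\<in>Basis. norm h * C b)"
        by (rule order_trans[OF sum_abs sum_mono])
           (auto simp: abs_mult intro!: mult_mono C y Basis_le_norm)
      also have "\<dots> = (\<Sum>b\<in>Basis. C b) * norm h" by (simp add: sum_distrib_left mult.commute)
      finally show "norm (?D y h) \<le> (\<Sum>b\<in>Basis. C b) * norm h" by simp
    qed
  qed (auto intro!: sum_nonneg C0)
  then show ?thesis using r unfolding lipschitz_near_def by blast
qed

section \<open>One-forms in dimension three\<close>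

text \<open>In three dimensions a covector is a vector \<open>p\<close>, acting by \<open>v \<mapsto> p \<bullet> v\<close>, and an alternating
  2-form is a vector \<open>w\<close>, acting by \<open>(u, v) \<mapsto> w \<bullet> (u \<times> v)\<close>.  In these terms the wedge product of a
  1-form and a 2-form is the inner product, and exterior differentiation is the curl.\<close>

definition covector :: "(real^3) form1 \<Rightarrow> real^3 \<Rightarrow> real^3" where
  "covector \<alpha> x = (\<chi> k. \<alpha> x (axis k 1))"

definition curl :: "(real^3) form1 \<Rightarrow> real^3 \<Rightarrow> real^3" where
  "curl \<alpha> x = vector [ext_d \<alpha> x (axis 2 1) (axis 3 1), ext_d \<alpha> x (axis 3 1) (axis 1 1),
                       ext_d \<alpha> x (axis 1 1) (axis 2 1)]"

definition contraction :: "(real^3) form1 \<Rightarrow> (real^3) form1 \<Rightarrow> real^3 \<Rightarrow> real" where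
  "contraction \<alpha> \<beta> x = covector \<alpha> x \<bullet> curl \<beta> x"

definition smooth_form_on :: "(real^3) set \<Rightarrow> (real^3) form1 \<Rightarrow> bool" where
  "smooth_form_on S \<alpha> \<longleftrightarrow> open S \<and> (\<forall>x\<in>S. linear (\<alpha> x)) \<and> (\<forall>v. smooth_on S (\<lambda>x. \<alpha> x v))"

lemma smooth_form_on_open: "smooth_form_on S \<alpha> \<Longrightarrow> open S"
  and smooth_form_on_linear: "smooth_form_on S \<alpha> \<Longrightarrow> x \<in> S \<Longrightarrow> linear (\<alpha> x)"
  and smooth_form_on_smooth: "smooth_form_on S \<alpha> \<Longrightarrow> smooth_on S (\<lambda>x. \<alpha> x v)"
  by (simp_all add: smooth_form_on_def)

abbreviation form_deriv :: "(real^3) form1 \<Rightarrow> real^3 \<Rightarrow> real^3 \<Rightarrow> real^3 \<Rightarrow> real" where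
  "form_deriv \<alpha> x v \<equiv> frechet_derivative (\<lambda>y. \<alpha> y v) (at x)"

lemma linear_sum_axis:
  fixes f :: "real^3 \<Rightarrow> real"
  assumes "linear f"
  shows "f v = (\<Sum>k\<in>UNIV. v $ k * f (axis k 1))"
proof -
  have "f v = f (\<Sum>k\<in>UNIV. v $ k *\<^sub>R axis k 1)"
    using basis_expansion[of v] by (simp add: scalar_mult_eq_scaleR)
  then show ?thesis by (simp add: linear_sum[OF assms] linear_scale[OF assms])
qed

context
  fixes S and \<alpha> :: "(real^3) form1" and x
  assumes \<alpha>: "smooth_form_on S \<alpha>" and x: "x \<in> S"
begin

lemma form_has_derivative: "((\<lambda>y. \<alpha> y v) has_derivative form_deriv \<alpha> x v) (at x)"
  by (rule smooth_on_has_derivative[OF smooth_form_on_smooth[OF \<alpha>] x])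

lemma covector_inner: "\<alpha> x v = covector \<alpha> x \<bullet> v"
  using linear_sum_axis[of "\<alpha> x" v] \<alpha> x
  by (simp add: smooth_form_on_def covector_def inner_vec_def mult.commute)

lemma form_deriv_sum: "form_deriv \<alpha> x v u = (\<Sum>k\<in>UNIV. v $ k * form_deriv \<alpha> x (axis k 1) u)"
proof -
  have "((\<lambda>y. \<Sum>k\<in>UNIV. v $ k * \<alpha> y (axis k 1)) has_derivative
      (\<lambda>u. \<Sum>k\<in>UNIV. v $ k * form_deriv \<alpha> x (axis k 1) u)) (at x)"
    by (intro has_derivative_sum has_derivative_mult_right form_has_derivative)
  then have "((\<lambda>y. \<alpha> y v) has_derivative (\<lambda>u. \<Sum>k\<in>UNIV. v $ k * form_deriv \<alpha> x (axis k 1) u)) (at x)"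
    by (rule has_derivative_transform_within_open[OF _ smooth_form_on_open[OF \<alpha>] x])
       (rule linear_sum_axis[OF smooth_form_on_linear[OF \<alpha>], symmetric])
  from frechet_derivative_at[OF this] show ?thesis by (rule fun_cong[symmetric])
qed

lemma ext_d_curl: "ext_d \<alpha> x u v = curl \<alpha> x \<bullet> cross3 u v"
proof -
  define d where "d k l = form_deriv \<alpha> x (axis k 1) (axis l 1)" for k l
  have lin: "linear (form_deriv \<alpha> x v)" for v
    using form_has_derivative by (rule has_derivative_linear)
  have D: "form_deriv \<alpha> x v u = (\<Sum>k\<in>UNIV. v $ k * (\<Sum>l\<in>UNIV. u $ l * d k l))" for u v
    by (subst form_deriv_sum) (simp add: d_def linear_sum_axis[OF lin, of _ u])
  have "curl \<alpha> x = vector [d 3 2 - d 2 3, d 1 3 - d 3 1, d 2 1 - d 1 2]"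
    by (simp add: curl_def ext_d_def d_def)
  then show ?thesis
    by (simp add: ext_d_def D sum_3 inner_vec_def cross3_def vector_3 algebra_simps)
qed

end

lemma wedge12_contraction:
  assumes \<alpha>: "smooth_form_on S \<alpha>" and \<beta>: "smooth_form_on S \<beta>" and x: "x \<in> S"
  shows "wedge12 \<alpha> (ext_d \<beta>) x u v w = contraction \<alpha> \<beta> x * (u \<bullet> cross3 v w)"
  unfolding wedge12_def ext_d_curl[OF \<beta> x] covector_inner[OF \<alpha> x] contraction_def
  by (simp add: inner_vec_def cross3_def sum_3 vector_3 algebra_simps)

lemma standard_frame_volume: "axis 1 1 \<bullet> cross3 (axis 2 1) (axis 3 1) = (1 :: real)"
  by (simp add: cross_basis inner_axis_axis)

lemma lipschitz_near_covector:
  assumes "smooth_form_on S \<alpha>" "x \<in> S"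
  shows "lipschitz_near x (\<lambda>y. covector \<alpha> y $ k)"
  unfolding covector_def vec_lambda_beta
  by (rule smooth_on_lipschitz_near[OF smooth_form_on_smooth[OF assms(1)] smooth_form_on_open[OF assms(1)] assms(2)])

lemma lipschitz_near_ext_d:
  assumes "smooth_form_on S \<alpha>" "x \<in> S"
  shows "lipschitz_near x (\<lambda>y. ext_d \<alpha> y u v)"
  unfolding ext_d_def using assms
  by (intro lipschitz_near_diff smooth_on_lipschitz_near[of S] smooth_on_derivative)
     (auto simp: smooth_form_on_def)

lemma lipschitz_near_contraction:
  assumes "smooth_form_on S \<alpha>" "smooth_form_on S \<beta>" "x \<in> S"
  shows "lipschitz_near x (contraction \<alpha> \<beta>)"
  unfolding contraction_def[abs_def] inner_vec_def sum_3 inner_real_def curl_def vector_3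
  by (intro lipschitz_near_add lipschitz_near_mult lipschitz_near_covector[OF assms(1,3)]
      lipschitz_near_ext_d[OF assms(2,3)])

lemma lipschitz_near_cross_covector:
  assumes "smooth_form_on S \<alpha>" "smooth_form_on S \<beta>" "x \<in> S"
  shows "lipschitz_near x (\<lambda>y. cross3 (covector \<alpha> y) (covector \<beta> y) $ k)"
proof -
  have "\<forall>k. lipschitz_near x (\<lambda>y. cross3 (covector \<alpha> y) (covector \<beta> y) $ k)"
    unfolding forall_3 cross3_def vector_3
    by (intro conjI lipschitz_near_diff lipschitz_near_mult lipschitz_near_covector[OF assms(1,3)]
        lipschitz_near_covector[OF assms(2,3)])
  then show ?thesis ..
qed

lemma lipschitz_near_isCont: "lipschitz_near x f \<Longrightarrow> isCont f x"
proof -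
  assume "lipschitz_near x f"
  then obtain r L where r: "r > 0" "L-lipschitz_on (cball x r) f" by (auto simp: lipschitz_near_def)
  then have "continuous_on (ball x r) f"
    using lipschitz_on_continuous_on continuous_on_subset ball_subset_cball by blast
  then show ?thesis using r by (simp add: continuous_on_eq_continuous_at)
qed

text \<open>Naturality of the exterior derivative.  Differentiating the pulled back form produces, besides
  the pullback of the derivative, a term with the second derivative of \<open>\<phi>\<close>; it is symmetric and
  cancels under antisymmetrisation.\<close>

lemma ext_d_pullback:
  fixes \<phi> :: "real^3 \<Rightarrow> real^3"
  assumes U: "open U" "x \<in> U" and \<phi>: "smooth_on U \<phi>" "\<phi> ` U \<subseteq> S"
    and \<beta>: "smooth_form_on S \<beta>"
    and pull: "\<And>y v. y \<in> U \<Longrightarrow> \<alpha> y v = \<beta> (\<phi> y) (frechet_derivative \<phi> (at y) v)"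
  shows "ext_d \<alpha> x u v = ext_d \<beta> (\<phi> x) (frechet_derivative \<phi> (at x) u) (frechet_derivative \<phi> (at x) v)"
proof -
  define J where "J y v = frechet_derivative \<phi> (at y) v" for y v
  define H where "H y v u = frechet_derivative (\<lambda>y. J y v) (at y) u" for y v u
  have \<phi>x: "\<phi> x \<in> S" using U \<phi> by blast
  have J: "(\<phi> has_derivative J y) (at y)" if "y \<in> U" for y
    using smooth_on_has_derivative[OF \<phi>(1) that] by (simp add: J_def[abs_def])
  have J_smooth: "smooth_on U (\<lambda>y. J y v)" for v
    unfolding J_def by (rule smooth_on_derivative[OF \<phi>(1)])
  have H: "((\<lambda>y. J y v) has_derivative H y v) (at y)" if "y \<in> U" for y v
    using smooth_on_has_derivative[OF J_smooth that] by (simp add: H_def[abs_def])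
  have H_cont: "continuous_on U (\<lambda>y. H y v u)" for v u
    unfolding H_def by (rule smooth_on_continuous[OF smooth_on_derivative[OF J_smooth]])
  have sym: "H x v u $ k = H x u v $ k" for u v k
    by (rule second_derivative_symmetric[OF U, of "\<lambda>y. \<phi> y $ k" "\<lambda>y v. J y v $ k" v "\<lambda>y u. H y v u $ k" u
          "\<lambda>y v. H y u v $ k"])
       (use J H H_cont in \<open>auto intro!: bounded_linear.has_derivative[OF bounded_linear_vec_nth] continuous_on_component\<close>)
  have deriv: "form_deriv \<alpha> x v u = form_deriv \<beta> (\<phi> x) (J x v) (J x u) + (\<Sum>k\<in>UNIV. \<beta> (\<phi> x) (axis k 1) * H x v u $ k)"
    for u v
  proof -
    have "((\<lambda>y. \<Sum>k\<in>UNIV. \<beta> (\<phi> y) (axis k 1) * J y v $ k) has_derivative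
        (\<lambda>u. \<Sum>k\<in>UNIV. \<beta> (\<phi> x) (axis k 1) * H x v u $ k + form_deriv \<beta> (\<phi> x) (axis k 1) (J x u) * J x v $ k)) (at x)"
      by (intro has_derivative_sum has_derivative_mult bounded_linear.has_derivative[OF bounded_linear_vec_nth] H U
          has_derivative_compose[OF J form_has_derivative[OF \<beta> \<phi>x]])
    then have "((\<lambda>y. \<alpha> y v) has_derivative
        (\<lambda>u. \<Sum>k\<in>UNIV. \<beta> (\<phi> x) (axis k 1) * H x v u $ k + form_deriv \<beta> (\<phi> x) (axis k 1) (J x u) * J x v $ k)) (at x)"
    proof (rule has_derivative_transform_within_open[OF _ U])
      fix y assume y: "y \<in> U"
      then have "linear (\<beta> (\<phi> y))" using \<beta> \<phi>(2) by (auto simp: smooth_form_on_def)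
      from linear_sum_axis[OF this, of "J y v"]
      show "(\<Sum>k\<in>UNIV. \<beta> (\<phi> y) (axis k 1) * J y v $ k) = \<alpha> y v"
        using pull[OF y, of v] by (simp add: J_def mult.commute)
    qed
    from fun_cong[OF frechet_derivative_at[OF this], of u]
    show ?thesis
      by (subst form_deriv_sum[OF \<beta> \<phi>x]) (simp add: sum.distrib mult.commute)
  qed
  show ?thesis unfolding ext_d_def deriv J_def[symmetric] using sym[of v u] by simp
qed

lemma inner_transpose_mult: "(transpose A *v p) \<bullet> v = p \<bullet> (A *v v)" for A :: "real^'n^'n"
  by (simp add: dot_lmul_matrix)

section \<open>The Liouville field of a pair\<close>

lemma ext_d_pair_form:
  assumes m: "smooth_form_on S (\<alpha>m i)" and p: "smooth_form_on S (\<alpha>p i)" and x: "x \<in> S"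
  shows "ext_d (pair_form \<alpha>m \<alpha>p i) (s, x) (a, u) (b, v) =
     a * ((exp s *\<^sub>R covector (\<alpha>p i) x - exp (- s) *\<^sub>R covector (\<alpha>m i) x) \<bullet> v)
   - b * ((exp s *\<^sub>R covector (\<alpha>p i) x - exp (- s) *\<^sub>R covector (\<alpha>m i) x) \<bullet> u)
   + (exp (- s) *\<^sub>R curl (\<alpha>m i) x + exp s *\<^sub>R curl (\<alpha>p i) x) \<bullet> cross3 u v"
proof -
  have deriv: "frechet_derivative (\<lambda>y. pair_form \<alpha>m \<alpha>p i y (b, v)) (at (s, x)) (a, u) =
      a * (exp s * \<alpha>p i x v - exp (- s) * \<alpha>m i x v)
      + (exp (- s) * form_deriv (\<alpha>m i) x v u + exp s * form_deriv (\<alpha>p i) x v u)" for a b u v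
  proof -
    have fst: "(fst has_derivative fst) (at (s, x))" and snd: "(snd has_derivative snd) (at (s, x))"
      by (auto intro!: derivative_eq_intros)
    have form: "((\<lambda>y. \<beta> (snd y) v) has_derivative (\<lambda>z. form_deriv \<beta> x v (snd z))) (at (s, x))"
      if "smooth_form_on S \<beta>" for \<beta>
      using has_derivative_compose[OF snd] form_has_derivative[OF that x] by fastforce
    have "((\<lambda>y. exp (- fst y) * \<alpha>m i (snd y) v + exp (fst y) * \<alpha>p i (snd y) v) has_derivative
        (\<lambda>z. fst z * (exp s * \<alpha>p i x v - exp (- s) * \<alpha>m i x v)
          + (exp (- s) * form_deriv (\<alpha>m i) x v (snd z) + exp s * form_deriv (\<alpha>p i) x v (snd z)))) (at (s, x))"
      by (auto intro!: derivative_eq_intros form[OF m] form[OF p] simp: algebra_simps)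
    moreover have "(\<lambda>y. pair_form \<alpha>m \<alpha>p i y (b, v)) =
        (\<lambda>y. exp (- fst y) * \<alpha>m i (snd y) v + exp (fst y) * \<alpha>p i (snd y) v)"
      by (auto simp: pair_form_def split: prod.splits)
    ultimately have "((\<lambda>y. pair_form \<alpha>m \<alpha>p i y (b, v)) has_derivative
        (\<lambda>z. fst z * (exp s * \<alpha>p i x v - exp (- s) * \<alpha>m i x v)
          + (exp (- s) * form_deriv (\<alpha>m i) x v (snd z) + exp s * form_deriv (\<alpha>p i) x v (snd z)))) (at (s, x))"
      by (simp only:)
    from fun_cong[OF frechet_derivative_at[OF this], of "(a, u)"] show ?thesis by simp
  qed
  show ?thesis
    using ext_d_curl[OF m x, of u v] ext_d_curl[OF p x, of u v]
    unfolding ext_d_def[of "pair_form \<alpha>m \<alpha>p i"] deriv covector_inner[OF m x] covector_inner[OF p x]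
    by (simp add: ext_d_def inner_add_left inner_diff_left algebra_simps)
qed

text \<open>With \<open>\<lambda> = l \<bullet> _\<close>, \<open>d\<lambda> = ds \<and> (n \<bullet> _) + w \<bullet> (_ \<times> _)\<close>, the equation \<open>\<iota>\<^sub>Z d\<lambda> = \<lambda>\<close> is solved by
  \<open>Z = (l \<bullet> w, l \<times> n) / (n \<bullet> w)\<close>; this is the expansion of \<open>w \<times> (n \<times> l)\<close>.\<close>

lemma liouville_equation_solution:
  fixes l n w v :: "real^3"
  assumes "n \<bullet> w \<noteq> 0"
  shows "(l \<bullet> w) / (n \<bullet> w) * (n \<bullet> v) - b * (n \<bullet> ((1 / (n \<bullet> w)) *\<^sub>R cross3 l n))
     + w \<bullet> cross3 ((1 / (n \<bullet> w)) *\<^sub>R cross3 l n) v = l \<bullet> v"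
proof -
  have "(l \<bullet> w) * (n \<bullet> v) + w \<bullet> cross3 (cross3 l n) v = (n \<bullet> w) * (l \<bullet> v)"
    by (simp add: inner_vec_def cross3_def sum_3 vector_3 algebra_simps)
  moreover have "n \<bullet> cross3 l n = 0" by (simp add: dot_cross_self)
  ultimately show ?thesis using assms
    by (simp add: cross_mult_left divide_simps)
qed

section \<open>Behaviour under oriented coordinate changes\<close>

lemma smooth_1form_chart:
  assumes "smooth_atlas M" "smooth_1form M \<alpha>" "i \<in> idx M"
  shows "smooth_form_on (coord M i ` dom M i) (\<alpha> i)"
  using assms smooth_atlas_image[OF assms(1,3)] by (simp add: smooth_1form_def smooth_form_on_def)

context
  fixes M :: "('i, 'm::{t2_space,second_countable_topology}, real^3) atlas" and i j p
  assumes M: "oriented_smooth_atlas M" and i: "i \<in> idx M" "p \<in> dom M i" and j: "j \<in> idx M" "p \<in> dom M j"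
begin

definition jacobian :: "real^3^3" where
  "jacobian = matrix (frechet_derivative (transition M i j) (at (coord M i p)))"

lemma overlap: "coord M i p \<in> coord M i ` (dom M i \<inter> dom M j)" and atlas: "smooth_atlas M"
  using i j M by (auto simp: oriented_smooth_atlas_def)

lemma jacobian_mult: "frechet_derivative (transition M i j) (at (coord M i p)) v = jacobian *v v"
proof -
  have "linear (frechet_derivative (transition M i j) (at (coord M i p)))"
    using smooth_on_has_derivative[OF smooth_atlas_transition[OF atlas i(1) j(1)] overlap]
    by (rule has_derivative_linear)
  then show ?thesis unfolding jacobian_def by (simp add: matrix_works)
qed

lemma det_jacobian_pos: "det jacobian > 0"
  using M i(1) j(1) overlap unfolding oriented_smooth_atlas_def jacobian_def by blast

lemma form_transition:
  assumes "smooth_1form M \<alpha>"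
  shows "\<alpha> i (coord M i p) v = \<alpha> j (coord M j p) (jacobian *v v)"
  using assms i(1) j(1) overlap
  unfolding smooth_1form_def jacobian_mult[symmetric] transition_coord[OF atlas i, of j, symmetric] by blast

lemma ext_d_transition:
  assumes "smooth_1form M \<alpha>"
  shows "ext_d (\<alpha> i) (coord M i p) u v = ext_d (\<alpha> j) (coord M j p) (jacobian *v u) (jacobian *v v)"
  unfolding jacobian_mult[symmetric] transition_coord[OF atlas i, of j, symmetric]
proof (rule ext_d_pullback[OF _ overlap _ _ smooth_1form_chart[OF atlas assms j(1)]])
  show "open (coord M i ` (dom M i \<inter> dom M j))" by (rule smooth_atlas_overlap_open[OF atlas i(1) j(1)])
  show "smooth_on (coord M i ` (dom M i \<inter> dom M j)) (transition M i j)"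
    by (rule smooth_atlas_transition[OF atlas i(1) j(1)])
  show "transition M i j ` coord M i ` (dom M i \<inter> dom M j) \<subseteq> coord M j ` dom M j"
    using transition_coord[OF atlas i(1)] by auto
  show "\<alpha> i y v = \<alpha> j (transition M i j y) (frechet_derivative (transition M i j) (at y) v)"
    if "y \<in> coord M i ` (dom M i \<inter> dom M j)" for y v
    using assms i(1) j(1) that unfolding smooth_1form_def by blast
qed

lemma covector_transition:
  assumes "smooth_1form M \<alpha>"
  shows "covector (\<alpha> i) (coord M i p) = transpose jacobian *v covector (\<alpha> j) (coord M j p)"
proof -
  have "covector (\<alpha> i) (coord M i p) \<bullet> v = (transpose jacobian *v covector (\<alpha> j) (coord M j p)) \<bullet> v" for v
    using form_transition[OF assms, of v] i j
    by (simp only: inner_transpose_mult covector_inner[OF smooth_1form_chart[OF atlas assms i(1)]]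
        covector_inner[OF smooth_1form_chart[OF atlas assms j(1)]] imageI)
  then show ?thesis by (rule vector_eq_rdot[THEN iffD1, OF allI])
qed

text \<open>\<open>\<alpha> \<and> d\<beta>\<close> is natural, and a top-degree form changes by the Jacobian determinant.\<close>

lemma contraction_transition:
  assumes \<alpha>: "smooth_1form M \<alpha>" and \<beta>: "smooth_1form M \<beta>"
  shows "contraction (\<alpha> i) (\<beta> i) (coord M i p) = det jacobian * contraction (\<alpha> j) (\<beta> j) (coord M j p)"
proof -
  let ?w = "\<lambda>i u v w. wedge12 (\<alpha> i) (ext_d (\<beta> i)) (coord M i p) u v w"
  have w: "?w k u v w = contraction (\<alpha> k) (\<beta> k) (coord M k p) * (u \<bullet> cross3 v w)"
    if "k \<in> idx M" "p \<in> dom M k" for k u v w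
    using wedge12_contraction[OF smooth_1form_chart[OF atlas \<alpha> that(1)] smooth_1form_chart[OF atlas \<beta> that(1)]
        imageI[OF that(2)]] .
  have "contraction (\<alpha> i) (\<beta> i) (coord M i p) = ?w i (axis 1 1) (axis 2 1) (axis 3 1)"
    by (simp add: w[OF i] standard_frame_volume)
  also have "\<dots> = ?w j (jacobian *v axis 1 1) (jacobian *v axis 2 1) (jacobian *v axis 3 1)"
    by (simp add: wedge12_def form_transition[OF \<alpha>] ext_d_transition[OF \<beta>])
  also have "\<dots> = contraction (\<alpha> j) (\<beta> j) (coord M j p) *
      ((transpose jacobian *v cross3 (jacobian *v axis 2 1) (jacobian *v axis 3 1)) \<bullet> axis 1 1)"
    unfolding w[OF j] inner_transpose_mult by (simp only: inner_commute)
  also have "\<dots> = det jacobian * contraction (\<alpha> j) (\<beta> j) (coord M j p)"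
    unfolding cross_matrix_mult using standard_frame_volume by (simp add: inner_commute)
  finally show ?thesis .
qed

text \<open>A cross product of covectors is a vector field up to the Jacobian determinant, which is the
  factor that dividing by a volume form compensates.\<close>

lemma cross_covector_transition:
  assumes "smooth_1form M \<alpha>" "smooth_1form M \<beta>"
  shows "jacobian *v cross3 (covector (\<alpha> i) (coord M i p)) (covector (\<beta> i) (coord M i p)) =
    det jacobian *\<^sub>R cross3 (covector (\<alpha> j) (coord M j p)) (covector (\<beta> j) (coord M j p))"
  using cross_matrix_mult[of "transpose jacobian"]
  by (simp only: covector_transition[OF assms(1)] covector_transition[OF assms(2)] transpose_transpose det_transpose)

end

lemma chart_functions_descend:
  fixes A :: "('i, 'm::{t2_space,second_countable_topology}, 'b::euclidean_space) atlas"
    and r :: "'i \<Rightarrow> 'b \<Rightarrow> 'c::topological_space"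
  assumes A: "smooth_atlas A" and cont: "\<And>i x. i \<in> idx A \<Longrightarrow> x \<in> coord A i ` dom A i \<Longrightarrow> isCont (r i) x"
    and consistent: "\<And>i j p. i \<in> idx A \<Longrightarrow> p \<in> dom A i \<Longrightarrow> j \<in> idx A \<Longrightarrow> p \<in> dom A j \<Longrightarrow>
      r i (coord A i p) = r j (coord A j p)"
  shows "\<exists>\<rho>. continuous_on UNIV \<rho> \<and> (\<forall>i\<in>idx A. \<forall>p\<in>dom A i. \<rho> p = r i (coord A i p))"
proof -
  define chart where "chart p = (SOME i. i \<in> idx A \<and> p \<in> dom A i)" for p
  have chart: "chart p \<in> idx A" "p \<in> dom A (chart p)" for p
    using someI_ex[OF smooth_atlas_cover[OF A, unfolded Bex_def], of p] by (auto simp: chart_def)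
  define \<rho> where "\<rho> p = r (chart p) (coord A (chart p) p)" for p
  have \<rho>: "\<rho> p = r i (coord A i p)" if "i \<in> idx A" "p \<in> dom A i" for i p
    unfolding \<rho>_def by (rule consistent[OF chart that])
  have "continuous_on (\<Union>i\<in>idx A. dom A i) \<rho>"
  proof (rule continuous_on_open_UN)
    fix i assume i: "i \<in> idx A"
    show "open (dom A i)" by (rule smooth_atlas_dom[OF A i])
    have "continuous_on (coord A i ` dom A i) (r i)"
      using cont[OF i] by (intro continuous_at_imp_continuous_on) blast
    then have "continuous_on (dom A i) (\<lambda>p. r i (coord A i p))"
      by (rule continuous_on_compose2[OF _ homeomorphism_cont1[OF smooth_atlas_homeo[OF A i]]]) simp
    then show "continuous_on (dom A i) \<rho>" using \<rho>[OF i] by (simp cong: continuous_on_cong)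
  qed
  moreover have "(\<Union>i\<in>idx A. dom A i) = UNIV" using smooth_atlas_cover[OF A] by auto
  ultimately have "continuous_on UNIV \<rho>" by simp
  then show ?thesis using \<rho> by (intro exI[of _ \<rho>]) simp
qed

section \<open>The skeleton of a Liouville pair\<close>

lemma mean_value_increment:
  fixes G :: "real \<Rightarrow> real"
  assumes "\<And>s. (G has_real_derivative G' s) (at s)" "s \<le> s'"
  shows "\<exists>z. s \<le> z \<and> z \<le> s' \<and> G s' - G s = G' z * (s' - s)"
proof (cases "s = s'")
  case True then show ?thesis by (intro exI[of _ s]) simp
next
  case False
  then obtain z where "s < z" "z < s'" "G s' - G s = (s' - s) * G' z"
    using MVT2[of s s' G G'] assms by auto
  then show ?thesis by (intro exI[of _ z]) (simp add: mult.commute)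
qed

locale liouville_pair_manifold =
  fixes M :: "('i, 'm::{t2_space,second_countable_topology}, real^3) atlas"
    and \<alpha>m \<alpha>p :: "'i \<Rightarrow> (real^3) form1"
  assumes closed: "closed_connected_oriented_3_manifold M"
    and pair: "liouville_pair M \<alpha>m \<alpha>p"
begin

lemma oriented: "oriented_smooth_atlas M" and atlas: "smooth_atlas M" and compact: "compact (UNIV :: 'm set)"
  using closed by (auto simp: closed_connected_oriented_3_manifold_def oriented_smooth_atlas_def)

lemma forms: "smooth_1form M \<alpha>m" "smooth_1form M \<alpha>p"
  using pair by (auto simp: liouville_pair_def)

lemmas forms_in_chart = forms[THEN smooth_1form_chart[OF atlas]]

abbreviation vol :: "'i \<Rightarrow> real^3 \<Rightarrow> real" where
  "vol i \<equiv> contraction (\<alpha>p i) (\<alpha>p i)"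

lemma vol_pos: "i \<in> idx M \<Longrightarrow> x \<in> coord M i ` dom M i \<Longrightarrow> vol i x > 0"
  using pair wedge12_contraction[OF forms_in_chart(2) forms_in_chart(2)]
  by (force simp: liouville_pair_def positive_3form_def standard_frame_volume)

lemma contraction_minus_neg:
  "i \<in> idx M \<Longrightarrow> x \<in> coord M i ` dom M i \<Longrightarrow> contraction (\<alpha>m i) (\<alpha>m i) x < 0"
  using pair wedge12_contraction[OF forms_in_chart(1) forms_in_chart(1)]
  by (force simp: liouville_pair_def negative_3form_def standard_frame_volume)

text \<open>The section of \<open>ker \<alpha>\<^sub>- \<inter> ker \<alpha>\<^sub>+\<close> whose contraction with the volume form \<open>\<alpha>\<^sub>+ \<and> d\<alpha>\<^sub>+\<close> is
  \<open>2 \<alpha>\<^sub>- \<and> \<alpha>\<^sub>+\<close>; it vanishes where the two forms are proportional.\<close>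

definition kernel_field :: "'i \<Rightarrow> real^3 \<Rightarrow> real^3" where
  "kernel_field i x = (2 / vol i x) *\<^sub>R cross3 (covector (\<alpha>m i) x) (covector (\<alpha>p i) x)"

lemma kernel_field_covariant:
  assumes i: "i \<in> idx M" "p \<in> dom M i" and j: "j \<in> idx M" "p \<in> dom M j"
  shows "frechet_derivative (transition M i j) (at (coord M i p)) (kernel_field i (coord M i p)) =
    kernel_field j (coord M j p)"
  using det_jacobian_pos[OF oriented i j]
  unfolding kernel_field_def jacobian_mult[OF oriented i j] matrix_vector_mult_scaleR
    cross_covector_transition[OF oriented i j forms] contraction_transition[OF oriented i j forms(2) forms(2)]
  by simp

lemma kernel_field_lipschitz_near:
  assumes "i \<in> idx M" "x \<in> coord M i ` dom M i"
  shows "lipschitz_near x (kernel_field i)"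
proof (rule lipschitz_near_vec3)
  fix k
  have "lipschitz_near x (\<lambda>y. 2 :: real)"
    unfolding lipschitz_near_def by (intro exI[of _ "1::real"] conjI exI[of _ "0::real"] lipschitz_on_constant) simp
  then have "lipschitz_near x (\<lambda>y. 2 * inverse (vol i y) * cross3 (covector (\<alpha>m i) y) (covector (\<alpha>p i) y) $ k)"
    using vol_pos[OF assms]
    by (intro lipschitz_near_mult lipschitz_near_inverse
        lipschitz_near_contraction[OF forms_in_chart(2)[OF assms(1)] forms_in_chart(2)[OF assms(1)] assms(2)]
        lipschitz_near_cross_covector[OF forms_in_chart[OF assms(1)] assms(2)])
  then show "lipschitz_near x (\<lambda>y. kernel_field i y $ k)"
    by (simp add: kernel_field_def divide_inverse)
qed

sublocale compact_lipschitz_field M kernel_field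
proof
  show "smooth_atlas M" "compact (UNIV :: 'm set)" by (rule atlas, rule compact)
  show "frechet_derivative (transition M i j) (at (coord M i p)) (kernel_field i (coord M i p)) =
    kernel_field j (coord M j p)"
    if "i \<in> idx M" "j \<in> idx M" "p \<in> dom M i" "p \<in> dom M j" for i j p
    by (rule kernel_field_covariant) (use that in auto)
  show "\<exists>r>0. \<exists>L. cball \<xi> r \<subseteq> coord M i ` dom M i \<and> L-lipschitz_on (cball \<xi> r) (kernel_field i)"
    if i: "i \<in> idx M" "\<xi> \<in> coord M i ` dom M i" for i \<xi>
  proof -
    obtain e where "e > 0" "cball \<xi> e \<subseteq> coord M i ` dom M i"
      using smooth_atlas_image[OF atlas i(1)] i(2) open_contains_cball by blast
    moreover from lipschitz_near_shrink[OF kernel_field_lipschitz_near[OF i] kernel_field_lipschitz_near[OF i] this(1)]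
    obtain r L where "r > 0" "r \<le> e" "L-lipschitz_on (cball \<xi> r) (kernel_field i)" by metis
    ultimately show ?thesis using subset_cball[of r e \<xi>] by blast
  qed
qed

text \<open>In charts, \<open>\<alpha> \<and> d\<beta>\<close> and \<open>\<alpha>\<^sub>+ \<and> d\<alpha>\<^sub>+\<close> both scale with the Jacobian determinant, so their quotient
  is a function on the manifold.\<close>

lemma ratio_function:
  assumes \<alpha>: "smooth_1form M \<alpha>" and \<beta>: "smooth_1form M \<beta>"
  shows "\<exists>\<rho> :: 'm \<Rightarrow> real. continuous_on UNIV \<rho> \<and> (\<forall>i\<in>idx M. \<forall>p\<in>dom M i.
      contraction (\<alpha> i) (\<beta> i) (coord M i p) = vol i (coord M i p) * \<rho> p)"
proof -
  define r where "r i x = contraction (\<alpha> i) (\<beta> i) x / vol i x" for i x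
  have "\<exists>\<rho>. continuous_on UNIV \<rho> \<and> (\<forall>i\<in>idx M. \<forall>p\<in>dom M i. \<rho> p = r i (coord M i p))"
  proof (rule chart_functions_descend[OF atlas, of r])
    fix i x assume ix: "i \<in> idx M" "x \<in> coord M i ` dom M i"
    show "isCont (r i) x"
      unfolding r_def[abs_def]
      by (intro continuous_divide lipschitz_near_isCont lipschitz_near_contraction[of "coord M i ` dom M i"]
          smooth_1form_chart[OF atlas] \<alpha> \<beta> forms ix) (use vol_pos[OF ix] in simp)
  next
    fix i j p assume ij: "i \<in> idx M" "p \<in> dom M i" "j \<in> idx M" "p \<in> dom M j"
    show "r i (coord M i p) = r j (coord M j p)"
      using det_jacobian_pos[OF oriented ij]
      unfolding r_def contraction_transition[OF oriented ij \<alpha> \<beta>] contraction_transition[OF oriented ij forms(2) forms(2)]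
      by simp
  qed
  then obtain \<rho> where \<rho>: "continuous_on UNIV \<rho>" "\<forall>i\<in>idx M. \<forall>p\<in>dom M i. \<rho> p = r i (coord M i p)" by blast
  have "contraction (\<alpha> i) (\<beta> i) (coord M i p) = vol i (coord M i p) * \<rho> p"
    if ip: "i \<in> idx M" "p \<in> dom M i" for i p
    using vol_pos[OF ip(1) imageI[OF ip(2)]] \<rho>(2) ip by (simp add: r_def)
  then show ?thesis using \<rho>(1) by blast
qed

theorem skeleton_graph:
  "\<exists>\<sigma>. continuous_on UNIV \<sigma> \<and> skeleton (line_times M) (pair_form \<alpha>m \<alpha>p) = graph_over \<sigma>"
proof -
  obtain \<rho>mm where \<rho>mm: "continuous_on UNIV \<rho>mm" "\<And>i p. i \<in> idx M \<Longrightarrow> p \<in> dom M i \<Longrightarrow>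
    contraction (\<alpha>m i) (\<alpha>m i) (coord M i p) = vol i (coord M i p) * \<rho>mm p"
    using ratio_function[OF forms(1,1)] by blast
  obtain \<rho>mp where \<rho>mp: "continuous_on UNIV \<rho>mp" "\<And>i p. i \<in> idx M \<Longrightarrow> p \<in> dom M i \<Longrightarrow>
    contraction (\<alpha>m i) (\<alpha>p i) (coord M i p) = vol i (coord M i p) * \<rho>mp p"
    using ratio_function[OF forms(1,2)] by blast
  obtain \<rho>pm where \<rho>pm: "continuous_on UNIV \<rho>pm" "\<And>i p. i \<in> idx M \<Longrightarrow> p \<in> dom M i \<Longrightarrow>
    contraction (\<alpha>p i) (\<alpha>m i) (coord M i p) = vol i (coord M i p) * \<rho>pm p"
    using ratio_function[OF forms(2,1)] by blast
  \<comment> \<open>The coefficients of the Liouville field: \<open>Z = (g \<partial>/\<partial>s + X) / f\<close>, with \<open>X\<close> the kernel field.\<close>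
  define a where "a p = - \<rho>mm p" for p
  define f where "f s p = exp (2 * s) + a p * exp (- 2 * s) + (\<rho>pm p - \<rho>mp p)" for s p
  define g where "g s p = exp (2 * s) - a p * exp (- 2 * s) + (\<rho>pm p + \<rho>mp p)" for s p
  have a_cont: "continuous_on UNIV a" unfolding a_def by (intro continuous_intros \<rho>mm(1))
  have a_pos: "a p > 0" for p
  proof -
    obtain i where i: "i \<in> idx M" "p \<in> dom M i" using smooth_atlas_cover[OF atlas] by blast
    have "vol i (coord M i p) * \<rho>mm p < 0" "vol i (coord M i p) > 0"
      using contraction_minus_neg[OF i(1) imageI[OF i(2)]] vol_pos[OF i(1) imageI[OF i(2)]] \<rho>mm(2)[OF i] by auto
    then show ?thesis by (simp add: a_def mult_less_0_iff)
  qed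
  obtain p0 where p0: "\<And>p. a p0 \<le> a p" using continuous_attains_inf[OF compact _ a_cont] by auto
  obtain p1 where p1: "\<And>p. a p \<le> a p1" using continuous_attains_sup[OF compact _ a_cont] by auto
  \<comment> \<open>A lower bound for the derivative of \<open>g\<close> in \<open>s\<close>, as one of \<open>exp (2 * s)\<close>, \<open>exp (- 2 * s)\<close> is at least 1.\<close>
  define m where "m = 2 * min 1 (a p0)"
  have m: "m > 0" using a_pos[of p0] by (simp add: m_def)
  define g' where "g' s p = 2 * (exp (2 * s) + a p * exp (- 2 * s))" for s p
  have g_deriv: "((\<lambda>s. g s p) has_real_derivative g' s p) (at s)" for s p
    unfolding g_def g'_def by (auto intro!: derivative_eq_intros)
  have expand: "m * (s' - s) \<le> g s' p - g s p" if ss: "s \<le> s'" for s s' p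
  proof -
    obtain z where z: "g s' p - g s p = g' z p * (s' - s)"
      using mean_value_increment[of "\<lambda>s. g s p" "\<lambda>s. g' s p", OF g_deriv ss] by blast
    have "min 1 (a p0) * 1 \<le> min 1 (a p0) * (exp (2 * z) + exp (- 2 * z))"
    proof (rule mult_left_mono)
      have "1 \<le> exp (2 * z) \<or> 1 \<le> exp (- 2 * z)" unfolding one_le_exp_iff by auto
      then show "1 \<le> exp (2 * z) + exp (- 2 * z)"
        using exp_gt_zero[of "2 * z"] exp_gt_zero[of "- 2 * z"] by linarith
    qed (use a_pos[of p0] in simp)
    also have "\<dots> = min 1 (a p0) * exp (2 * z) + min 1 (a p0) * exp (- 2 * z)" by (simp add: distrib_left)
    also have "\<dots> \<le> 1 * exp (2 * z) + a p * exp (- 2 * z)"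
      using p0[of p] by (intro add_mono mult_right_mono) auto
    finally have "m \<le> g' z p" by (simp add: m_def g'_def)
    then show ?thesis unfolding z using ss by (intro mult_right_mono) auto
  qed
  have g_lip: "\<exists>L. \<forall>p. \<forall>s s'. - S \<le> s \<longrightarrow> s \<le> s' \<longrightarrow> s' \<le> S \<longrightarrow> g s' p - g s p \<le> L * (s' - s)" for S
  proof (intro exI allI impI)
    fix p s s' assume s: "- S \<le> s" "s \<le> s'" "s' \<le> S"
    obtain z where z: "s \<le> z" "z \<le> s'" "g s' p - g s p = g' z p * (s' - s)"
      using mean_value_increment[of "\<lambda>s. g s p" "\<lambda>s. g' s p", OF g_deriv s(2)] by blast
    have "g' z p \<le> 2 * (exp (2 * S) + a p1 * exp (2 * S))"
      unfolding g'_def using z s p1[of p] a_pos[of p1]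
      by (intro mult_left_mono add_mono mult_mono) (auto simp: less_imp_le)
    then show "g s' p - g s p \<le> (2 * (exp (2 * S) + a p1 * exp (2 * S))) * (s' - s)"
      unfolding z(3) using s(2) by (intro mult_right_mono) auto
  qed
  \<comment> \<open>In the chart \<open>i\<close>: the covector of the contraction of \<open>d\<lambda>\<close> with \<open>\<partial>/\<partial>s\<close>, the covector of \<open>\<lambda>\<close>, and the
    vector of the part of \<open>d\<lambda>\<close> without \<open>ds\<close>.\<close>
  define n where "n i s x = exp s *\<^sub>R covector (\<alpha>p i) x - exp (- s) *\<^sub>R covector (\<alpha>m i) x" for i s x
  define l where "l i s x = exp s *\<^sub>R covector (\<alpha>p i) x + exp (- s) *\<^sub>R covector (\<alpha>m i) x" for i s x
  define w where "w i s x = exp (- s) *\<^sub>R curl (\<alpha>m i) x + exp s *\<^sub>R curl (\<alpha>p i) x" for i s x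
  have exp2: "exp s * exp (- s) = 1" "exp (- s) * exp s = 1" "exp s * exp s = exp (2 * s)"
    "exp (- s) * exp (- s) = exp (- 2 * s)" for s :: real
    by (simp_all add: exp_add[symmetric])
  have nw: "n i s (coord M i p) \<bullet> w i s (coord M i p) = vol i (coord M i p) * f s p"
    and lw: "l i s (coord M i p) \<bullet> w i s (coord M i p) = vol i (coord M i p) * g s p"
    if "i \<in> idx M" "p \<in> dom M i" for i p s
  proof -
    note c = \<rho>mm(2)[OF that] \<rho>mp(2)[OF that] \<rho>pm(2)[OF that]
    let ?c = "\<lambda>\<alpha> \<beta>. contraction (\<alpha> i) (\<beta> i) (coord M i p)"
    have "n i s (coord M i p) \<bullet> w i s (coord M i p) =
        exp s * exp s * ?c \<alpha>p \<alpha>p - exp (- s) * exp (- s) * ?c \<alpha>m \<alpha>m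
        + exp s * exp (- s) * (?c \<alpha>p \<alpha>m - ?c \<alpha>m \<alpha>p)"
      by (simp add: n_def w_def contraction_def inner_add_left inner_add_right inner_diff_left algebra_simps)
    then show "n i s (coord M i p) \<bullet> w i s (coord M i p) = vol i (coord M i p) * f s p"
      unfolding c exp2 by (simp add: f_def a_def algebra_simps)
    have "l i s (coord M i p) \<bullet> w i s (coord M i p) =
        exp s * exp s * ?c \<alpha>p \<alpha>p + exp (- s) * exp (- s) * ?c \<alpha>m \<alpha>m
        + exp s * exp (- s) * (?c \<alpha>p \<alpha>m + ?c \<alpha>m \<alpha>p)"
      by (simp add: l_def w_def contraction_def inner_add_left inner_add_right algebra_simps)
    then show "l i s (coord M i p) \<bullet> w i s (coord M i p) = vol i (coord M i p) * g s p"
      unfolding c exp2 by (simp add: g_def a_def algebra_simps)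
  qed
  have d_lam: "ext_d (pair_form \<alpha>m \<alpha>p i) (s, x) (b, u) (b', v) =
      b * (n i s x \<bullet> v) - b' * (n i s x \<bullet> u) + w i s x \<bullet> cross3 u v"
    if "i \<in> idx M" "x \<in> coord M i ` dom M i" for i s x b u b' v
    unfolding n_def w_def by (rule ext_d_pair_form[of _ \<alpha>m i \<alpha>p, OF forms_in_chart[OF that(1)] that(2)])

  have f_pos: "f s p > 0" for s p
  proof -
    obtain i where i: "i \<in> idx M" "p \<in> dom M i" using smooth_atlas_cover[OF atlas] by blast
    let ?x = "coord M i p"
    have "wedge22 (ext_d (pair_form \<alpha>m \<alpha>p i)) (ext_d (pair_form \<alpha>m \<alpha>p i)) (s, ?x)
        (1, 0) (0, axis 1 1) (0, axis 2 1) (0, axis 3 1) > 0"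
      using pair i
      unfolding liouville_pair_def positive_liouville_form_def positive_4form_def by simp
    also have "wedge22 (ext_d (pair_form \<alpha>m \<alpha>p i)) (ext_d (pair_form \<alpha>m \<alpha>p i)) (s, ?x)
        (1, 0) (0, axis 1 1) (0, axis 2 1) (0, axis 3 1) = 2 * (n i s ?x \<bullet> w i s ?x)"
      unfolding wedge22_def d_lam[OF i(1) imageI[OF i(2)]]
      by (simp add: cross_basis inner_axis inner_vec_def[of "n i s ?x" "w i s ?x"] sum_3)
    finally show ?thesis
      using nw[OF i, of s] vol_pos[OF i(1) imageI[OF i(2)]] by (simp add: zero_less_mult_iff)
  qed
  have Z: "liouville_vector_field (pair_form \<alpha>m \<alpha>p) i (s, coord M i p) =
      (1 / f s p) *\<^sub>R (g s p, kernel_field i (coord M i p))" (is "_ = ?Z")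
    if i: "i \<in> idx M" "p \<in> dom M i" for i s p
  proof -
    let ?x = "coord M i p"
    note x = i(1) imageI[OF i(2)]
    have vol: "vol i ?x > 0" by (rule vol_pos[OF x])
    have nz: "n i s ?x \<bullet> w i s ?x \<noteq> 0" using nw[OF i, of s] f_pos[of s p] vol by simp
    have "cross3 (l i s ?x) (n i s ?x) =
        (2 * (exp s * exp (- s))) *\<^sub>R cross3 (covector (\<alpha>m i) ?x) (covector (\<alpha>p i) ?x)"
      unfolding l_def n_def
      by (simp add: cross3_def vec_eq_iff forall_3 vector_3 algebra_simps)
    then have ln: "cross3 (l i s ?x) (n i s ?x) = vol i ?x *\<^sub>R kernel_field i ?x"
      using vol by (simp add: kernel_field_def exp2)
    have Z_eq: "?Z = ((l i s ?x \<bullet> w i s ?x) / (n i s ?x \<bullet> w i s ?x),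
        (1 / (n i s ?x \<bullet> w i s ?x)) *\<^sub>R cross3 (l i s ?x) (n i s ?x))"
      using vol f_pos[of s p] unfolding nw[OF i] lw[OF i] ln by simp
    have solves: "ext_d (pair_form \<alpha>m \<alpha>p i) (s, ?x) ?Z (b, v) = pair_form \<alpha>m \<alpha>p i (s, ?x) (b, v)" for b v
      unfolding Z_eq d_lam[OF x] liouville_equation_solution[OF nz]
      by (simp add: pair_form_def l_def inner_add_left covector_inner[OF forms_in_chart(1)[OF x(1)] x(2)]
          covector_inner[OF forms_in_chart(2)[OF x(1)] x(2)])
    show ?thesis unfolding liouville_vector_field_def
    proof (rule the_equality)
      show "\<forall>y. ext_d (pair_form \<alpha>m \<alpha>p i) (s, ?x) ?Z y = pair_form \<alpha>m \<alpha>p i (s, ?x) y"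
        using solves by auto
      fix z assume z: "\<forall>y. ext_d (pair_form \<alpha>m \<alpha>p i) (s, ?x) z y = pair_form \<alpha>m \<alpha>p i (s, ?x) y"
      have "ext_d (pair_form \<alpha>m \<alpha>p i) (s, ?x) (z - ?Z) y = 0" for y
      proof -
        have "ext_d (pair_form \<alpha>m \<alpha>p i) (s, ?x) (z - z') y =
            ext_d (pair_form \<alpha>m \<alpha>p i) (s, ?x) z y - ext_d (pair_form \<alpha>m \<alpha>p i) (s, ?x) z' y" for z'
          by (cases z, cases z', cases y)
             (simp add: d_lam[OF x] inner_diff_right Cross3.left_diff_distrib algebra_simps)
        then show ?thesis using z solves by (cases y) simp
      qed
      moreover have "\<forall>u. (\<forall>v. ext_d (pair_form \<alpha>m \<alpha>p i) (s, ?x) u v = 0) \<longrightarrow> u = 0"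
        using pair i unfolding liouville_pair_def positive_liouville_form_def nondegenerate_2form_def by simp
      ultimately have "z - ?Z = 0" by blast
      then show "z = ?Z" by (simp only: right_minus_eq)
    qed
  qed
  have comp: "continuous_on UNIV (\<lambda>(s::real, p). r p)" if "continuous_on UNIV r" for r :: "'m \<Rightarrow> real"
    unfolding case_prod_beta by (rule continuous_on_compose2[OF that]) (auto intro: continuous_intros)
  interpret expanding_skew_field M kernel_field f g m "liouville_vector_field (pair_form \<alpha>m \<alpha>p)"
  proof
    show "continuous_on UNIV (\<lambda>(s, p). f s p)" "continuous_on UNIV (\<lambda>(s, p). g s p)"
      unfolding f_def g_def case_prod_beta
      by (intro continuous_intros comp[unfolded case_prod_beta] a_cont \<rho>mp(1) \<rho>pm(1))+
  qed (use f_pos m expand g_lip Z in auto)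
  show ?thesis unfolding skeleton_def by (rule bounded_future_graph)
qed

end

theorem proposition1:
  fixes M :: "('i, 'm::{t2_space,second_countable_topology}, real^3) atlas"
    and \<alpha>m \<alpha>p :: "'i \<Rightarrow> (real^3) form1"
  assumes "closed_connected_oriented_3_manifold M"
    and "liouville_pair M \<alpha>m \<alpha>p"
  shows "\<exists>\<sigma> :: 'm \<Rightarrow> real. continuous_on UNIV \<sigma> \<and>
           skeleton (line_times M) (pair_form \<alpha>m \<alpha>p) = graph_over \<sigma>"
proof -
  interpret liouville_pair_manifold M \<alpha>m \<alpha>p by standard (fact assms)+
  show ?thesis by (rule skeleton_graph)
qed

end
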